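(* Let $n\ge2$, $G=\operatorname{PGL}_n(\mathbb R)$, $\Gamma=\operatorname{PGL}_n(\mathbb Z)$, $X=\Gamma\backslash G$, $H$ the diagonal subgroup. There exist a sequence of periodic $H$-orbits $x_iH$ in $X$ and constants $\alpha,\delta>0$ such that (1) every weak$^*$ limit of the $H$-invariant probability measures $\mu_{x_iH}$ on $x_iH$ has total mass $<1-\delta$; (2) the total volume of the orbits $x_iH$ with $\operatorname{disc}(x_iH)<D$ is $\gg D^\alpha$.
   Context: Periodic $H$-orbit = compact $H$-orbit; volume = covolume of $g^{-1}\Gamma g\cap H$ in $H$ for a fixed Haar measure. Discriminant of periodic $\Gamma gH$: $\det(B(e_i,e_j))$ for a $\mathbb Z$-basis $(e_i)$ of $\operatorname{Ad}(g)\mathfrak h\cap\mathfrak g_{\mathbb Z}$, with $\mathfrak g=M_n(\mathbb Q)/\mathbb QI$, $\mathfrak g_{\mathbb Z}$ the image of $M_n(\mathbb Z)$, $B(X,Y)=\operatorname{tr}(1)\operatorname{tr}(XY)-\operatorname{tr}(X)\operatorname{tr}(Y)$ (tr = trace of left multiplication on $M_n(\mathbb Q)$). Weak$^*$ limits are taken against compactly supported continuous functions on the noncompact space $X$. *)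

theory Defs
  imports "HOL-Analysis.Analysis" "HOL-Probability.Probability"
begin

text \<open>Matrices are real^'n^'n with n = CARD('n). A point of X is represented by
  the full preimage in GL_n(R) of the coset Gamma g, i.e. the set of all
  c * gamma * g with gamma in GL_n(Z), c a nonzero real scalar.\<close>

definition GLZ :: "(real^'n^'n) set" where
  "GLZ = {\<gamma>. (\<forall>i j. \<gamma>$i$j \<in> \<int>) \<and> \<bar>det \<gamma>\<bar> = 1}"

definition cls :: "real^'n^'n \<Rightarrow> (real^'n^'n) set" where
  "cls g = {c *\<^sub>R (\<gamma> ** g) | \<gamma> c. \<gamma> \<in> GLZ \<and> c \<noteq> 0}"

definition Xset :: "(real^'n^'n) set set" where
  "Xset = cls ` {g. invertible g}"

definition Xtop :: "(real^'n^'n) set topology" where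
  "Xtop = topology (\<lambda>U. U \<subseteq> Xset \<and> open {g. invertible g \<and> cls g \<in> U})"

definition borelX :: "(real^'n^'n) set measure" where
  "borelX = sigma Xset {U. openin Xtop U}"

definition diagm :: "real^'n \<Rightarrow> real^'n^'n" where
  "diagm t = (\<chi> i j. if i = j then t$i else 0)"

definition Hmat :: "(real^'n^'n) set" where
  "Hmat = {diagm t | t. \<forall>i. t$i \<noteq> 0}"

definition Ract :: "real^'n^'n \<Rightarrow> (real^'n^'n) set \<Rightarrow> (real^'n^'n) set" where
  "Ract h p = (\<lambda>M. M ** h) ` p"

definition orbit :: "real^'n^'n \<Rightarrow> (real^'n^'n) set set" where
  "orbit g = {cls (g ** h) | h. h \<in> Hmat}"

definition periodic :: "real^'n^'n \<Rightarrow> bool" where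
  "periodic g \<longleftrightarrow> invertible g \<and> compactin Xtop (orbit g)"

definition inv_prob_on_orbit :: "(real^'n^'n) set measure \<Rightarrow> real^'n^'n \<Rightarrow> bool" where
  "inv_prob_on_orbit \<mu> g \<longleftrightarrow> prob_space \<mu> \<and> sets \<mu> = sets borelX \<and>
     emeasure \<mu> (orbit g) = 1 \<and> (\<forall>h\<in>Hmat. distr \<mu> \<mu> (Ract h) = \<mu>)"

definition orbmeas :: "real^'n^'n \<Rightarrow> (real^'n^'n) set measure" where
  "orbmeas g = (THE \<mu>. inv_prob_on_orbit \<mu> g)"

definition Cc_nonneg :: "((real^'n^'n) set \<Rightarrow> real) \<Rightarrow> bool" where
  "Cc_nonneg f \<longleftrightarrow> continuous_map Xtop euclideanreal f \<and> (\<forall>p. f p \<ge> 0) \<and>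
     (\<exists>K. compactin Xtop K \<and> (\<forall>p\<in>Xset - K. f p = 0))"

definition weak_star_limit ::
  "(nat \<Rightarrow> (real^'n^'n) set measure) \<Rightarrow> (real^'n^'n) set measure \<Rightarrow> bool" where
  "weak_star_limit \<mu> \<nu> \<longleftrightarrow> sets \<nu> = sets borelX \<and>
     (\<forall>f. Cc_nonneg f \<longrightarrow>
        (\<lambda>k. \<integral>\<^sup>+ p. ennreal (f p) \<partial>(\<mu> k)) \<longlonglongrightarrow> (\<integral>\<^sup>+ p. ennreal (f p) \<partial>\<nu>))"

text \<open>H = diagonal matrices modulo scalars is parametrised by the entries t_i,
  i different from a fixed index i0 (the i0 entry normalised to 1).
  Fixed Haar measure: product of dt/|t| over i different from i0.\<close>

definition i0 :: "'n" where "i0 = (SOME i. True)"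

definition Hpar :: "('n \<Rightarrow> real) set" where
  "Hpar = {t. t \<in> extensional (- {i0}) \<and> (\<forall>i. i \<noteq> i0 \<longrightarrow> t i \<noteq> 0)}"

definition hat :: "('n \<Rightarrow> real) \<Rightarrow> real^'n^'n" where
  "hat t = diagm (\<chi> i. if i = i0 then 1 else t i)"

definition tmul :: "('n \<Rightarrow> real) \<Rightarrow> ('n \<Rightarrow> real) \<Rightarrow> ('n \<Rightarrow> real)" where
  "tmul t s = restrict (\<lambda>i. t i * s i) (- {i0})"

definition HaarH :: "('n \<Rightarrow> real) measure" where
  "HaarH = PiM (- {i0}) (\<lambda>_. density lborel (\<lambda>s. ennreal (1 / \<bar>s\<bar>)))"

definition stab :: "real^'n^'n \<Rightarrow> ('n \<Rightarrow> real) set" where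
  "stab g = {t \<in> Hpar. cls (g ** hat t) = cls g}"

definition fund_dom :: "real^'n^'n \<Rightarrow> ('n \<Rightarrow> real) set \<Rightarrow> bool" where
  "fund_dom g F \<longleftrightarrow> F \<in> sets HaarH \<and> F \<subseteq> Hpar \<and>
     (\<forall>t\<in>Hpar. \<exists>!p. p \<in> F \<times> stab g \<and> t = tmul (fst p) (snd p))"

definition vol :: "real^'n^'n \<Rightarrow> real" where
  "vol g = measure HaarH (SOME F. fund_dom g F)"

text \<open>Trace of left multiplication by X on M_n, computed in the basis E_ij.\<close>
definition Emat :: "'n \<Rightarrow> 'n \<Rightarrow> real^'n^'n" where
  "Emat i j = (\<chi> k l. if k = i \<and> l = j then 1 else 0)"

definition trLM :: "real^'n^'n \<Rightarrow> real" where
  "trLM A = (\<Sum>i\<in>UNIV. \<Sum>j\<in>UNIV. (A ** Emat i j)$i$j)"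

definition Bform :: "real^'n^'n \<Rightarrow> real^'n^'n \<Rightarrow> real" where
  "Bform A C = trLM (mat 1 :: real^'n^'n) * trLM (A ** C) - trLM A * trLM C"

text \<open>Preimage in M_n(Z) of Ad(g)h \<inter> g_Z: integer matrices M with g^{-1} M g diagonal
  (the Lie algebra of the diagonal group, together with the scalars).\<close>
definition Lint :: "real^'n^'n \<Rightarrow> (real^'n^'n) set" where
  "Lint g = {M. (\<forall>i j. M$i$j \<in> \<int>) \<and> (\<exists>t. M = g ** diagm t ** matrix_inv g)}"

definition detn :: "nat \<Rightarrow> (nat \<Rightarrow> nat \<Rightarrow> real) \<Rightarrow> real" where
  "detn m A = (\<Sum>p | p permutes {..<m}. of_int (sign p) * (\<Prod>i<m. A i (p i)))"

text \<open>E 0,...,E (n-2) are representatives of a Z-basis of the lattice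
  Lint g / Z I = Ad(g)h \<inter> g_Z.\<close>
definition Zbasis :: "real^'n^'n \<Rightarrow> (nat \<Rightarrow> real^'n^'n) \<Rightarrow> bool" where
  "Zbasis g E \<longleftrightarrow> (\<forall>k < CARD('n) - 1. E k \<in> Lint g) \<and>
     (\<forall>M\<in>Lint g. \<exists>c a. c \<in> \<int> \<and> (\<forall>k. a k \<in> \<int>) \<and>
         M = c *\<^sub>R mat 1 + (\<Sum>k<CARD('n) - 1. a k *\<^sub>R E k)) \<and>
     (\<forall>c a. c \<in> \<int> \<and> (\<forall>k. a k \<in> \<int>) \<and>
         c *\<^sub>R mat 1 + (\<Sum>k<CARD('n) - 1. a k *\<^sub>R E k) = 0 \<longrightarrow>
         c = 0 \<and> (\<forall>k < CARD('n) - 1. a k = 0))"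

definition disc :: "real^'n^'n \<Rightarrow> real" where
  "disc g = (THE d. \<exists>E. Zbasis g E \<and>
               d = detn (CARD('n) - 1) (\<lambda>k l. Bform (E k) (E l)))"

end

theory Submission
  imports Defs "Jordan_Normal_Form.Determinant"
begin

text \<open>Fix \<open>n\<close> and let \<open>a\<close> be a large integer. The polynomial \<open>(X - 0)(X - a)\<dots>(X - (n-1)a) - 1\<close> has \<open>n\<close> real
  roots \<open>\<alpha>\<^sub>j\<close>, with \<open>\<alpha>\<^sub>j\<close> very close to \<open>j a\<close>, and the elements \<open>\<alpha> - k a\<close> are units of \<open>\<int>[\<alpha>]\<close>. The
  orbits are those of the matrices \<open>(\<alpha>\<^sub>j\<^sup>k)\<close>, whose rows span the lattice \<open>\<int>[\<alpha>]\<close>.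

  In logarithmic coordinates on the diagonal group modulo scalars the unit \<open>\<alpha> - k a\<close> is, up to a
  bounded error, \<open>- n log a\<close> times a coordinate vector. Hence the stabiliser is cocompact and the
  orbit is the image of a box of side \<open>O(log a)\<close>. The lattice \<open>\<int>[\<alpha>]\<close> contains the vector
  \<open>(1, \<dots>, 1)\<close>, while its covolume is a power of \<open>a\<close>: it stays far out in the cusp on a box whose side is a
  fixed proportion of \<open>log a\<close>. A bounded number of translates of the small box covers the large
  one, so every orbit gives the cusp a mass bounded below.

  The discriminant is a constant times a squared Vandermonde determinant. It is strictly increasing
  and polynomially bounded in \<open>a\<close>, so that the orbits are distinct and polynomially many have
  discriminant below \<open>D\<close>. Their volumes are bounded below because an integer matrix that is
  diagonalisable with real eigenvalues close to 1 is the identity.\<close>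

text \<open>The full unit group is never computed. The n explicit units have product 1 and generate
  a subgroup of the stabiliser of unknown index. This is enough because every estimate compares a
  packing set with a covering set for the stabiliser itself: a large covering box gives finiteness,
  and a small packing box gives a lower bound for the volume that is the same for all orbits.
  Polynomially many orbits then yield a power of D.

  Origin of the numbers: the unit of k has logarithm near log a at every coordinate other than k,
  hence near -(n-1) log a at k, and dividing by coordinate \<open>i0\<close> gives -n log a. A box
  of side tau stretches the short vector and shrinks the n-th root of the covolume by at most exp
  tau each, and this root is at least sqrt (a / 2). With tau = log a / 8 the loss is a^(1/4), which
  leaves room for every height bound R.

  \<open>orbmeas\<close> and \<open>disc\<close> are definite descriptions, so uniqueness of the
  invariant probability measure and independence of the basis must be proved before either can be
  used.\<close>

hide_const (open) Matrix.mat Matrix.row Determinant.det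
hide_fact (open) Matrix.vec_eq_iff Matrix.row_def Matrix.mat_def Determinant.det_def
  Determinant.det_rows_mul Congruence.set_eqI
no_notation Matrix.vec_index (infixl "$" 100)

subsection \<open>Determinants over initial segments of the natural numbers\<close>

abbreviation nmat :: "nat \<Rightarrow> (nat \<Rightarrow> nat \<Rightarrow> real) \<Rightarrow> real Matrix.mat" where
  "nmat m A \<equiv> Matrix.mat m m (\<lambda>(i, j). A i j)"

text \<open>Gives access to the product rule, the transpose rule and the block formula for
  determinants of matrices indexed by natural numbers.\<close>

lemma detn_eq_det: "detn m A = Determinant.det (nmat m A)"
  by (auto simp: detn_def Determinant.det_def atLeast0LessThan permutes_in_image
      intro!: sum.cong prod.cong arg_cong2[where f="(*)"])

lemma permutes_lessThan: "p permutes {..<m :: nat} \<Longrightarrow> p i < m \<longleftrightarrow> i < m"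
  using permutes_in_image[of p "{..<m}" i] by simp

lemma detn_cong: "(\<And>i j. i < m \<Longrightarrow> j < m \<Longrightarrow> A i j = B i j) \<Longrightarrow> detn m A = detn m B"
  by (auto simp: detn_def permutes_lessThan intro!: sum.cong prod.cong)

lemma detn_mult: "detn m (\<lambda>i j. \<Sum>k<m. A i k * B k j) = detn m A * detn m B"
proof -
  have "nmat m (\<lambda>i j. \<Sum>k<m. A i k * B k j) = nmat m A * nmat m B"
    by (rule eq_matI) (auto simp: scalar_prod_def atLeast0LessThan)
  then show ?thesis
    by (simp add: detn_eq_det Determinant.det_mult[of _ m])
qed

lemma detn_transpose: "detn m (\<lambda>i j. A j i) = detn m A"
proof -
  have "nmat m (\<lambda>i j. A j i) = Matrix.transpose_mat (nmat m A)"
    by (rule eq_matI) auto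
  then show ?thesis
    by (simp add: detn_eq_det Determinant.det_transpose[of _ m])
qed

lemma detn_cmult: "detn m (\<lambda>i j. c * A i j) = c ^ m * detn m A"
  by (simp add: detn_def prod.distrib sum_distrib_left mult.left_commute)

lemma detn_upper_triangular:
  assumes "\<And>i j. j < i \<Longrightarrow> i < m \<Longrightarrow> A i j = 0"
  shows "detn m A = (\<Prod>i<m. A i i)"
proof -
  have "upper_triangular (nmat m A)"
    using assms by auto
  then have "detn m A = prod_list (diag_mat (nmat m A))"
    unfolding detn_eq_det by (rule det_upper_triangular) auto
  then show ?thesis
    by (simp add: prod_list_diag_prod atLeast0LessThan)
qed

lemma detn_lower_triangular:
  assumes "\<And>i j. i < j \<Longrightarrow> j < m \<Longrightarrow> A i j = 0"
  shows "detn m A = (\<Prod>i<m. A i i)"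
  using detn_upper_triangular[of m "\<lambda>i j. A j i"] assms detn_transpose[of m A] by auto

lemma detn_Ints:
  assumes "\<And>i j. i < m \<Longrightarrow> j < m \<Longrightarrow> A i j \<in> \<int>"
  shows "detn m A \<in> \<int>"
  unfolding detn_def
  by (intro Ints_sum Ints_mult Ints_prod) (auto simp: permutes_lessThan assms)

text \<open>Row operations with the unipotent matrix \<open>L\<close> clear column 0 below the
  pivot. The Schur complement on the right is, up to a scalar, the Gram matrix of the discriminant
  form; \<open>disc_G\<close> uses it in this way.\<close>

lemma detn_Schur:
  assumes "G 0 0 \<noteq> 0"
  shows "detn (Suc m) G =
    G 0 0 * detn m (\<lambda>k l. G (Suc k) (Suc l) - G (Suc k) 0 * G 0 (Suc l) / G 0 0)"
proof -
  define L where "L i j = (if i = j then 1 else if j = 0 then - G i 0 / G 0 0 else 0)" for i j :: nat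
  define K where "K i j = (\<Sum>k<Suc m. L i k * G k j)" for i j :: nat
  have L: "L (Suc i) 0 = - G (Suc i) 0 / G 0 0" "L 0 0 = 1" "L 0 (Suc i) = 0" for i
    by (auto simp: L_def)
  have LS: "L (Suc i) (Suc j) = (if i = j then 1 else 0)" for i j
    by (auto simp: L_def)
  have K0: "K 0 j = G 0 j" for j
    unfolding K_def by (subst sum.lessThan_Suc_shift) (simp add: L)
  have KS: "K (Suc i) j = G (Suc i) j - G (Suc i) 0 * G 0 j / G 0 0" if "i < m" for i j
    using that unfolding K_def by (subst sum.lessThan_Suc_shift) (simp add: L LS if_distrib[of "\<lambda>x. x * _"] cong: if_cong)
  have "detn (Suc m) L = 1"
    by (subst detn_lower_triangular) (auto simp: L_def)
  then have "detn (Suc m) G = detn (Suc m) K"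
    unfolding K_def by (simp only: detn_mult mult_1_left)
  moreover have "nmat (Suc m) K = four_block_mat (Matrix.mat 1 1 (\<lambda>_. G 0 0))
      (Matrix.mat 1 m (\<lambda>(i, j). G 0 (Suc j))) (0\<^sub>m m 1)
      (nmat m (\<lambda>k l. G (Suc k) (Suc l) - G (Suc k) 0 * G 0 (Suc l) / G 0 0))"
  proof (rule eq_matI, goal_cases)
    case (1 i j)
    then show ?case
      using assms by (cases i; cases j) (auto simp: K0 KS)
  qed auto
  ultimately show ?thesis
    by (simp add: detn_eq_det Determinant.det_four_block_mat_lower_left_zero_col[of _ _ m] det_single)
qed

text \<open>The index type \<open>'n\<close> has no order, while triangularity and the Vandermonde
  product need one. Conjugating permutations by an enumeration preserves their signs.\<close>

lemma det_eq_detn: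
  fixes A :: "real^'n^'n"
  assumes b: "bij_betw b {..<m} (UNIV :: 'n set)"
  shows "det A = detn m (\<lambda>i j. A $ b i $ b j)"
proof -
  let ?B = "{..<m}"
  have inj: "inj_on b ?B" and im: "b ` ?B = UNIV"
    using b by (auto simp: bij_betw_def)
  let ?f = "map_permutation ?B b"
  have bij: "bij_betw ?f {p. p permutes ?B} {p. p permutes (UNIV :: 'n set)}"
  proof -
    have "bij_betw (\<lambda>\<pi> x. if x \<in> UNIV then b (\<pi> (inv_into ?B b x)) else x)
        {p. p permutes ?B} {p. p permutes (UNIV :: 'n set)}"
      by (rule bij_betw_permutations[OF b])
    moreover have "?f = (\<lambda>\<pi> x. if x \<in> UNIV then b (\<pi> (inv_into ?B b x)) else x)"
      by (auto simp: fun_eq_iff map_permutation_def restrict_id_def im)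
    ultimately show ?thesis by simp
  qed
  have "det A = (\<Sum>p | p permutes (UNIV :: 'n set). of_int (sign p) * (\<Prod>i\<in>UNIV. A $ i $ p i))"
    by (simp add: Determinants.det_def)
  also have "\<dots> = (\<Sum>p | p permutes ?B. of_int (sign (?f p)) * (\<Prod>i\<in>UNIV. A $ i $ ?f p i))"
    by (rule sum.reindex_bij_betw[OF bij, symmetric])
  also have "\<dots> = (\<Sum>p | p permutes ?B. of_int (sign p) * (\<Prod>i<m. A $ b i $ b (p i)))"
  proof (intro sum.cong refl arg_cong2[where f="(*)"])
    fix p assume "p \<in> {p. p permutes ?B}"
    then have p: "p permutes ?B" by simp
    show "(of_int (sign (?f p)) :: real) = of_int (sign p)"
      by (simp add: sign_map_permutation[OF inj p])
    have "(\<Prod>i\<in>UNIV. A $ i $ ?f p i) = (\<Prod>i<m. A $ b i $ ?f p (b i))"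
      by (rule prod.reindex_bij_betw[OF b, symmetric])
    also have "\<dots> = (\<Prod>i<m. A $ b i $ b (p i))"
      by (rule prod.cong) (auto simp: map_permutation_apply[OF inj])
    finally show "(\<Prod>i\<in>UNIV. A $ i $ ?f p i) = (\<Prod>i<m. A $ b i $ b (p i))" .
  qed
  finally show ?thesis
    by (simp add: detn_def)
qed

text \<open>Replace the monomials by the Newton polynomials \<open>P k\<close>: the change of basis
  is unipotent, and the matrix of values becomes triangular because \<open>P k\<close> vanishes at
  \<open>x j\<close> for j < k.\<close>

lemma detn_vandermonde:
  "detn m (\<lambda>k j. x j ^ k) = (\<Prod>j<m. \<Prod>l<j. x j - x l)"
proof -
  define P where "P k = (\<Prod>l<k. [:- x l, 1:])" for k
  have deg: "degree (P k) = k" for k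
    unfolding P_def by (subst degree_prod_eq_sum_degree) auto
  have lead: "coeff (P k) k = 1" for k
    using lead_coeff_prod[of "\<lambda>l. [:- x l, 1:]" "{..<k}"] deg[of k] by (simp add: P_def)
  have "detn m (\<lambda>k j. poly (P k) (x j)) = detn m (\<lambda>k j. \<Sum>i<m. coeff (P k) i * x j ^ i)"
  proof (rule detn_cong)
    fix k j assume "k < m" "j < m"
    have "poly (P k) (x j) = (\<Sum>i\<le>k. coeff (P k) i * x j ^ i)"
      by (simp add: poly_altdef deg)
    also have "\<dots> = (\<Sum>i<m. coeff (P k) i * x j ^ i)"
      using \<open>k < m\<close> by (intro sum.mono_neutral_left) (auto intro!: coeff_eq_0 simp: deg)
    finally show "poly (P k) (x j) = (\<Sum>i<m. coeff (P k) i * x j ^ i)" .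
  qed
  also have "\<dots> = detn m (\<lambda>k i. coeff (P k) i) * detn m (\<lambda>i j. x j ^ i)"
    by (rule detn_mult)
  also have "detn m (\<lambda>k i. coeff (P k) i) = 1"
    by (subst detn_lower_triangular) (auto intro!: coeff_eq_0 simp: deg lead)
  also have "detn m (\<lambda>k j. poly (P k) (x j)) = (\<Prod>j<m. poly (P j) (x j))"
    by (rule detn_upper_triangular) (auto simp: P_def poly_prod)
  finally show ?thesis
    by (simp add: P_def poly_prod)
qed

subsection \<open>The Haar measure of the diagonal group\<close>

text \<open>Haar measure of the multiplicative group of the reals. At 0 the density is 1 / 0 = 0 by
  convention, and a point is a Lebesgue null set.\<close>

definition mlt :: "real measure" where
  "mlt = density lborel (\<lambda>s. ennreal (1 / \<bar>s\<bar>))"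

lemma sets_mlt [simp, measurable_cong]: "sets mlt = sets borel"
  by (simp add: mlt_def)

lemma space_mlt [simp]: "space mlt = UNIV"
  by (simp add: mlt_def)

lemma sigma_finite_mlt: "sigma_finite_measure mlt"
  unfolding mlt_def by (subst sigma_finite_measure.sigma_finite_iff_density_finite) (auto intro: lborel.sigma_finite_measure_axioms)

lemma emeasure_mlt: "A \<in> sets borel \<Longrightarrow> emeasure mlt A = (\<integral>\<^sup>+ s. ennreal (1 / \<bar>s\<bar>) * indicator A s \<partial>lborel)"
  by (simp add: mlt_def emeasure_density)

text \<open>The Jacobian of multiplication by c is cancelled by the density.\<close>

lemma distr_mlt:
  assumes "c \<noteq> 0"
  shows "distr mlt borel ((*) c) = mlt"
proof (rule measure_eqI)
  fix A assume "A \<in> sets (distr mlt borel ((*) c))"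
  then have [measurable]: "A \<in> sets borel" by simp
  have 1: "((*) c) -` A \<in> sets borel"
    by (rule measurable_sets_borel[of "(*) c" borel]) auto
  have "emeasure mlt A = \<bar>c\<bar> * (\<integral>\<^sup>+ s. ennreal (1 / \<bar>0 + c * s\<bar>) * indicator A (0 + c * s) \<partial>lborel)"
    using nn_integral_real_affine[of "\<lambda>s. ennreal (1 / \<bar>s\<bar>) * indicator A s" c 0] assms
    by (simp add: emeasure_mlt)
  also have "\<dots> = (\<integral>\<^sup>+ s. \<bar>c\<bar> * (ennreal (1 / \<bar>0 + c * s\<bar>) * indicator A (0 + c * s)) \<partial>lborel)"
    by (rule nn_integral_cmult[symmetric]) auto
  also have "\<dots> = (\<integral>\<^sup>+ s. ennreal (1 / \<bar>s\<bar>) * indicator ((*) c -` A) s \<partial>lborel)"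
  proof (rule nn_integral_cong)
    fix s :: real
    have "ennreal \<bar>c\<bar> * ennreal (1 / \<bar>c * s\<bar>) = ennreal (1 / \<bar>s\<bar>)"
      using assms by (simp add: ennreal_mult[symmetric] abs_mult)
    then show "ennreal \<bar>c\<bar> * (ennreal (1 / \<bar>0 + c * s\<bar>) * indicator A (0 + c * s)) = ennreal (1 / \<bar>s\<bar>) * indicator ((*) c -` A) s"
      by (simp add: indicator_def)
  qed
  also have "\<dots> = emeasure mlt ((*) c -` A)"
    using 1 by (simp add: emeasure_mlt)
  finally show "emeasure (distr mlt borel ((*) c)) A = emeasure mlt A"
    by (subst emeasure_distr) (auto)
qed (simp)

lemma emeasure_mlt_finite:
  assumes "A \<in> sets borel" "A \<subseteq> {s. e \<le> \<bar>s\<bar> \<and> \<bar>s\<bar> \<le> R}" "e > 0"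
  shows "emeasure mlt A < \<infinity>"
proof -
  have "emeasure mlt A \<le> (\<integral>\<^sup>+ s. ennreal (1 / e) * indicator {-R..R} s \<partial>lborel)"
    unfolding emeasure_mlt[OF assms(1)]
    using assms(2,3) by (intro nn_integral_mono) (auto simp: indicator_def field_simps intro!: ennreal_leI frac_le)
  also have "\<dots> = ennreal (1 / e) * emeasure lborel {-R..R}"
    by (subst nn_integral_cmult_indicator) auto
  also have "\<dots> < \<infinity>"
    by (cases "- R \<le> R") (auto simp: ennreal_mult_less_top)
  finally show ?thesis .
qed

lemma emeasure_mlt_pos:
  assumes "b > 1"
  shows "emeasure mlt {1..b} > 0"
proof -
  have "0 < ennreal (1 / b) * ennreal (b - 1)"
    using assms by (simp add: ennreal_mult[symmetric])
  also have "\<dots> = (\<integral>\<^sup>+ s. ennreal (1 / b) * indicator {1..b} s \<partial>lborel)"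
    using assms by (subst nn_integral_cmult_indicator) auto
  also have "\<dots> \<le> emeasure mlt {1..b}"
    unfolding emeasure_mlt[OF borel_closed[OF closed_atLeastAtMost]]
    using assms by (intro nn_integral_mono) (auto simp: indicator_def intro!: ennreal_leI frac_le)
  finally show ?thesis .
qed

text \<open>Neutral element and inverse for \<open>tmul\<close>; \<open>restrict\<close> keeps them
  extensional, as \<open>Hpar\<close> requires.\<close>

definition tone :: "'n \<Rightarrow> real" where "tone = restrict (\<lambda>_. 1) (- {i0})"
definition tinv :: "('n \<Rightarrow> real) \<Rightarrow> 'n \<Rightarrow> real" where "tinv t = restrict (\<lambda>i. 1 / t i) (- {i0})"

lemma HaarH_eq: "HaarH = PiM (- {i0 :: 'n}) (\<lambda>_. mlt)"
  by (simp add: HaarH_def mlt_def)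

lemma space_HaarH: "space (HaarH :: ('n \<Rightarrow> real) measure) = extensional (- {i0})"
  by (auto simp: HaarH_eq space_PiM PiE_def)

lemma tone_Hpar: "tone \<in> Hpar"
  by (auto simp: tone_def Hpar_def)

lemma tinv_Hpar: "t \<in> Hpar \<Longrightarrow> tinv t \<in> Hpar"
  by (auto simp: tinv_def Hpar_def)

lemma tmul_Hpar: "t \<in> Hpar \<Longrightarrow> s \<in> Hpar \<Longrightarrow> tmul t s \<in> Hpar"
  by (auto simp: tmul_def Hpar_def)

lemma tmul_assoc: "tmul (tmul a b) c = tmul a (tmul b c)"
  by (auto simp: tmul_def fun_eq_iff restrict_def)

lemma tmul_commute: "tmul a b = tmul b a"
  by (auto simp: tmul_def fun_eq_iff restrict_def)

lemma tmul_left_commute: "tmul a (tmul b c) = tmul b (tmul a c)"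
  by (auto simp: tmul_def fun_eq_iff restrict_def)

lemmas tmul_ac = tmul_assoc tmul_commute tmul_left_commute

lemma tmul_tone: "t \<in> extensional (- {i0}) \<Longrightarrow> tmul t tone = t"
  by (auto simp: tmul_def tone_def fun_eq_iff extensional_def)

lemma tmul_tinv: "t \<in> Hpar \<Longrightarrow> tmul t (tinv t) = tone"
  by (auto simp: tmul_def tone_def tinv_def Hpar_def fun_eq_iff)

lemma Hpar_extensional: "t \<in> Hpar \<Longrightarrow> t \<in> extensional (- {i0})"
  by (simp add: Hpar_def)

lemma tmul_tmul_tinv:
  assumes "s \<in> Hpar" "t \<in> extensional (- {i0})"
  shows "tmul (tmul t s) (tinv s) = t"
  using assms by (simp add: tmul_assoc tmul_tinv tmul_tone)

lemma tmul_tinv_tmul: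
  assumes "s \<in> Hpar" "t \<in> extensional (- {i0})"
  shows "tmul (tmul t (tinv s)) s = t"
  using tmul_tmul_tinv[OF assms] by (simp add: tmul_ac)

lemma tmul_Hpar_iff:
  assumes "s \<in> Hpar" "t \<in> extensional (- {i0})"
  shows "tmul t s \<in> Hpar \<longleftrightarrow> t \<in> Hpar"
  using assms by (auto simp: tmul_def Hpar_def)

lemma Hpar_sets [measurable]: "(Hpar :: ('n::finite \<Rightarrow> real) set) \<in> sets HaarH"
proof -
  have "(Hpar :: ('n \<Rightarrow> real) set) = PiE (- {i0}) (\<lambda>_. - {0})"
    by (auto simp: Hpar_def PiE_def Pi_def)
  moreover have "PiE (- {i0 :: 'n}) (\<lambda>_. - {0}) \<in> sets (PiM (- {i0}) (\<lambda>_. mlt))"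
    by (intro sets_PiM_I_finite) auto
  ultimately show ?thesis
    by (simp add: HaarH_eq)
qed

lemma measurable_tmul [measurable]:
  "(\<lambda>t. tmul t (s :: 'n::finite \<Rightarrow> real)) \<in> measurable HaarH HaarH"
  unfolding HaarH_eq tmul_def by measurable

text \<open>Boxes determine the product measure, and on a box the claim is the invariance of each
  factor.\<close>

lemma distr_HaarH:
  fixes s :: "'n::finite \<Rightarrow> real"
  assumes "s \<in> Hpar"
  shows "distr HaarH HaarH (\<lambda>t. tmul t s) = HaarH"
proof -
  interpret product_sigma_finite "\<lambda>_ :: 'n. mlt"
    by (simp add: product_sigma_finite_def sigma_finite_mlt)
  have "PiM (- {i0 :: 'n}) (\<lambda>_. mlt) = distr HaarH HaarH (\<lambda>t. tmul t s)"
  proof (rule PiM_eqI[symmetric])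
    fix A :: "'n \<Rightarrow> real set" assume "\<And>i. i \<in> - {i0} \<Longrightarrow> A i \<in> sets mlt"
    then have A [measurable]: "i \<in> - {i0} \<Longrightarrow> A i \<in> sets borel" for i by simp
    have A': "PiE (- {i0}) A \<in> sets HaarH"
      unfolding HaarH_eq by (auto intro!: sets_PiM_I_finite A)
    have B: "(\<lambda>x. s i * x) -` A i \<in> sets borel" if "i \<in> - {i0}" for i
      using A[OF that] by (intro measurable_sets_borel[of "(*) (s i)" borel]) auto
    have "(\<lambda>t. tmul t s) -` (PiE (- {i0}) A) \<inter> space HaarH = PiE (- {i0}) (\<lambda>i. (\<lambda>x. s i * x) -` A i)"
      by (auto simp: space_HaarH tmul_def PiE_def Pi_def mult.commute)
    then have "emeasure (distr HaarH HaarH (\<lambda>t. tmul t s)) (PiE (- {i0}) A) =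
        emeasure HaarH (PiE (- {i0}) (\<lambda>i. (\<lambda>x. s i * x) -` A i))"
      using A' by (simp add: emeasure_distr)
    also have "\<dots> = (\<Prod>i\<in>- {i0}. emeasure mlt ((\<lambda>x. s i * x) -` A i))"
      unfolding HaarH_eq by (rule emeasure_PiM) (auto simp: B)
    also have "\<dots> = (\<Prod>i\<in>- {i0}. emeasure mlt (A i))"
    proof (rule prod.cong[OF refl])
      fix i assume i: "i \<in> - {i0 :: 'n}"
      then have "s i \<noteq> 0" using assms by (auto simp: Hpar_def)
      then have "emeasure mlt (A i) = emeasure (distr mlt borel ((*) (s i))) (A i)"
        by (simp add: distr_mlt)
      also have "\<dots> = emeasure mlt ((\<lambda>x. s i * x) -` A i)"
        using A[OF i] by (subst emeasure_distr) auto
      finally show "emeasure mlt ((\<lambda>x. s i * x) -` A i) = emeasure mlt (A i)" ..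
    qed
    finally show "emeasure (distr HaarH HaarH (\<lambda>t. tmul t s)) (PiE (- {i0}) A) = (\<Prod>i\<in>- {i0}. emeasure mlt (A i))" .
  qed (auto simp: HaarH_eq)
  then show ?thesis by (simp add: HaarH_eq)
qed

lemma nn_integral_HaarH_tmul:
  fixes s :: "'n::finite \<Rightarrow> real"
  assumes "s \<in> Hpar" and [measurable]: "f \<in> borel_measurable HaarH"
  shows "(\<integral>\<^sup>+ t. f (tmul t s) \<partial>HaarH) = (\<integral>\<^sup>+ t. f t \<partial>HaarH)"
  by (subst (2) distr_HaarH[OF assms(1), symmetric]) (simp add: nn_integral_distr)

text \<open>Unfolding: every point of P has a translate in C, and a point of C comes from at most
  one translate of P. So the sum over \<open>\<Lambda>\<close> of the translated indicators is at
  least 1 on P and, after an invariant change of variables, at most 1 on C. The invariant set S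
  localises the comparison, so that two fundamental domains agree on every stabiliser-invariant
  set.\<close>

lemma packing_le_covering:
  fixes \<Lambda> :: "('n::finite \<Rightarrow> real) set"
  assumes "countable \<Lambda>" and sub: "\<Lambda> \<subseteq> Hpar"
    and P [measurable]: "P \<in> sets HaarH" and PH: "P \<subseteq> Hpar"
    and packing: "\<And>p q a b. p \<in> P \<Longrightarrow> q \<in> P \<Longrightarrow> a \<in> \<Lambda> \<Longrightarrow> b \<in> \<Lambda> \<Longrightarrow> tmul p a = tmul q b \<Longrightarrow> a = b"
    and C [measurable]: "C \<in> sets HaarH"
    and covering: "\<And>p. p \<in> P \<Longrightarrow> \<exists>c\<in>C. \<exists>a\<in>\<Lambda>. c = tmul p a"
    and S [measurable]: "S \<in> sets HaarH"
    and S_inv: "\<And>t a. t \<in> P \<Longrightarrow> a \<in> \<Lambda> \<Longrightarrow> t \<in> S \<Longrightarrow> tmul t a \<in> S"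
  shows "emeasure HaarH (P \<inter> S) \<le> emeasure HaarH (C \<inter> S)"
proof -
  let ?f = "\<lambda>a t. indicator (P \<inter> S) t * indicator C (tmul t a) :: ennreal"
  let ?h = "\<lambda>a t. indicator (P \<inter> S) (tmul t (tinv a)) * indicator C t :: ennreal"
  have "emeasure HaarH (P \<inter> S) = (\<integral>\<^sup>+ t. indicator (P \<inter> S) t \<partial>HaarH)"
    by simp
  also have "\<dots> \<le> (\<integral>\<^sup>+ t. (\<integral>\<^sup>+ a. ?f a t \<partial>count_space \<Lambda>) \<partial>HaarH)"
  proof (rule nn_integral_mono)
    fix t :: "'n \<Rightarrow> real"
    show "indicator (P \<inter> S) t \<le> (\<integral>\<^sup>+ a. ?f a t \<partial>count_space \<Lambda>)"
    proof (cases "t \<in> P \<inter> S")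
      case True
      then obtain a where a: "a \<in> \<Lambda>" "tmul t a \<in> C" using covering by blast
      have "?f a t \<le> (\<integral>\<^sup>+ a. ?f a t \<partial>count_space \<Lambda>)"
        by (rule nn_integral_ge_point) fact
      then show ?thesis using True a by simp
    qed simp
  qed
  also have "\<dots> = (\<integral>\<^sup>+ a. (\<integral>\<^sup>+ t. ?f a t \<partial>HaarH) \<partial>count_space \<Lambda>)"
    by (rule nn_integral_count_space_nn_integral) (use assms in auto)
  also have "\<dots> = (\<integral>\<^sup>+ a. (\<integral>\<^sup>+ t. ?h a t \<partial>HaarH) \<partial>count_space \<Lambda>)"
  proof (rule nn_integral_cong)
    fix a assume "a \<in> space (count_space \<Lambda>)"
    then have a: "a \<in> Hpar" using sub by auto
    have "(\<integral>\<^sup>+ t. ?h a t \<partial>HaarH) = (\<integral>\<^sup>+ t. ?h a (tmul t a) \<partial>HaarH)"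
      by (rule nn_integral_HaarH_tmul[OF a, symmetric]) measurable
    also have "\<dots> = (\<integral>\<^sup>+ t. ?f a t \<partial>HaarH)"
      by (rule nn_integral_cong) (simp add: space_HaarH tmul_tmul_tinv[OF a])
    finally show "(\<integral>\<^sup>+ t. ?f a t \<partial>HaarH) = (\<integral>\<^sup>+ t. ?h a t \<partial>HaarH)" ..
  qed
  also have "\<dots> = (\<integral>\<^sup>+ t. (\<integral>\<^sup>+ a. ?h a t \<partial>count_space \<Lambda>) \<partial>HaarH)"
    by (rule nn_integral_count_space_nn_integral[symmetric]) (use assms in auto)
  also have "\<dots> \<le> (\<integral>\<^sup>+ t. indicator (C \<inter> S) t \<partial>HaarH)"
  proof (rule nn_integral_mono)
    fix t :: "'n \<Rightarrow> real" assume t: "t \<in> space HaarH"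
    show "(\<integral>\<^sup>+ a. ?h a t \<partial>count_space \<Lambda>) \<le> indicator (C \<inter> S) t"
    proof (cases "\<exists>a\<in>\<Lambda>. tmul t (tinv a) \<in> P \<inter> S \<and> t \<in> C")
      case False
      then have "(\<integral>\<^sup>+ a. ?h a t \<partial>count_space \<Lambda>) = (\<integral>\<^sup>+ a. 0 \<partial>count_space \<Lambda>)"
        by (intro nn_integral_cong) (auto simp: indicator_def)
      then show ?thesis by simp
    next
      case True
      then obtain a where a: "a \<in> \<Lambda>" "tmul t (tinv a) \<in> P \<inter> S" "t \<in> C" by blast
      have cancel: "tmul (tmul t (tinv b)) b = t" if "b \<in> \<Lambda>" for b
        using that sub t by (intro tmul_tinv_tmul) (auto simp: space_HaarH)
      \<comment> \<open>Packing: only one element can bring t back into P, so the sum has at most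
        one nonzero term.\<close>
      have uniq: "b = a" if "b \<in> \<Lambda>" "tmul t (tinv b) \<in> P" for b
        using packing[of "tmul t (tinv b)" "tmul t (tinv a)" b a] that a(1,2)
        by (simp add: cancel)
      have "(\<integral>\<^sup>+ a. ?h a t \<partial>count_space \<Lambda>) \<le> (\<integral>\<^sup>+ b. indicator {a} b \<partial>count_space \<Lambda>)"
        using uniq by (intro nn_integral_mono) (auto simp: indicator_def)
      also have "\<dots> = 1"
        using a by (subst nn_integral_indicator) auto
      also have "1 = (indicator (C \<inter> S) t :: ennreal)"
        using S_inv[of "tmul t (tinv a)" a] a cancel[OF a(1)] by simp
      finally show ?thesis .
    qed
  qed
  also have "\<dots> = emeasure HaarH (C \<inter> S)" by simp
  finally show ?thesis .
qed

subsection \<open>The space of lattices\<close>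

lemma det_Ints:
  fixes A :: "real^'n^'n"
  assumes "\<And>i j. A $ i $ j \<in> \<int>"
  shows "det A \<in> \<int>"
  unfolding det_def by (intro Ints_sum Ints_mult Ints_prod) (auto simp: assms)

lemma matrix_mult_Ints:
  fixes A B :: "real^'n^'n"
  assumes "\<And>i j. A $ i $ j \<in> \<int>" "\<And>i j. B $ i $ j \<in> \<int>"
  shows "(A ** B) $ i $ j \<in> \<int>"
  unfolding matrix_matrix_mult_def by (auto intro!: Ints_sum Ints_mult assms)

lemma GLZ_mat_1: "mat 1 \<in> GLZ"
  by (simp add: GLZ_def) (simp add: mat_def)

lemma GLZ_mult: "a \<in> GLZ \<Longrightarrow> b \<in> GLZ \<Longrightarrow> a ** b \<in> GLZ"
  by (auto simp: GLZ_def det_mul abs_mult intro: matrix_mult_Ints)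

lemma GLZ_I:
  fixes A B :: "real^'n^'n"
  assumes "\<And>i j. A $ i $ j \<in> \<int>" "\<And>i j. B $ i $ j \<in> \<int>" "A ** B = mat 1"
  shows "A \<in> GLZ"
proof -
  obtain a b where ab: "det A = of_int a" "det B = of_int b"
    using det_Ints[OF assms(1)] det_Ints[OF assms(2)] by (auto elim!: Ints_cases)
  have "det A * det B = 1"
    using det_mul[of A B] assms(3) by simp
  then have "a * b = 1"
    unfolding ab by (metis of_int_1 of_int_eq_iff of_int_mult)
  then have "\<bar>a\<bar> = 1"
    by (simp add: zmult_eq_1_iff) auto
  then show ?thesis
    using assms(1) ab(1) by (auto simp: GLZ_def)
qed

lemma GLZ_invertible: "a \<in> GLZ \<Longrightarrow> invertible a"
  by (auto simp: GLZ_def invertible_det_nz)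

text \<open>Cramer's rule writes the entries of the inverse as integer determinants divided by
  \<open>det A\<close>, which is 1 or -1.\<close>

lemma GLZ_inverse:
  fixes A :: "real^'n^'n"
  assumes "A \<in> GLZ"
  obtains B where "B \<in> GLZ" "A ** B = mat 1" "B ** A = mat 1"
proof -
  obtain B where B: "A ** B = mat 1" "B ** A = mat 1"
    using GLZ_invertible[OF assms] by (auto simp: invertible_def)
  have "B $ k $ j \<in> \<int>" for k j
  proof -
    have "det A \<noteq> 0" using assms by (auto simp: GLZ_def)
    moreover have "A *v (column j B) = axis j 1"
    proof -
      have "A *v (column j B) = column j (A ** B)"
        by (simp add: vec_eq_iff column_def matrix_matrix_mult_def matrix_vector_mult_def)
      then show ?thesis
        unfolding B by (simp add: vec_eq_iff column_def mat_def axis_def)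
    qed
    ultimately have "column j B = (\<chi> k. det (\<chi> i l. if l = k then axis j 1 $ i else A $ i $ l) / det A)"
      by (subst (asm) cramer) auto
    then have "B $ k $ j = det (\<chi> i l. if l = k then axis j 1 $ i else A $ i $ l) / det A"
      by (simp add: vec_eq_iff column_def)
    moreover have "det (\<chi> i l. if l = k then axis j 1 $ i else A $ i $ l) \<in> \<int>"
      using assms by (intro det_Ints) (auto simp: axis_def GLZ_def)
    moreover have "det A = 1 \<or> det A = -1"
      using assms by (auto simp: GLZ_def)
    ultimately show ?thesis by auto
  qed
  then have "B \<in> GLZ"
    using assms B by (intro GLZ_I[of B A]) (auto simp: GLZ_def)
  with B that show ?thesis by blast
qed

lemma det_scaleR:
  fixes A :: "real^'n^'n"
  shows "det (c *\<^sub>R A) = c ^ CARD('n) * det A"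
proof -
  have "c *\<^sub>R A = (\<chi> i. c *s A $ i)"
    by (simp add: vec_eq_iff)
  then show ?thesis
    using det_rows_mul[where c="\<lambda>_::'n. c" and a="\<lambda>i. A $ i"] by simp
qed

lemma invertible_scaleR:
  fixes A :: "real^'n^'n"
  shows "invertible A \<Longrightarrow> c \<noteq> 0 \<Longrightarrow> invertible (c *\<^sub>R A)"
  by (simp add: invertible_det_nz det_scaleR)

lemma scaleR_matrix_mult [simp]:
  fixes A B :: "real^'n^'n"
  shows "(c *\<^sub>R A) ** B = c *\<^sub>R (A ** B)" "A ** (c *\<^sub>R B) = c *\<^sub>R (A ** B)"
  by (simp_all add: vec_eq_iff matrix_matrix_mult_def sum_distrib_left mult_ac)

lemma cls_memI: "\<gamma> \<in> GLZ \<Longrightarrow> c \<noteq> 0 \<Longrightarrow> c *\<^sub>R (\<gamma> ** g) \<in> cls g"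
  by (auto simp: cls_def)

lemma cls_self: "g \<in> cls g"
  using cls_memI[OF GLZ_mat_1, of 1 g] by simp

lemma cls_trans: "M \<in> cls g \<Longrightarrow> N \<in> cls M \<Longrightarrow> N \<in> cls g"
  by (fastforce simp: cls_def matrix_mul_assoc intro: GLZ_mult)

lemma cls_sym:
  assumes "M \<in> cls g" shows "g \<in> cls M"
proof -
  obtain \<gamma> c where M: "M = c *\<^sub>R (\<gamma> ** g)" "\<gamma> \<in> GLZ" "c \<noteq> 0"
    using assms by (auto simp: cls_def)
  obtain \<delta> where \<delta>: "\<delta> \<in> GLZ" "\<delta> ** \<gamma> = mat 1" using GLZ_inverse[OF M(2)] by metis
  have "(1 / c) *\<^sub>R (\<delta> ** M) = g"
    using M(3) \<delta>(2) by (simp add: M(1) matrix_mul_assoc)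
  then show ?thesis
    using cls_memI[OF \<delta>(1), of "1 / c" M] M(3) by simp
qed

lemma cls_eq: "M \<in> cls g \<Longrightarrow> cls M = cls g"
  using cls_trans cls_sym by blast

lemma cls_scaleR: "c \<noteq> 0 \<Longrightarrow> cls (c *\<^sub>R g) = cls g"
  using cls_memI[OF GLZ_mat_1, of c g] by (intro cls_eq) simp

lemma cls_GLZ: "\<gamma> \<in> GLZ \<Longrightarrow> cls (\<gamma> ** g) = cls g"
  using cls_memI[of \<gamma> 1 g] by (intro cls_eq) simp

lemma Ract_cls:
  fixes g h :: "real^'n^'n"
  shows "Ract h (cls g) = cls (g ** h)"
proof -
  have "Ract h (cls g) = {c *\<^sub>R (\<gamma> ** g) ** h | \<gamma> c. \<gamma> \<in> GLZ \<and> c \<noteq> 0}"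
    by (auto simp: Ract_def cls_def image_def simp del: scaleR_matrix_mult)
  then show ?thesis
    by (simp add: cls_def matrix_mul_assoc)
qed

lemma cls_mult_cong: "cls M = cls g \<Longrightarrow> cls (M ** h) = cls (g ** h)"
  by (metis Ract_cls)

lemma invertible_cls: "invertible g \<Longrightarrow> M \<in> cls g \<Longrightarrow> invertible M"
  by (auto simp: cls_def intro!: invertible_scaleR invertible_mult[OF GLZ_invertible])

lemma cls_Xset: "invertible g \<Longrightarrow> cls g \<in> Xset"
  by (simp add: Xset_def)

section \<open>Topology and Borel sets of the quotient\<close>

lemma continuous_on_det: "continuous_on S (det :: real^'n^'n \<Rightarrow> real)"
  unfolding det_def by (intro continuous_intros)

abbreviation GL :: "(real^'n^'n) set" where
  "GL \<equiv> {g. invertible g}"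

lemma open_invertible: "open (GL :: (real^'n^'n) set)"
proof -
  have "(GL :: (real^'n^'n) set) = det -` (- {0})"
    by (auto simp: invertible_det_nz)
  also have "open \<dots>"
    by (intro open_vimage continuous_on_det) auto
  finally show ?thesis .
qed

lemma istopology_X: "istopology (\<lambda>U. U \<subseteq> Xset \<and> open {g :: real^'n^'n. invertible g \<and> cls g \<in> U})"
  unfolding istopology_def
proof (intro conjI allI impI; (elim conjE)?)
  fix S T :: "(real^'n^'n) set set"
  assume "open {g. invertible g \<and> cls g \<in> S}" "open {g. invertible g \<and> cls g \<in> T}"
  then have "open ({g. invertible g \<and> cls g \<in> S} \<inter> {g. invertible g \<and> cls g \<in> T})" by auto
  also have "\<dots> = {g. invertible g \<and> cls g \<in> S \<inter> T}" by auto
  finally show "open {g. invertible g \<and> cls g \<in> S \<inter> T}" .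
next
  fix \<K> :: "(real^'n^'n) set set set"
  assume K: "\<forall>K\<in>\<K>. K \<subseteq> Xset \<and> open {g. invertible g \<and> cls g \<in> K}"
  then have "open (\<Union>K\<in>\<K>. {g. invertible g \<and> cls g \<in> K})" by auto
  also have "\<dots> = {g. invertible g \<and> cls g \<in> \<Union>\<K>}" by auto
  finally show "open {g. invertible g \<and> cls g \<in> \<Union>\<K>}" .
  show "\<Union>\<K> \<subseteq> Xset" using K by auto
qed auto

lemma openin_Xtop: "openin Xtop U \<longleftrightarrow> U \<subseteq> Xset \<and> open {g. invertible g \<and> cls g \<in> U}"
  by (simp add: Xtop_def topology_inverse'[OF istopology_X])

lemma topspace_Xtop: "topspace Xtop = (Xset :: (real^'n^'n) set set)"
proof -
  have "{g :: real^'n^'n. invertible g \<and> cls g \<in> Xset} = GL"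
    by (auto simp: cls_Xset)
  then have "openin Xtop (Xset :: (real^'n^'n) set set)"
    by (simp add: openin_Xtop open_invertible)
  then show ?thesis
    by (auto simp: topspace_def openin_Xtop)
qed

lemma space_borelX: "space borelX = Xset"
  unfolding borelX_def by (rule space_measure_of) (auto simp: openin_Xtop)

lemma sets_borelX: "sets borelX = sigma_sets Xset {U. openin Xtop U}"
  unfolding borelX_def by (rule sets_measure_of) (auto simp: openin_Xtop)

lemma openin_sets_borelX: "openin Xtop U \<Longrightarrow> U \<in> sets borelX"
  by (auto simp: sets_borelX)

lemma measurable_borelXI:
  assumes "f \<in> space M \<rightarrow> Xset" "\<And>U. openin Xtop U \<Longrightarrow> f -` U \<inter> space M \<in> sets M"
  shows "f \<in> measurable M borelX"
  unfolding borelX_def using assms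
  by (intro measurable_measure_of) (auto simp: openin_Xtop)

text \<open>The quotient map is open: the saturation of V is a union of preimages of V under the
  continuous maps that multiply by an integer matrix and a scalar.\<close>

lemma openin_cls_image:
  fixes V :: "(real^'n^'n) set"
  assumes "open V"
  shows "openin Xtop (cls ` {g \<in> V. invertible g})"
proof -
  have "{g. invertible g \<and> cls g \<in> cls ` {g \<in> V. invertible g}} =
    (\<Union>p\<in>GLZ \<times> (- {0}). GL \<inter> (\<lambda>g. snd p *\<^sub>R (fst p ** g)) -` V)" (is "?L = ?R")
  proof (intro set_eqI iffI)
    fix g assume "g \<in> ?L"
    then obtain v where v: "invertible g" "v \<in> V" "cls g = cls v" by auto
    then have "v \<in> cls g" using cls_self by auto
    then show "g \<in> ?R" using v by (auto simp: cls_def)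
  next
    fix g assume "g \<in> ?R"
    then obtain \<gamma> c where g: "\<gamma> \<in> GLZ" "c \<noteq> 0" "invertible g" "c *\<^sub>R (\<gamma> ** g) \<in> V" by auto
    have m: "c *\<^sub>R (\<gamma> ** g) \<in> cls g" using g by (intro cls_memI)
    then have "invertible (c *\<^sub>R (\<gamma> ** g))" using g invertible_cls by blast
    moreover have "cls g = cls (c *\<^sub>R (\<gamma> ** g))" using cls_eq[OF m] by simp
    ultimately show "g \<in> ?L" using g by auto
  qed
  also have "open \<dots>"
  proof (intro open_UN ballI open_Int open_invertible)
    fix p :: "(real^'n^'n) \<times> real"
    have "continuous_on UNIV (\<lambda>g. snd p *\<^sub>R (fst p ** g))"
      unfolding matrix_matrix_mult_def by (intro continuous_intros)
    then show "open ((\<lambda>g. snd p *\<^sub>R (fst p ** g)) -` V)"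
      using assms by (intro open_vimage)
  qed
  finally show ?thesis by (auto simp: openin_Xtop Xset_def)
qed

lemma continuous_map_cls: "continuous_map (top_of_set GL) Xtop cls"
  unfolding continuous_map_def
proof (intro conjI allI impI)
  fix U :: "(real^'n^'n) set set" assume "openin Xtop U"
  then have "open {g. invertible g \<and> cls g \<in> U}" by (simp add: openin_Xtop)
  then show "openin (top_of_set GL) {x \<in> topspace (top_of_set GL). cls x \<in> U}"
    by (auto simp: openin_open Int_def)
qed (auto simp: topspace_Xtop cls_Xset)

lemma compactin_cls_image:
  assumes "compact K" "K \<subseteq> GL"
  shows "compactin Xtop (cls ` K)"
  using assms by (intro image_compactin[OF _ continuous_map_cls]) (auto simp: compactin_subtopology)

lemma continuous_map_Xtop:
  fixes f :: "(real^'n^'n) set \<Rightarrow> real"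
  assumes "continuous_on GL (\<lambda>g. f (cls g))"
  shows "continuous_map Xtop euclideanreal f"
  unfolding continuous_map_def
proof (intro conjI allI impI)
  fix U :: "real set" assume "openin euclideanreal U"
  then have "open U" by simp
  have "{g. invertible g \<and> cls g \<in> {x \<in> Xset. f x \<in> U}} = GL \<inter> (\<lambda>g. f (cls g)) -` U"
    by (auto simp: cls_Xset)
  also have "open \<dots>"
    using assms open_invertible \<open>open U\<close> by (metis continuous_on_open_vimage Int_commute)
  finally show "openin Xtop {x \<in> topspace Xtop. f x \<in> U}"
    by (auto simp: openin_Xtop topspace_Xtop)
qed auto

lemma borel_measurable_Xtop:
  assumes "continuous_map Xtop euclideanreal f"
  shows "f \<in> borel_measurable borelX"
proof (rule borel_measurableI)
  fix S :: "real set" assume "open S"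
  then have "openin Xtop {x \<in> topspace Xtop. f x \<in> S}"
    using assms by (auto simp: continuous_map_def)
  also have "{x \<in> topspace Xtop. f x \<in> S} = f -` S \<inter> space borelX"
    by (auto simp: topspace_Xtop space_borelX)
  finally show "f -` S \<inter> space borelX \<in> sets borelX"
    by (rule openin_sets_borelX)
qed

section \<open>A continuous proper height function\<close>

lemma norm_matrix_mult_le:
  fixes A B :: "real^'n^'n"
  shows "norm (A ** B) \<le> real CARD('n) ^ 3 * norm A * norm B"
proof -
  have el: "\<bar>M $ i $ j\<bar> \<le> norm M" for M :: "real^'n^'n" and i j
    by (rule order_trans[OF component_le_norm_cart Finite_Cartesian_Product.norm_nth_le])
  have "norm (A ** B) \<le> (\<Sum>i\<in>UNIV. norm ((A ** B) $ i))"
    by (simp add: norm_vec_def L2_set_le_sum)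
  also have "\<dots> \<le> (\<Sum>i\<in>UNIV. \<Sum>j\<in>UNIV. \<bar>(A ** B) $ i $ j\<bar>)"
    by (intro sum_mono norm_le_l1_cart)
  also have "\<dots> \<le> (\<Sum>i\<in>(UNIV::'n set). \<Sum>j\<in>(UNIV::'n set). \<Sum>k\<in>(UNIV::'n set). norm A * norm B)"
  proof (intro sum_mono)
    fix i j
    have "\<bar>(A ** B) $ i $ j\<bar> \<le> (\<Sum>k\<in>UNIV. \<bar>A $ i $ k * B $ k $ j\<bar>)"
      by (simp add: matrix_matrix_mult_def sum_abs)
    also have "\<dots> \<le> (\<Sum>k\<in>(UNIV::'n set). norm A * norm B)"
      by (intro sum_mono) (auto simp: abs_mult intro!: mult_mono el)
    finally show "\<bar>(A ** B) $ i $ j\<bar> \<le> (\<Sum>k\<in>(UNIV::'n set). norm A * norm B)" .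
  qed
  also have "\<dots> = real CARD('n) ^ 3 * norm A * norm B"
    by (simp add: power3_eq_cube mult_ac)
  finally show ?thesis .
qed

text \<open>\<open>Psi\<close> is proper by construction: its sublevel sets are images of compact sets of matrices, so
  that Mahler's criterion is not needed.\<close>

definition Psi :: "(real^'n^'n) set \<Rightarrow> real" where
  "Psi p = (INF M\<in>p. norm M / root CARD('n) \<bar>det M\<bar>)"

lemma Psi_le:
  fixes M :: "real^'n^'n"
  assumes "M \<in> p"
  shows "Psi p \<le> norm M / root CARD('n) \<bar>det M\<bar>"
  unfolding Psi_def using assms
  by (intro cINF_lower bdd_belowI[of _ 0]) auto

lemma Psi_ge:
  fixes g :: "real^'n^'n"
  assumes "\<And>M. M \<in> cls g \<Longrightarrow> r \<le> norm M / root CARD('n) \<bar>det M\<bar>"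
  shows "r \<le> Psi (cls g)"
  unfolding Psi_def using assms cls_self by (intro cINF_greatest) auto

text \<open>The quotient in \<open>Psi\<close> is unchanged by scaling, so an element that nearly
  attains the infimum can be normalised to absolute determinant 1. The strict bound replaces
  attainment of the infimum.\<close>

lemma Psi_lessE:
  fixes g :: "real^'n^'n"
  assumes "Psi (cls g) < R" "invertible g"
  obtains M where "M \<in> cls g" "\<bar>det M\<bar> = 1" "norm M < R"
proof -
  obtain N where N: "N \<in> cls g" "norm N / root CARD('n) \<bar>det N\<bar> < R"
    using assms(1) cls_self unfolding Psi_def by (subst (asm) cINF_less_iff) (auto intro!: bdd_belowI[of _ 0])
  have "det N \<noteq> 0"
    using invertible_cls[OF assms(2) N(1)] by (simp add: invertible_det_nz)
  define c where "c = 1 / root CARD('n) \<bar>det N\<bar>"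
  have c: "c > 0"
    using \<open>det N \<noteq> 0\<close> by (simp add: c_def)
  have "c *\<^sub>R N \<in> cls g"
    using cls_trans[OF N(1) cls_memI[OF GLZ_mat_1, of c N]] c by simp
  moreover have "\<bar>det (c *\<^sub>R N)\<bar> = 1"
    using \<open>det N \<noteq> 0\<close> by (simp add: det_scaleR abs_mult power_abs c_def power_divide)
  moreover have "norm (c *\<^sub>R N) < R"
    using N(2) c by (simp add: c_def)
  ultimately show ?thesis by (rule that)
qed

text \<open>Passing from g to h multiplies every representative on the right by the same matrix
  \<open>g' ** h\<close>, whatever the integer matrix and the scalar. All quotients under the
  infimum therefore change by uniform factors that tend to 1, and so does the infimum.\<close>

lemma continuous_Psi: "continuous_on (GL :: (real^'n^'n) set) (\<lambda>g. Psi (cls g))"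
proof -
  let ?n = "CARD('n)"
  define C where "C = real ?n ^ 3"
  have "isCont (\<lambda>h. Psi (cls h)) g" if g: "invertible g" for g :: "real^'n^'n"
  proof -
    obtain g' where g': "g ** g' = mat 1" "g' ** g = mat 1"
      using g by (auto simp: invertible_def)
    \<comment> \<open>\<open>e h\<close> bounds the relative change of the norm; \<open>r h\<close>
      is the exact factor between the normalising n-th roots.\<close>
    define e where "e h = C * norm (g' ** h - mat 1)" for h
    define r where "r h = root ?n (\<bar>det g\<bar> / \<bar>det h\<bar>)" for h :: "real^'n^'n"
    have dg: "det g \<noteq> 0" using g by (simp add: invertible_det_nz)
    \<comment> \<open>The truncation at 0 keeps the lower factor nonnegative, so that it may
      multiply an inequality even when \<open>e h\<close> exceeds 1.\<close>
    have key: "max 0 (1 - e h) * r h * Psi (cls g) \<le> Psi (cls h) \<and>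
        Psi (cls h) \<le> (1 + e h) * r h * Psi (cls g)" if h: "invertible h" for h
    proof -
      have dh: "det h \<noteq> 0" using h by (simp add: invertible_det_nz)
      have rpos: "r h > 0" using dg dh by (simp add: r_def)
      have epos: "e h \<ge> 0" by (simp add: e_def C_def)
      have rel: "max 0 (1 - e h) * norm M \<le> norm N \<and> norm N \<le> (1 + e h) * norm M \<and>
          root ?n \<bar>det M\<bar> = r h * root ?n \<bar>det N\<bar>"
        if "M = c *\<^sub>R (\<gamma> ** g)" "N = c *\<^sub>R (\<gamma> ** h)" for M N \<gamma> c
      proof -
        have "N = M ** (g' ** h)"
          using g' by (simp add: that) (metis matrix_mul_assoc matrix_mul_rid)
        then have "N = M + M ** (g' ** h - mat 1)"
          using matrix_add_ldistrib[of M "g' ** h - mat 1" "mat 1"] by simp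
        moreover have "norm (M ** (g' ** h - mat 1)) \<le> e h * norm M"
          using norm_matrix_mult_le[of M "g' ** h - mat 1"] by (simp add: e_def C_def mult_ac)
        ultimately have "(1 - e h) * norm M \<le> norm N" "norm N \<le> (1 + e h) * norm M"
          using norm_triangle_ineq[of M "M ** (g' ** h - mat 1)"]
            norm_diff_ineq[of M "M ** (g' ** h - mat 1)"]
          by (auto simp: algebra_simps)
        moreover have "root ?n \<bar>det M\<bar> = r h * root ?n \<bar>det N\<bar>"
          using dg dh by (simp add: that r_def det_scaleR det_mul abs_mult flip: real_root_mult)
        ultimately show ?thesis by (auto simp: max_def)
      qed
      show ?thesis
      proof
        show "max 0 (1 - e h) * r h * Psi (cls g) \<le> Psi (cls h)"
        proof (rule Psi_ge)
          fix N assume "N \<in> cls h"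
          then obtain \<gamma> c where N: "N = c *\<^sub>R (\<gamma> ** h)" "\<gamma> \<in> GLZ" "c \<noteq> 0" by (auto simp: cls_def)
          define M where "M = c *\<^sub>R (\<gamma> ** g)"
          have M: "M \<in> cls g" using N by (auto simp: M_def intro!: cls_memI)
          have dN: "root ?n \<bar>det N\<bar> > 0"
            using invertible_cls[OF h \<open>N \<in> cls h\<close>] by (simp add: invertible_det_nz)
          have "max 0 (1 - e h) * r h * Psi (cls g) \<le> max 0 (1 - e h) * r h * (norm M / root ?n \<bar>det M\<bar>)"
            using rpos by (intro mult_left_mono Psi_le M) auto
          also have "\<dots> = max 0 (1 - e h) * norm M / root ?n \<bar>det N\<bar>"
            using rel[OF M_def N(1)] rpos by simp
          also have "\<dots> \<le> norm N / root ?n \<bar>det N\<bar>"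
            using rel[OF M_def N(1)] dN by (intro divide_right_mono) auto
          finally show "max 0 (1 - e h) * r h * Psi (cls g) \<le> norm N / root ?n \<bar>det N\<bar>" .
        qed
      next
        have "Psi (cls h) / ((1 + e h) * r h) \<le> Psi (cls g)"
        proof (rule Psi_ge)
          fix M assume "M \<in> cls g"
          then obtain \<gamma> c where M: "M = c *\<^sub>R (\<gamma> ** g)" "\<gamma> \<in> GLZ" "c \<noteq> 0" by (auto simp: cls_def)
          define N where "N = c *\<^sub>R (\<gamma> ** h)"
          have N: "N \<in> cls h" using M by (auto simp: N_def intro!: cls_memI)
          have dN: "root ?n \<bar>det N\<bar> > 0"
            using invertible_cls[OF h N] by (simp add: invertible_det_nz)
          have "Psi (cls h) \<le> norm N / root ?n \<bar>det N\<bar>" by (rule Psi_le[OF N])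
          also have "\<dots> \<le> (1 + e h) * norm M / root ?n \<bar>det N\<bar>"
            using rel[OF M(1) N_def] dN by (intro divide_right_mono) auto
          also have "\<dots> = (1 + e h) * r h * (norm M / root ?n \<bar>det M\<bar>)"
            using rel[OF M(1) N_def] rpos by simp
          finally show "Psi (cls h) / ((1 + e h) * r h) \<le> norm M / root ?n \<bar>det M\<bar>"
            using rpos epos by (simp add: pos_divide_le_eq mult_ac add_pos_nonneg)
        qed
        then show "Psi (cls h) \<le> (1 + e h) * r h * Psi (cls g)"
          using rpos epos by (simp add: pos_divide_le_eq mult_ac add_pos_nonneg)
      qed
    qed
    have "continuous_on UNIV e"
      unfolding e_def matrix_matrix_mult_def by (intro continuous_intros)
    then have "isCont e g" by (simp add: continuous_on_eq_continuous_at)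
    moreover have "e g = 0" by (simp add: e_def g')
    ultimately have ce: "(e \<longlongrightarrow> 0) (at g)" by (simp add: isCont_def)
    have "isCont det g"
      using continuous_on_det[of "UNIV :: (real^'n^'n) set"] by (simp add: continuous_on_eq_continuous_at)
    then have "isCont r g" unfolding r_def using dg by (intro continuous_intros) auto
    then have cr: "(r \<longlongrightarrow> 1) (at g)" using dg by (simp add: isCont_def r_def)
    have ev: "\<forall>\<^sub>F h in at g. invertible h"
      using open_invertible g by (auto simp: eventually_at_topological)
    show ?thesis
      unfolding isCont_def
    proof (rule tendsto_sandwich)
      show "\<forall>\<^sub>F h in at g. max 0 (1 - e h) * r h * Psi (cls g) \<le> Psi (cls h)"
        using ev by eventually_elim (use key in blast)
      show "\<forall>\<^sub>F h in at g. Psi (cls h) \<le> (1 + e h) * r h * Psi (cls g)"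
        using ev by eventually_elim (use key in blast)
      have "((\<lambda>h. max 0 (1 - e h) * r h * Psi (cls g)) \<longlongrightarrow> max 0 (1 - 0) * 1 * Psi (cls g)) (at g)"
        by (intro tendsto_intros ce cr)
      then show "((\<lambda>h. max 0 (1 - e h) * r h * Psi (cls g)) \<longlongrightarrow> Psi (cls g)) (at g)" by simp
      have "((\<lambda>h. (1 + e h) * r h * Psi (cls g)) \<longlongrightarrow> (1 + 0) * 1 * Psi (cls g)) (at g)"
        by (intro tendsto_intros ce cr)
      then show "((\<lambda>h. (1 + e h) * r h * Psi (cls g)) \<longlongrightarrow> Psi (cls g)) (at g)" by simp
    qed
  qed
  then show ?thesis by (simp add: continuous_at_imp_continuous_on)
qed

lemma continuous_map_Psi: "continuous_map Xtop euclideanreal (Psi :: (real^'n^'n) set \<Rightarrow> real)"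
  by (rule continuous_map_Xtop[OF continuous_Psi])

text \<open>Test functions of compact support that increase to 1 everywhere, so that monotone
  convergence recovers the total mass of a weak star limit.\<close>

definition cutoff :: "nat \<Rightarrow> (real^'n^'n) set \<Rightarrow> real" where
  "cutoff R p = max 0 (min 1 (real R + 1 - Psi p))"

lemma compact_norm_det: "compact {M :: real^'n^'n. norm M \<le> R \<and> \<bar>det M\<bar> = 1}"
proof -
  have "{M :: real^'n^'n. norm M \<le> R \<and> \<bar>det M\<bar> = 1} = cball 0 R \<inter> (\<lambda>M. \<bar>det M\<bar>) -` {1}"
    by auto
  also have "compact \<dots>"
    by (intro compact_Int_closed closed_vimage continuous_intros continuous_on_det) auto
  finally show ?thesis .
qed

lemma Cc_nonneg_cutoff: "Cc_nonneg (cutoff R :: (real^'n^'n) set \<Rightarrow> real)"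
  unfolding Cc_nonneg_def
proof (intro conjI allI exI ballI)
  show "continuous_map Xtop euclideanreal (cutoff R :: (real^'n^'n) set \<Rightarrow> real)"
    unfolding cutoff_def
    by (intro continuous_intros continuous_map_real_max continuous_map_real_min continuous_map_Psi)
  let ?K = "{M :: real^'n^'n. norm M \<le> real R + 1 \<and> \<bar>det M\<bar> = 1}"
  have "?K \<subseteq> GL" by (auto simp: invertible_det_nz)
  then show "compactin Xtop (cls ` ?K)"
    by (rule compactin_cls_image[OF compact_norm_det])
  fix p :: "(real^'n^'n) set" assume "p \<in> Xset - cls ` ?K"
  then obtain g where g: "invertible g" "p = cls g" "cls g \<notin> cls ` ?K" by (auto simp: Xset_def)
  have "\<not> Psi p < real R + 1"
  proof
    assume "Psi p < real R + 1"
    then obtain M where M: "M \<in> cls g" "\<bar>det M\<bar> = 1" "norm M < real R + 1"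
      using g by (auto elim: Psi_lessE)
    then have "cls g = cls M" using cls_eq by metis
    then show False using M g(3) by auto
  qed
  then show "cutoff R p = 0" by (simp add: cutoff_def)
qed (simp add: cutoff_def)

text \<open>A test function that vanishes where \<open>Psi\<close> exceeds R + 1 does not see the
  mass beyond. The bound 1 - \<eta> passes to the limit measure for each R, and then to the supremum
  over R.\<close>

lemma weak_star_limit_mass_le:
  fixes \<nu> :: "(real^'n^'n) set measure"
  assumes lim: "weak_star_limit \<mu> \<nu>"
    and \<mu>: "\<And>k. prob_space (\<mu> k)" "\<And>k. sets (\<mu> k) = sets borelX"
    and esc: "\<And>R. \<forall>\<^sub>F k in sequentially. \<eta> \<le> measure (\<mu> k) {p \<in> Xset. Psi p > R}"
  shows "emeasure \<nu> Xset \<le> ennreal (1 - \<eta>)"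
proof -
  have sp: "space (\<mu> k) = Xset" for k
    using sets_eq_imp_space_eq[OF \<mu>(2)] by (simp add: space_borelX)
  have sets_nu: "sets \<nu> = sets borelX" and
    conv: "\<And>f. Cc_nonneg f \<Longrightarrow> (\<lambda>k. \<integral>\<^sup>+ p. ennreal (f p) \<partial>(\<mu> k)) \<longlonglongrightarrow> (\<integral>\<^sup>+ p. ennreal (f p) \<partial>\<nu>)"
    using lim by (auto simp: weak_star_limit_def)
  have spn: "space \<nu> = Xset"
    using sets_eq_imp_space_eq[OF sets_nu] by (simp add: space_borelX)
  have meas: "cutoff R \<in> borel_measurable (borelX :: (real^'n^'n) set measure)" for R
    using Cc_nonneg_cutoff[of R, where 'n='n] by (auto simp: Cc_nonneg_def intro: borel_measurable_Xtop)
  have bound: "(\<integral>\<^sup>+ p. ennreal (cutoff R p) \<partial>\<nu>) \<le> ennreal (1 - \<eta>)" for R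
  proof (rule LIMSEQ_le_const2[OF conv[OF Cc_nonneg_cutoff]])
    have "\<forall>\<^sub>F k in sequentially. (\<integral>\<^sup>+ p. ennreal (cutoff R p) \<partial>(\<mu> k)) \<le> ennreal (1 - \<eta>)"
      using esc[of "real R + 1"]
    proof eventually_elim
      case (elim k)
      interpret prob_space "\<mu> k" by (rule \<mu>)
      let ?A = "{p \<in> Xset. Psi p > real R + 1} :: (real^'n^'n) set set"
      have A: "?A \<in> sets (\<mu> k)"
      proof -
        have [measurable]: "Psi \<in> borel_measurable (borelX :: (real^'n^'n) set measure)"
          by (rule borel_measurable_Xtop[OF continuous_map_Psi])
        have "{p \<in> space borelX. Psi p > real R + 1} \<in> sets (borelX :: (real^'n^'n) set measure)"
          by measurable
        then show ?thesis by (simp add: \<mu> space_borelX)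
      qed
      have "(\<integral>\<^sup>+ p. ennreal (cutoff R p) \<partial>(\<mu> k)) \<le> (\<integral>\<^sup>+ p. indicator (Xset - ?A) p \<partial>(\<mu> k))"
        by (intro nn_integral_mono) (auto simp: sp cutoff_def indicator_def ennreal_neg)
      also have "\<dots> = emeasure (\<mu> k) (space (\<mu> k) - ?A)"
        using sets.compl_sets[OF A] by (simp add: sp)
      also have "\<dots> = ennreal (1 - measure (\<mu> k) ?A)"
        using A by (simp add: emeasure_eq_measure prob_compl)
      also have "\<dots> \<le> ennreal (1 - \<eta>)"
        using elim by (intro ennreal_leI) simp
      finally show ?case .
    qed
    then show "\<exists>N. \<forall>k\<ge>N. (\<integral>\<^sup>+ p. ennreal (cutoff R p) \<partial>(\<mu> k)) \<le> ennreal (1 - \<eta>)"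
      by (simp add: eventually_sequentially)
  qed
  have "emeasure \<nu> Xset = (\<integral>\<^sup>+ p. 1 \<partial>\<nu>)" by (simp add: spn[symmetric])
  also have "\<dots> = (\<integral>\<^sup>+ p. (SUP R. ennreal (cutoff R p)) \<partial>\<nu>)"
  proof (rule nn_integral_cong)
    fix p :: "(real^'n^'n) set"
    obtain R :: nat where "Psi p \<le> real R" using real_arch_simple by blast
    then have "cutoff R p = 1" by (simp add: cutoff_def)
    then have "1 \<le> (SUP R. ennreal (cutoff R p))"
      by (intro SUP_upper2[of R]) auto
    moreover have "(SUP R. ennreal (cutoff R p)) \<le> 1"
      by (intro SUP_least) (simp add: cutoff_def)
    ultimately show "1 = (SUP R. ennreal (cutoff R p))" by simp
  qed
  also have "\<dots> = (SUP R. \<integral>\<^sup>+ p. ennreal (cutoff R p) \<partial>\<nu>)"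
  proof (rule nn_integral_monotone_convergence_SUP)
    show "incseq (\<lambda>R (p :: (real^'n^'n) set). ennreal (cutoff R p))"
      by (auto simp: incseq_def le_fun_def cutoff_def intro!: ennreal_leI max.mono min.mono)
    fix R
    have "cutoff R \<in> borel_measurable \<nu>"
      using meas measurable_cong_sets[OF sets_nu refl] by blast
    then show "(\<lambda>p. ennreal (cutoff R p)) \<in> borel_measurable \<nu>" by measurable
  qed
  also have "\<dots> \<le> ennreal (1 - \<eta>)"
    by (intro SUP_least bound)
  finally show ?thesis .
qed

section \<open>Short vectors force large height\<close>

lemma det_row_bound:
  fixes A :: "real^'n^'n"
  assumes "\<And>i j. i \<noteq> k \<Longrightarrow> \<bar>A $ i $ j\<bar> \<le> R" "\<And>j. \<bar>A $ k $ j\<bar> \<le> r"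
  shows "\<bar>det A\<bar> \<le> fact CARD('n) * (r * R ^ (CARD('n) - 1))"
proof -
  have "r \<ge> 0"
    using order_trans[OF abs_ge_zero assms(2)] .
  have "\<bar>det A\<bar> \<le> (\<Sum>p | p permutes (UNIV :: 'n set). \<bar>of_int (sign p) * (\<Prod>i\<in>UNIV. A $ i $ p i)\<bar>)"
    unfolding det_def by (rule sum_abs)
  also have "\<dots> \<le> (\<Sum>p | p permutes (UNIV :: 'n set). r * R ^ (CARD('n) - 1))"
  proof (rule sum_mono)
    fix p :: "'n \<Rightarrow> 'n"
    have "\<bar>of_int (sign p) * (\<Prod>i\<in>UNIV. A $ i $ p i)\<bar> = (\<Prod>i\<in>UNIV. \<bar>A $ i $ p i\<bar>)"
      by (simp add: abs_mult abs_prod sign_def)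
    also have "\<dots> = \<bar>A $ k $ p k\<bar> * (\<Prod>i\<in>UNIV - {k}. \<bar>A $ i $ p i\<bar>)"
      by (simp add: prod.remove)
    also have "\<dots> \<le> r * (\<Prod>i\<in>UNIV - {k}. R)"
      using \<open>r \<ge> 0\<close> by (intro mult_mono prod_mono prod_nonneg) (auto simp: assms)
    also have "\<dots> = r * R ^ (CARD('n) - 1)"
      by (simp add: card_Diff_singleton)
    finally show "\<bar>of_int (sign p) * (\<Prod>i\<in>UNIV. A $ i $ p i)\<bar> \<le> r * R ^ (CARD('n) - 1)" .
  qed
  also have "\<dots> = fact CARD('n) * (r * R ^ (CARD('n) - 1))"
    by (simp add: card_permutations)
  finally show ?thesis .
qed

text \<open>Otherwise the lattice, rescaled to covolume 1, has a basis M with entries at most R + 1.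
  The rescaled row k of g is an integer combination of the rows of M with some nonzero coefficient.
  Cramer's rule expresses this coefficient, up to sign, as a determinant containing the short row,
  which would make it smaller than 1 in absolute value.\<close>

lemma Psi_gt_short_row:
  fixes g :: "real^'n^'n"
  assumes g: "invertible g" and R: "R \<ge> 0"
    and short: "fact CARD('n) * (norm (g $ k) * (R + 1) ^ (CARD('n) - 1)) < root CARD('n) \<bar>det g\<bar>"
  shows "Psi (cls g) > R"
proof (rule ccontr)
  let ?n = "CARD('n)"
  assume "\<not> Psi (cls g) > R"
  then have "Psi (cls g) < R + 1" by simp
  then obtain M where M: "M \<in> cls g" "\<bar>det M\<bar> = 1" "norm M < R + 1"
    using g by (rule Psi_lessE)
  then obtain \<gamma> c where c: "M = c *\<^sub>R (\<gamma> ** g)" "\<gamma> \<in> GLZ" "c \<noteq> 0" by (auto simp: cls_def)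
  obtain \<delta> where \<delta>: "\<delta> \<in> GLZ" "\<delta> ** \<gamma> = mat 1" using GLZ_inverse[OF c(2)] by metis
  have "\<delta> ** M = c *\<^sub>R g"
    using \<delta> by (simp add: c(1) matrix_mul_assoc)
  then have row: "(\<Sum>i\<in>UNIV. \<delta> $ k $ i *s row i M) = c *s g $ k"
    by (auto simp: vec_eq_iff matrix_matrix_mult_def row_def)
  have "\<exists>j. \<delta> $ k $ j \<noteq> 0"
  proof (rule ccontr)
    assume "\<not> (\<exists>j. \<delta> $ k $ j \<noteq> 0)"
    then have "(\<delta> ** \<gamma>) $ k $ k = 0" by (simp add: matrix_matrix_mult_def)
    then show False by (simp add: \<delta> mat_def)
  qed
  then obtain j where j: "\<delta> $ k $ j \<noteq> 0" by blast
  then have "1 \<le> \<bar>\<delta> $ k $ j\<bar>"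
    using \<delta>(1) by (intro Ints_nonzero_abs_ge1) (auto simp: GLZ_def)
  also have "\<dots> = \<bar>det (\<chi> i. if i = j then c *s g $ k else row i M)\<bar>"
    using cramer_lemma_transpose[of j "\<delta> $ k" M] M(2) unfolding row by (simp only: abs_mult mult_1_right)
  also have "\<dots> \<le> fact ?n * (\<bar>c\<bar> * norm (g $ k) * (R + 1) ^ (?n - 1))"
  proof (rule det_row_bound)
    fix i l assume "i \<noteq> j"
    have "\<bar>M $ i $ l\<bar> \<le> norm M"
      by (rule order_trans[OF component_le_norm_cart Finite_Cartesian_Product.norm_nth_le])
    then show "\<bar>(\<chi> i. if i = j then c *s g $ k else row i M) $ i $ l\<bar> \<le> R + 1"
      using M(3) \<open>i \<noteq> j\<close> by (simp add: row_def)
  qed (auto simp: abs_mult intro!: mult_left_mono component_le_norm_cart)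
  also have "\<dots> = \<bar>c\<bar> * (fact ?n * (norm (g $ k) * (R + 1) ^ (?n - 1)))"
    by (simp add: mult_ac)
  also have "\<dots> < \<bar>c\<bar> * root ?n \<bar>det g\<bar>"
    using c(3) short by simp
  also have "\<dots> = root ?n \<bar>det M\<bar>"
  proof -
    have "\<bar>det M\<bar> = \<bar>c\<bar> ^ ?n * \<bar>det g\<bar>"
      using c(2) by (simp add: c(1) det_scaleR det_mul abs_mult power_abs GLZ_def)
    then show ?thesis by (simp add: real_root_mult real_root_power_cancel)
  qed
  finally show False by (simp add: M(2))
qed

subsection \<open>Stabilisers and fundamental domains\<close>

definition hv :: "('n \<Rightarrow> real) \<Rightarrow> real^'n" where
  "hv t = (\<chi> i. if i = i0 then 1 else t i)"

lemma hat_eq: "hat t = diagm (hv t)"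
  by (simp add: hat_def hv_def)

lemma diagm_1: "diagm (\<chi> i. 1) = mat 1"
  by (simp add: diagm_def mat_def vec_eq_iff)

lemma det_diagm: "det (diagm t) = (\<Prod>i\<in>UNIV. t $ i)"
  by (subst det_diagonal) (auto simp: diagm_def)

lemma matrix_mult_diagm: "(A ** diagm t) $ i $ j = A $ i $ j * t $ j" for A :: "real^'n^'n"
  by (simp add: matrix_matrix_mult_def diagm_def if_distrib[of "(*) _"] cong: if_cong)

lemma diagm_mult: "diagm s ** diagm t = diagm (\<chi> i. s $ i * t $ i)" for s t :: "real^'n"
  by (simp add: vec_eq_iff matrix_mult_diagm) (simp add: diagm_def)

lemma matrix_add_rdistrib: "(A + B) ** C = A ** C + B ** C" for A B C :: "real^'n^'n"
  by (simp add: vec_eq_iff matrix_matrix_mult_def distrib_right sum.distrib)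

lemma tmul_tone_left: "t \<in> extensional (- {i0}) \<Longrightarrow> tmul tone t = t"
  using tmul_tone[of t] by (simp add: tmul_commute)

lemma tmul_tinv_left: "t \<in> Hpar \<Longrightarrow> tmul (tinv t) t = tone"
  using tmul_tinv[of t] by (simp add: tmul_commute)

text \<open>Reduces a coincidence of two translates to a single group element carrying p to
  q.\<close>

lemma tmul_eq_cancel:
  assumes "q \<in> Hpar" "a \<in> Hpar" "b \<in> Hpar" "tmul p a = tmul q b"
  shows "tmul p (tmul a (tinv b)) = q" "tmul a (tinv b) = tone \<Longrightarrow> a = b"
  using tmul_tmul_tinv[of b q] tmul_tinv_tmul[of b a] assms
  by (simp_all add: Hpar_extensional tmul_tone_left flip: tmul_assoc)

lemma hat_tmul: "hat (tmul t s) = hat t ** hat s"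
  by (simp add: hat_eq diagm_mult) (auto simp: hv_def tmul_def diagm_def vec_eq_iff)

lemma hat_tone: "hat tone = mat 1"
  by (auto simp: hat_eq hv_def tone_def diagm_def mat_def vec_eq_iff)

lemma hv_nonzero: "t \<in> Hpar \<Longrightarrow> hv t $ i \<noteq> 0"
  by (auto simp: hv_def Hpar_def)

lemma invertible_hat: "t \<in> Hpar \<Longrightarrow> invertible (hat t)"
  by (simp add: invertible_det_nz hat_eq det_diagm hv_nonzero)

lemma Hmat_scale_hat:
  assumes "h \<in> Hmat"
  obtains c t where "c \<noteq> 0" "t \<in> Hpar" "h = c *\<^sub>R hat t"
proof -
  obtain v where v: "h = diagm v" "\<And>i. v $ i \<noteq> 0" using assms by (auto simp: Hmat_def)
  define t where "t = restrict (\<lambda>i. v $ i / v $ i0) (- {i0})"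
  have "t \<in> Hpar" using v by (auto simp: t_def Hpar_def)
  moreover have "h = v $ i0 *\<^sub>R hat t"
    by (simp add: vec_eq_iff v hat_eq hv_def t_def diagm_def)
  ultimately show ?thesis using v(2) that by blast
qed

lemma hat_Hmat: "t \<in> Hpar \<Longrightarrow> hat t \<in> Hmat"
  using hv_nonzero by (auto simp: Hmat_def hat_eq)

lemma cls_mult_scale: "c \<noteq> 0 \<Longrightarrow> cls (g ** (c *\<^sub>R h)) = cls (g ** h)" for g :: "real^'n^'n"
  by (simp add: cls_scaleR)

lemma orbit_eq: "orbit g = (\<lambda>t. cls (g ** hat t)) ` Hpar"
  unfolding orbit_def
  by (auto elim!: Hmat_scale_hat simp: cls_mult_scale simp del: scaleR_matrix_mult intro: hat_Hmat)

lemma stab_Hpar: "stab g \<subseteq> Hpar"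
  by (auto simp: stab_def)

lemma cls_hat_tmul:
  fixes g :: "real^'n^'n"
  assumes "cls (g ** hat t) = cls (g ** hat s)"
  shows "cls (g ** hat (tmul t a)) = cls (g ** hat (tmul s a))"
  using cls_mult_cong[OF assms, of "hat a"] by (simp add: hat_tmul matrix_mul_assoc)

lemma tone_stab: "tone \<in> stab g"
  by (simp add: stab_def tone_Hpar hat_tone)

lemma stab_iff: "a \<in> stab g \<longleftrightarrow> a \<in> Hpar \<and> cls (g ** hat a) = cls (g ** hat tone)"
  by (simp add: stab_def hat_tone)

lemma cls_hat_stab:
  fixes g :: "real^'n^'n"
  assumes "a \<in> stab g" "t \<in> Hpar"
  shows "cls (g ** hat (tmul t a)) = cls (g ** hat t)"
  using cls_hat_tmul[of g a tone t] assms
  by (simp add: stab_iff tmul_commute[of t a] tmul_tone_left Hpar_extensional)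

lemma stab_tmul: "a \<in> stab g \<Longrightarrow> b \<in> stab g \<Longrightarrow> tmul a b \<in> stab g"
  using stab_Hpar[of g] cls_hat_stab[of b g a] by (auto simp: stab_iff tmul_Hpar)

lemma stab_tinv: 
  fixes g :: "real^'n^'n"
  assumes "a \<in> stab g" shows "tinv a \<in> stab g"
proof -
  have "a \<in> Hpar" using assms stab_Hpar by blast
  then show ?thesis
    using assms cls_hat_stab[OF assms, of "tinv a"]
    by (simp add: stab_iff tinv_Hpar tmul_tinv_left)
qed

lemma stab_GLZ:
  fixes g :: "real^'n^'n"
  assumes "a \<in> stab g"
  obtains \<gamma> c where "\<gamma> \<in> GLZ" "c \<noteq> 0" "g ** hat a = c *\<^sub>R (\<gamma> ** g)"
  using assms cls_self[of "g ** hat a"] by (auto simp: stab_def) (auto simp: cls_def)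

lemma countable_GLZ: "countable (GLZ :: (real^'n^'n) set)"
proof -
  have "GLZ \<subseteq> range (\<lambda>f :: 'n \<Rightarrow> 'n \<Rightarrow> int. (\<chi> i j. of_int (f i j)) :: real^'n^'n)"
  proof
    fix A :: "real^'n^'n" assume "A \<in> GLZ"
    then have "A = (\<chi> i j. of_int \<lfloor>A $ i $ j\<rfloor>)" by (auto simp: GLZ_def vec_eq_iff)
    then show "A \<in> range (\<lambda>f :: 'n \<Rightarrow> 'n \<Rightarrow> int. (\<chi> i j. of_int (f i j)))"
      by (rule range_eqI[where x="\<lambda>i j. \<lfloor>A $ i $ j\<rfloor>"])
  qed
  then show ?thesis
    by (rule countable_subset) (rule countable_image, simp)
qed

text \<open>The integer matrix determines the stabiliser element: the diagonal entries of
  \<open>g' ** \<gamma> ** g\<close> are those of \<open>hat a\<close> up to a scalar, which cancels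
  in the quotient by the entry at \<open>i0\<close>.\<close>

lemma countable_stab:
  fixes g :: "real^'n^'n"
  assumes "invertible g"
  shows "countable (stab g)"
proof -
  obtain g' where g': "g' ** g = mat 1" using assms by (auto simp: invertible_def)
  define f where "f \<gamma> = (\<lambda>i\<in>- {i0}. (g' ** \<gamma> ** g) $ i $ i / (g' ** \<gamma> ** g) $ i0 $ i0)" for \<gamma>
  have "stab g \<subseteq> f ` GLZ"
  proof
    fix a assume a: "a \<in> stab g"
    then obtain \<gamma> c where \<gamma>: "\<gamma> \<in> GLZ" "c \<noteq> 0" "g ** hat a = c *\<^sub>R (\<gamma> ** g)" by (rule stab_GLZ)
    have "hat a = g' ** (g ** hat a)" by (simp add: g' matrix_mul_assoc)
    also have "\<dots> = c *\<^sub>R (g' ** \<gamma> ** g)" by (simp add: \<gamma>(3) matrix_mul_assoc)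
    finally have *: "hat a $ i $ i = c * (g' ** \<gamma> ** g) $ i $ i" for i by simp
    have "(g' ** \<gamma> ** g) $ i0 $ i0 = 1 / c"
      using *[of i0] \<gamma>(2) by (simp add: hat_eq hv_def diagm_def field_simps)
    moreover have "(g' ** \<gamma> ** g) $ i $ i = a i / c" if "i \<noteq> i0" for i
      using *[of i] \<gamma>(2) that by (simp add: hat_eq hv_def diagm_def field_simps)
    moreover have "a \<in> extensional (- {i0})" using a stab_Hpar Hpar_extensional by blast
    ultimately have "f \<gamma> = a"
      using \<gamma>(2) by (auto simp: f_def extensional_def fun_eq_iff)
    then show "a \<in> f ` GLZ" using \<gamma>(1) by blast
  qed
  then show ?thesis using countable_GLZ by (meson countable_image countable_subset)
qed

definition sep :: "'n itself \<Rightarrow> real" where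
  "sep _ = sqrt (1 + 1 / (real CARD('n) + 1))"

lemma sep_gt_1: "sep TYPE('n) > 1"
  by (simp add: sep_def)

text \<open>The deviation \<open>N = \<plusminus>\<gamma> - 1\<close> from the identity of the integer matrix inducing a stabiliser element
  close to 1 has small real eigenvalues, so that the integer \<open>tr N\<^sup>2\<close> must vanish. The value of \<open>sep\<close>
  makes \<open>tr N\<^sup>2\<close> at most \<open>n / (n + 1)\<^sup>2\<close>.\<close>

lemma stab_separated:
  fixes g :: "real^'n^'n"
  assumes g: "invertible g" and a: "a \<in> stab g"
    and close: "\<And>i. i \<noteq> i0 \<Longrightarrow> 1 / sep TYPE('n) \<le> a i \<and> a i \<le> sep TYPE('n)"
  shows "a = tone"
proof -
  let ?n = "CARD('n)" and ?b = "sep TYPE('n)"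
  obtain g' where g': "g' ** g = mat 1" "g ** g' = mat 1" using g by (auto simp: invertible_def)
  obtain \<gamma> c where \<gamma>: "\<gamma> \<in> GLZ" "c \<noteq> 0" "g ** hat a = c *\<^sub>R (\<gamma> ** g)" using a by (rule stab_GLZ)
  have b1: "?b > 1" by (rule sep_gt_1)
  have d: "1 / ?b \<le> hv a $ i" "hv a $ i \<le> ?b" for i
    using close[of i] b1 by (auto simp: hv_def)
  have dpos: "hv a $ i > 0" for i
  proof -
    have "0 < 1 / ?b" using b1 by simp
    then show ?thesis using d(1)[of i] by linarith
  qed
  \<comment> \<open>Comparing determinants shows that the absolute value of c is the geometric mean
    of the entries of \<open>hv a\<close>, so it obeys the same bounds as they do.\<close>
  have "det g * (\<Prod>i\<in>UNIV. hv a $ i) = c ^ ?n * (det \<gamma> * det g)"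
    using arg_cong[OF \<gamma>(3), of det] by (simp add: det_mul det_scaleR hat_eq det_diagm)
  then have "\<bar>(\<Prod>i\<in>UNIV. hv a $ i)\<bar> = \<bar>c ^ ?n * det \<gamma>\<bar>"
    using g by (simp add: invertible_det_nz)
  then have cn: "(\<Prod>i\<in>UNIV. hv a $ i) = \<bar>c\<bar> ^ ?n"
    using \<gamma>(1) dpos by (simp add: abs_mult power_abs GLZ_def abs_prod less_imp_le)
  have "\<bar>c\<bar> ^ ?n \<le> ?b ^ ?n"
    using prod_mono[of UNIV "\<lambda>i. hv a $ i" "\<lambda>_. ?b"] d dpos by (simp add: cn[symmetric] less_imp_le)
  then have cb: "\<bar>c\<bar> \<le> ?b"
    using b1 by (subst (asm) power_mono_iff) auto
  have "(1 / ?b) ^ ?n \<le> \<bar>c\<bar> ^ ?n"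
    using prod_mono[of UNIV "\<lambda>_. 1 / ?b" "\<lambda>i. hv a $ i"] d b1 by (simp add: cn[symmetric])
  then have cb': "1 / ?b \<le> \<bar>c\<bar>"
    using b1 by (subst (asm) power_mono_iff) auto
  define e where "e i = hv a $ i / \<bar>c\<bar> - 1" for i
  define \<sigma> where "\<sigma> = sgn c"
  define N where "N = \<sigma> *\<^sub>R \<gamma> - mat 1"
  have sc: "\<sigma> * c = \<bar>c\<bar>" and s2: "\<sigma> * \<sigma> = 1" and sZ: "\<sigma> \<in> \<int>"
    using \<gamma>(2) by (auto simp: \<sigma>_def sgn_if)
  have bb: "?b * ?b = 1 + 1 / (real ?n + 1)" by (simp add: sep_def)
  have e_le: "\<bar>e i\<bar> \<le> 1 / (real ?n + 1)" for i
  proof -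
    have "hv a $ i / \<bar>c\<bar> \<le> ?b / (1 / ?b)" "1 / ?b / ?b \<le> hv a $ i / \<bar>c\<bar>"
      using d[of i] cb cb' b1 dpos[of i] \<gamma>(2) by (intro frac_le; simp)+
    moreover have "1 - 1 / (real ?n + 1) \<le> 1 / (1 + 1 / (real ?n + 1))"
      by (simp add: field_simps)
    ultimately show ?thesis by (simp add: e_def bb abs_le_iff)
  qed
  have N: "g' ** N ** g = diagm (\<chi> i. e i)"
  proof -
    have "c *\<^sub>R (g' ** \<gamma> ** g) = hat a"
      using \<gamma>(3) g' by (metis matrix_mul_assoc matrix_mul_lid scaleR_matrix_mult(2))
    then have "g' ** \<gamma> ** g = (1 / c) *\<^sub>R hat a" using \<gamma>(2) by (metis divide_self_if scaleR_one scaleR_scaleR times_divide_eq_left mult_1)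
    moreover have "g' ** N ** g = \<sigma> *\<^sub>R (g' ** \<gamma> ** g) - mat 1"
    proof -
      have "(N + mat 1) = \<sigma> *\<^sub>R \<gamma>" by (simp add: N_def)
      then have "g' ** (N + mat 1) ** g = \<sigma> *\<^sub>R (g' ** \<gamma> ** g)" by simp
      then show ?thesis by (simp add: matrix_add_ldistrib matrix_add_rdistrib g' eq_diff_eq)
    qed
    moreover have "\<sigma> * x / c = x / \<bar>c\<bar>" for x
      using \<gamma>(2) by (auto simp: \<sigma>_def sgn_if abs_if)
    ultimately show ?thesis
      by (auto simp: vec_eq_iff hat_eq diagm_def e_def mat_def)
  qed
  have NN: "g' ** (N ** N) ** g = diagm (\<chi> i. e i * e i)"
  proof -
    have "g' ** (N ** N) ** g = (g' ** N ** g) ** (g' ** N ** g)"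
      using g' by (metis matrix_mul_assoc matrix_mul_rid)
    then show ?thesis by (simp add: N diagm_mult)
  qed
  have "trace (N ** N) = trace (g' ** (N ** N) ** g)"
    using g' trace_mul_sym[of "g' ** (N ** N)" g] by (simp add: matrix_mul_assoc)
  then have tr: "trace (N ** N) = (\<Sum>i\<in>UNIV. e i * e i)"
    by (simp add: NN trace_def diagm_def)
  have "trace (N ** N) \<in> \<int>"
  proof -
    have "N $ i $ j \<in> \<int>" for i j
      using \<gamma>(1) sZ by (auto simp: N_def mat_def GLZ_def)
    then show ?thesis unfolding trace_def by (intro Ints_sum matrix_mult_Ints)
  qed
  moreover have "\<bar>trace (N ** N)\<bar> < 1"
  proof -
    have "\<bar>trace (N ** N)\<bar> = (\<Sum>i\<in>UNIV. e i * e i)"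
      unfolding tr by (intro abs_of_nonneg sum_nonneg) simp
    also have "\<dots> \<le> (\<Sum>i\<in>(UNIV :: 'n set). 1 / (real ?n + 1) * 1)"
    proof (rule sum_mono)
      fix i
      have "e i * e i = \<bar>e i\<bar> * \<bar>e i\<bar>" by simp
      also have "\<dots> \<le> 1 / (real ?n + 1) * 1"
        using e_le[of i] by (intro mult_mono) (auto intro: order_trans simp: divide_le_eq)
      finally show "e i * e i \<le> 1 / (real ?n + 1) * 1" .
    qed
    also have "\<dots> < 1" by (simp add: divide_less_eq)
    finally show ?thesis .
  qed
  ultimately have "trace (N ** N) = 0"
    by (meson Ints_nonzero_abs_ge1 not_less)
  then have "e i * e i = 0" for i
    unfolding tr by (subst (asm) sum_nonneg_eq_0_iff) auto
  \<comment> \<open>All entries of \<open>hv a\<close> agree, and the one at \<open>i0\<close> is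
    1.\<close>
  then have "hv a $ i = \<bar>c\<bar>" for i using \<gamma>(2) by (simp add: e_def)
  then have "hv a $ i = 1" for i
    by (metis (mono_tags, lifting) hv_def vec_lambda_beta)
  then have "a i = 1" if "i \<noteq> i0" for i
    using that by (metis (mono_tags, lifting) hv_def vec_lambda_beta)
  moreover have "a \<in> extensional (- {i0})" using a stab_Hpar Hpar_extensional by blast
  ultimately show ?thesis
    by (auto simp: tone_def extensional_def fun_eq_iff)
qed

section \<open>Covering and packing boxes\<close>

definition logbox :: "real \<Rightarrow> ('n \<Rightarrow> real) set" where
  "logbox T = {t \<in> Hpar. \<forall>i. i \<noteq> i0 \<longrightarrow> \<bar>ln \<bar>t i\<bar>\<bar> \<le> T}"

text \<open>Quotients of two of its elements satisfy the hypothesis of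
  \<open>stab_separated\<close>, so its stabiliser translates are disjoint, for every g.\<close>

definition sepbox :: "('n \<Rightarrow> real) set" where
  "sepbox = PiE (- {i0}) (\<lambda>_. {1..sep TYPE('n)})"

text \<open>As a product of annuli the box is measurable and of finite measure; the positive inner
  radius also encodes that no coordinate vanishes.\<close>

lemma logbox_eq: "logbox T = PiE (- {i0}) (\<lambda>_. {s. exp (- T) \<le> \<bar>s\<bar> \<and> \<bar>s\<bar> \<le> exp T})"
proof -
  have "s \<noteq> 0 \<and> \<bar>ln \<bar>s\<bar>\<bar> \<le> T \<longleftrightarrow> exp (- T) \<le> \<bar>s\<bar> \<and> \<bar>s\<bar> \<le> exp T" for s :: real
  proof (cases "s = 0")
    case False
    then have "ln \<bar>s\<bar> \<le> T \<longleftrightarrow> \<bar>s\<bar> \<le> exp T" "- T \<le> ln \<bar>s\<bar> \<longleftrightarrow> exp (- T) \<le> \<bar>s\<bar>"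
      using exp_le_cancel_iff[of "ln \<bar>s\<bar>" T] exp_le_cancel_iff[of "- T" "ln \<bar>s\<bar>"] by simp_all
    then show ?thesis using False by (auto simp: abs_le_iff)
  qed (simp add: not_le)
  note iff = this
  have "logbox T = {t \<in> extensional (- {i0}). \<forall>i. i \<noteq> i0 \<longrightarrow> t i \<noteq> 0 \<and> \<bar>ln \<bar>t i\<bar>\<bar> \<le> T}"
    unfolding logbox_def Hpar_def by blast
  also have "\<dots> = {t \<in> extensional (- {i0}). \<forall>i. i \<noteq> i0 \<longrightarrow> exp (- T) \<le> \<bar>t i\<bar> \<and> \<bar>t i\<bar> \<le> exp T}"
    by (simp only: iff)
  also have "\<dots> = PiE (- {i0}) (\<lambda>_. {s. exp (- T) \<le> \<bar>s\<bar> \<and> \<bar>s\<bar> \<le> exp T})"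
    unfolding PiE_def Pi_def by blast
  finally show ?thesis .
qed

lemma closed_annulus: "closed {s :: real. a \<le> \<bar>s\<bar> \<and> \<bar>s\<bar> \<le> b}"
  by (intro closed_Collect_conj closed_Collect_le continuous_intros)

lemma product_sigma_finite_mlt: "product_sigma_finite (\<lambda>_ :: 'n. mlt)"
  by (simp add: product_sigma_finite_def sigma_finite_mlt)

lemma logbox_sets [measurable]: "(logbox T :: ('n::finite \<Rightarrow> real) set) \<in> sets HaarH"
  unfolding HaarH_eq logbox_eq by (intro sets_PiM_I_finite) (auto intro!: borel_closed closed_annulus)

lemma sepbox_sets [measurable]: "(sepbox :: ('n::finite \<Rightarrow> real) set) \<in> sets HaarH"
  unfolding HaarH_eq sepbox_def by (intro sets_PiM_I_finite) auto

lemma emeasure_logbox: "emeasure HaarH (logbox T :: ('n::finite \<Rightarrow> real) set) < \<infinity>"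
proof -
  interpret product_sigma_finite "\<lambda>_ :: 'n. mlt" by (rule product_sigma_finite_mlt)
  let ?S = "{s :: real. exp (- T) \<le> \<bar>s\<bar> \<and> \<bar>s\<bar> \<le> exp T}"
  have "emeasure mlt ?S < \<infinity>"
    by (rule emeasure_mlt_finite[of _ "exp (- T)" "exp T"]) (auto intro!: borel_closed closed_annulus)
  then show ?thesis
    unfolding HaarH_eq logbox_eq
    by (subst emeasure_PiM) (auto intro!: borel_closed closed_annulus simp: power_less_top_ennreal)
qed

lemma emeasure_sepbox:
  "0 < emeasure HaarH (sepbox :: ('n::finite \<Rightarrow> real) set)"
proof -
  interpret product_sigma_finite "\<lambda>_ :: 'n. mlt" by (rule product_sigma_finite_mlt)
  show ?thesis
    unfolding HaarH_eq sepbox_def using emeasure_mlt_pos[OF sep_gt_1[where 'n='n]]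
    by (subst emeasure_PiM) (auto simp: zero_less_iff_neq_zero)
qed

lemma sepbox_Hpar: "sepbox \<subseteq> Hpar"
  using sep_gt_1 by (fastforce simp: sepbox_def Hpar_def PiE_def Pi_def)

lemma sepbox_packing:
  fixes g :: "real^'n^'n"
  assumes g: "invertible g" and "p \<in> sepbox" "q \<in> sepbox" "a \<in> stab g" "tmul p a = q"
  shows "a = tone"
proof (rule stab_separated[OF g assms(4)])
  fix i :: 'n assume i: "i \<noteq> i0"
  let ?b = "sep TYPE('n)"
  have pq: "1 \<le> p i" "p i \<le> ?b" "1 \<le> q i" "q i \<le> ?b"
    using assms(2,3) i by (auto simp: sepbox_def PiE_def Pi_def)
  have "q i = p i * a i" using assms(5) i by (auto simp: tmul_def)
  then have a: "a i = q i / p i" using pq by simp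
  have "1 / ?b \<le> q i / p i" using pq by (intro frac_le) auto
  moreover have "q i / p i \<le> ?b / 1" using pq by (intro frac_le) auto
  ultimately show "1 / ?b \<le> a i \<and> a i \<le> ?b" by (simp add: a)
qed

text \<open>Countability is what the construction of a fundamental domain needs; it comes from the
  density of the rationals.\<close>

lemma sepbox_translates:
  obtains s :: "nat \<Rightarrow> 'n::finite \<Rightarrow> real"
  where "\<And>k. s k \<in> Hpar" "\<And>t. t \<in> Hpar \<Longrightarrow> \<exists>k. tmul t (tinv (s k)) \<in> sepbox"
proof -
  let ?b = "sep TYPE('n)"
  have b: "?b > 1" by (rule sep_gt_1)
  define f :: "('n \<Rightarrow> rat) \<Rightarrow> 'n \<Rightarrow> real"
    where "f q = (\<lambda>i\<in>- {i0}. if q i = 0 then 1 else real_of_rat (q i))" for q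
  have "f q \<in> Hpar" for q by (auto simp: f_def Hpar_def)
  moreover have "\<exists>q. tmul t (tinv (f q)) \<in> sepbox" if t: "t \<in> Hpar" for t
  proof -
    have "\<exists>r :: rat. r \<noteq> 0 \<and> 1 \<le> t i / real_of_rat r \<and> t i / real_of_rat r \<le> ?b" if "i \<noteq> i0" for i
    proof -
      have ti: "t i \<noteq> 0" using t that by (auto simp: Hpar_def)
      \<comment> \<open>A rational r between these two numbers puts the quotient of the absolute
        value of \<open>t i\<close> by r into [1, \<open>?b\<close>]; the sign is restored
        afterwards.\<close>
      then have "\<bar>t i\<bar> / ?b < \<bar>t i\<bar>" using b by (simp add: divide_less_eq)
      then obtain r where r: "\<bar>t i\<bar> / ?b < real_of_rat r" "real_of_rat r < \<bar>t i\<bar>"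
        using of_rat_dense by blast
      have "0 < \<bar>t i\<bar> / ?b" using ti b by simp
      then have r0: "0 < real_of_rat r" using r(1) by (rule less_trans)
      have "1 \<le> \<bar>t i\<bar> / real_of_rat r" "\<bar>t i\<bar> / real_of_rat r \<le> ?b"
        using r r0 b by (simp_all add: le_divide_eq divide_le_eq divide_less_eq mult.commute)
      moreover have "\<bar>t i\<bar> / real_of_rat r = t i / real_of_rat (if t i > 0 then r else - r)"
        using ti by (simp add: of_rat_minus)
      moreover have "(if t i > 0 then r else - r) \<noteq> 0" using r0 by auto
      ultimately show ?thesis by metis
    qed
    then obtain q :: "'n \<Rightarrow> rat" where "\<And>i. i \<noteq> i0 \<Longrightarrow> q i \<noteq> 0 \<and> 1 \<le> t i / real_of_rat (q i) \<and> t i / real_of_rat (q i) \<le> ?b"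
      by metis
    then have "tmul t (tinv (f q)) \<in> sepbox"
      by (auto simp: tmul_def tinv_def f_def sepbox_def)
    then show ?thesis by blast
  qed
  ultimately show ?thesis
    using that[of "\<lambda>k. f (from_nat k)"] by (metis from_nat_to_nat)
qed

text \<open>Greedy choice: from the k-th translate of \<open>sepbox\<close> keep the points whose
  stabiliser orbit misses all earlier translates. Inside one translate a stabiliser orbit has at
  most one point, so exactly one point of every orbit survives.\<close>

lemma fund_dom_exists:
  fixes g :: "real^'n^'n"
  assumes g: "invertible g"
  shows "\<exists>F. fund_dom g F"
proof -
  obtain s :: "nat \<Rightarrow> 'n \<Rightarrow> real" where s: "\<And>k. s k \<in> Hpar"
    "\<And>t. t \<in> Hpar \<Longrightarrow> \<exists>k. tmul t (tinv (s k)) \<in> sepbox"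
    using sepbox_translates by metis
  define V where "V k = {t \<in> Hpar. tmul t (tinv (s k)) \<in> sepbox}" for k
  \<comment> \<open>The saturation of \<open>V k\<close> under the stabiliser, measurable because
    the stabiliser is countable.\<close>
  define W where "W k = (\<Union>a\<in>stab g. (\<lambda>t. tmul t a) -` V k \<inter> space HaarH)" for k
  have V [measurable]: "V k \<in> sets HaarH" for k
  proof -
    have "V k = Hpar \<inter> ((\<lambda>t. tmul t (tinv (s k))) -` sepbox \<inter> space HaarH)"
      using sets.sets_into_space[OF Hpar_sets] by (auto simp: V_def)
    also have "\<dots> \<in> sets HaarH" by measurable
    finally show ?thesis .
  qed
  have W [measurable]: "W k \<in> sets HaarH" for k
    unfolding W_def using countable_stab[OF g]
    by (intro sets.countable_UN') (auto intro!: measurable_sets[OF measurable_tmul V])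
  define F where "F = (\<Union>k. V k - (\<Union>j<k. W j))"
  have F: "F \<in> sets HaarH" unfolding F_def by measurable
  have VH: "V k \<subseteq> Hpar" for k by (auto simp: V_def)
  then have FH: "F \<subseteq> Hpar" by (auto simp: F_def)
  have WI: "t \<in> W k" if "t \<in> Hpar" "a \<in> stab g" "tmul t a \<in> V k" for t a k
    using that by (auto simp: W_def space_HaarH Hpar_extensional)
  have stabH: "a \<in> stab g \<Longrightarrow> a \<in> Hpar" for a using stab_Hpar by blast
  have uniq: "a = tone" if p: "p \<in> F" and q: "q \<in> F" and a: "a \<in> stab g" and eq: "tmul p a = q" for p q a
  proof -
    obtain k where k: "p \<in> V k" "\<And>j. j < k \<Longrightarrow> p \<notin> W j" using p by (auto simp: F_def)
    obtain l where l: "q \<in> V l" "\<And>j. j < l \<Longrightarrow> q \<notin> W j" using q by (auto simp: F_def)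
    have pq: "p \<in> Hpar" "q \<in> Hpar" using p q FH by auto
    have inv: "tmul q (tinv a) = p"
      using tmul_tmul_tinv[of a p] stabH[OF a] pq by (simp add: eq[symmetric] Hpar_extensional)
    \<comment> \<open>Each of p and q lies in the saturation of the piece containing the other,
      which excludes both k < l and l < k.\<close>
    have "p \<in> W l" using WI[of p a l] pq a l eq by simp
    moreover have "q \<in> W k" using WI[of q "tinv a" k] pq stab_tinv[OF a] k inv by simp
    ultimately have "k = l" using k(2)[of l] l(2)[of k] by (meson nat_neq_iff)
    have "tmul (tmul p (tinv (s k))) a = tmul q (tinv (s l))"
      by (simp add: \<open>k = l\<close> eq[symmetric] tmul_ac)
    then show ?thesis
      using k(1) l(1) by (intro sepbox_packing[OF g _ _ a]) (auto simp: V_def)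
  qed
  have "\<exists>!p. p \<in> F \<times> stab g \<and> t = tmul (fst p) (snd p)" if t: "t \<in> Hpar" for t
  proof (rule ex_ex1I)
    let ?P = "\<lambda>k. \<exists>a\<in>stab g. tmul t a \<in> V k"
    have "\<exists>k. ?P k"
      using s(2)[OF t] t by (auto simp: V_def intro!: bexI[OF _ tone_stab] simp: tmul_tone Hpar_extensional)
    define k where "k = (LEAST k. ?P k)"
    have "?P k" unfolding k_def using \<open>\<exists>k. ?P k\<close> by (rule LeastI_ex)
    then obtain a where a: "a \<in> stab g" "tmul t a \<in> V k" by blast
    have "tmul t a \<notin> W j" if "j < k" for j
    proof
      assume "tmul t a \<in> W j"
      then obtain b where b: "b \<in> stab g" "tmul (tmul t a) b \<in> V j" by (auto simp: W_def)
      then have "?P j" using stab_tmul[OF a(1) b(1)] by (auto simp: tmul_assoc)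
      then show False using that not_less_Least unfolding k_def by blast
    qed
    then have "tmul t a \<in> F" using a by (auto simp: F_def)
    moreover have "t = tmul (tmul t a) (tinv a)"
      using tmul_tmul_tinv[of a t] stabH[OF a(1)] t by (simp add: Hpar_extensional)
    ultimately show "\<exists>p. p \<in> F \<times> stab g \<and> t = tmul (fst p) (snd p)"
      using stab_tinv[OF a(1)] by (intro exI[of _ "(tmul t a, tinv a)"]) auto
  next
    fix x y assume x: "x \<in> F \<times> stab g \<and> t = tmul (fst x) (snd x)"
      and y: "y \<in> F \<times> stab g \<and> t = tmul (fst y) (snd y)"
    obtain p a where xp: "x = (p, a)" "p \<in> F" "a \<in> stab g" "t = tmul p a" using x by (cases x) auto
    obtain q b where yq: "y = (q, b)" "q \<in> F" "b \<in> stab g" "t = tmul q b" using y by (cases y) auto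
    have H: "p \<in> Hpar" "q \<in> Hpar" "a \<in> Hpar" "b \<in> Hpar" using xp yq FH stabH by auto
    have pq: "tmul p a = tmul q b" using xp(4) yq(4) by simp
    note eq = tmul_eq_cancel(1)[OF H(2,3,4) pq]
    have ab: "tmul a (tinv b) = tone"
      by (rule uniq[OF xp(2) yq(2) _ eq]) (intro stab_tmul stab_tinv xp yq)
    then have "p = q" using eq H by (simp add: tmul_tone Hpar_extensional)
    moreover have "a = b" by (rule tmul_eq_cancel(2)[OF H(2,3,4) pq ab])
    ultimately show "x = y" by (simp add: xp yq)
  qed
  then have "fund_dom g F" using F FH unfolding fund_dom_def by blast
  then show ?thesis by blast
qed

text \<open>Together with \<open>fund_dom_covering\<close> this splits the unique decomposition into
  the two hypotheses of \<open>packing_le_covering\<close>.\<close>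

lemma fund_dom_packing:
  assumes "fund_dom g F" "p \<in> F" "q \<in> F" "a \<in> stab g" "b \<in> stab g" "tmul p a = tmul q b"
  shows "a = b"
proof -
  have "tmul p a \<in> Hpar"
    using assms stab_Hpar[of g] by (auto simp: fund_dom_def intro!: tmul_Hpar)
  then have "\<exists>!x. x \<in> F \<times> stab g \<and> tmul p a = tmul (fst x) (snd x)"
    using assms(1) by (simp add: fund_dom_def)
  then have uniq: "\<And>x y. x \<in> F \<times> stab g \<and> tmul p a = tmul (fst x) (snd x) \<Longrightarrow>
      y \<in> F \<times> stab g \<and> tmul p a = tmul (fst y) (snd y) \<Longrightarrow> x = y"
    by blast
  have "(p, a) = (q, b)"
  proof (rule uniq)
    show "(p, a) \<in> F \<times> stab g \<and> tmul p a = tmul (fst (p, a)) (snd (p, a))"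
      using assms(2,4) by simp
    show "(q, b) \<in> F \<times> stab g \<and> tmul p a = tmul (fst (q, b)) (snd (q, b))"
      using assms(3,5,6) by simp
  qed
  then show ?thesis by simp
qed

lemma fund_dom_covering:
  fixes g :: "real^'n^'n"
  assumes "fund_dom g F" "t \<in> Hpar"
  shows "\<exists>c\<in>F. \<exists>a\<in>stab g. c = tmul t a"
proof -
  obtain x where x: "x \<in> F \<times> stab g" "t = tmul (fst x) (snd x)"
    using assms unfolding fund_dom_def by blast
  define c a where "c = fst x" and "a = snd x"
  have c: "c \<in> F" "a \<in> stab g" "t = tmul c a"
    using x by (auto simp: c_def a_def)
  have "c \<in> Hpar" "a \<in> Hpar"
    using c assms(1) stab_Hpar[of g] unfolding fund_dom_def by blast+
  then have "c = tmul t (tinv a)"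
    using tmul_tmul_tinv[of a c] c(3) by (simp add: Hpar_extensional)
  then show ?thesis using c stab_tinv by blast
qed

text \<open>\<open>sepbox\<close> packs and F covers. The left side does not depend on g, so it
  bounds all volumes from below at once.\<close>

lemma fund_dom_measure_ge:
  fixes g :: "real^'n^'n"
  assumes "fund_dom g F" "invertible g"
  shows "emeasure HaarH (sepbox :: ('n \<Rightarrow> real) set) \<le> emeasure HaarH F"
proof -
  have "emeasure HaarH ((sepbox :: ('n \<Rightarrow> real) set) \<inter> space HaarH) \<le> emeasure HaarH (F \<inter> space HaarH)"
  proof (rule packing_le_covering[of "stab g"])
    fix p q a b :: "'n \<Rightarrow> real"
    assume *: "p \<in> sepbox" "q \<in> sepbox" "a \<in> stab g" "b \<in> stab g" "tmul p a = tmul q b"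
    have H: "p \<in> Hpar" "q \<in> Hpar" "a \<in> Hpar" "b \<in> Hpar" using * sepbox_Hpar stab_Hpar by auto
    have "tmul a (tinv b) = tone"
      using * tmul_eq_cancel(1)[OF H(2,3,4) *(5)]
      by (intro sepbox_packing[OF assms(2)]) (auto intro: stab_tmul stab_tinv)
    then show "a = b" by (rule tmul_eq_cancel(2)[OF H(2,3,4) *(5)])
  next
    fix t a :: "'n \<Rightarrow> real" assume "t \<in> sepbox" "a \<in> stab g"
    then show "tmul t a \<in> space HaarH" by (simp add: space_HaarH tmul_def)
  qed (use assms sepbox_Hpar in \<open>auto intro: countable_stab stab_Hpar[THEN subsetD] fund_dom_covering simp: fund_dom_def subset_iff\<close>)
  then show ?thesis
    using assms(1) sets.sets_into_space[of F HaarH] sets.sets_into_space[OF sepbox_sets]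
    by (simp add: Int_absorb2 fund_dom_def)
qed

lemma measure_sepbox_pos: "0 < measure HaarH (sepbox :: ('n::finite \<Rightarrow> real) set)"
proof -
  have "(sepbox :: ('n \<Rightarrow> real) set) \<subseteq> logbox (ln (sep TYPE('n)))"
    using sep_gt_1[where 'n='n] sepbox_Hpar
    by (auto simp: sepbox_def logbox_def PiE_def Pi_def abs_of_nonneg ln_ge_zero)
  then have "emeasure HaarH (sepbox :: ('n \<Rightarrow> real) set) < \<infinity>"
    using emeasure_mono[OF _ logbox_sets] emeasure_logbox by (meson le_less_trans)
  then show ?thesis
    using emeasure_sepbox[where 'n='n] by (simp add: measure_def enn2real_positive_iff)
qed

text \<open>The translate of F by s is again a fundamental domain. Each of the two packs and covers,
  so they give the same measure to a stabiliser-invariant set. This is the source of the invariance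
  of the measure on the orbit.\<close>

lemma fund_dom_translate:
  fixes g :: "real^'n^'n"
  assumes F: "fund_dom g F" and g: "invertible g" and s: "s \<in> Hpar"
    and S [measurable]: "S \<in> sets HaarH"
    and inv: "\<And>t a. t \<in> Hpar \<Longrightarrow> a \<in> stab g \<Longrightarrow> t \<in> S \<Longrightarrow> tmul t a \<in> S"
  shows "emeasure HaarH {t \<in> F. tmul t s \<in> S} = emeasure HaarH (F \<inter> S)"
proof -
  have FH: "F \<in> sets HaarH" "F \<subseteq> Hpar" using F by (auto simp: fund_dom_def)
  note [measurable] = FH(1)
  define F' where "F' = {t \<in> Hpar. tmul t (tinv s) \<in> F}"
  have F'_eq: "F' = Hpar \<inter> ((\<lambda>t. tmul t (tinv s)) -` F \<inter> space HaarH)"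
    using sets.sets_into_space[OF Hpar_sets] by (auto simp: F'_def)
  have F' [measurable]: "F' \<in> sets HaarH" unfolding F'_eq by measurable
  have F'H: "F' \<subseteq> Hpar" by (auto simp: F'_def)
  have stabH: "a \<in> stab g \<Longrightarrow> a \<in> Hpar" for a using stab_Hpar by blast
  have pack: "a = b" if "p \<in> F'" "q \<in> F'" "a \<in> stab g" "b \<in> stab g" "tmul p a = tmul q b" for p q a b
    using that fund_dom_packing[OF F, of "tmul p (tinv s)" "tmul q (tinv s)" a b]
    by (auto simp: F'_def tmul_assoc tmul_commute[of "tinv s"]) (simp add: tmul_assoc[symmetric])
  have cov: "\<exists>c\<in>F'. \<exists>a\<in>stab g. c = tmul t a" if tH: "t \<in> Hpar" for t
  proof -
    obtain c a where c: "c \<in> F" "a \<in> stab g" "c = tmul (tmul t (tinv s)) a"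
      using fund_dom_covering[OF F tmul_Hpar[OF tH tinv_Hpar[OF s]]] by blast
    then have "tmul t a \<in> F'"
      using tH stabH by (auto simp: F'_def tmul_Hpar tmul_ac)
    then show ?thesis using c(2) by blast
  qed
  have "{t \<in> F. tmul t s \<in> S} \<in> sets HaarH"
  proof -
    have "{t \<in> F. tmul t s \<in> S} = F \<inter> ((\<lambda>t. tmul t s) -` S \<inter> space HaarH)"
      using sets.sets_into_space[OF FH(1)] by auto
    then show ?thesis by simp
  qed
  then have "emeasure HaarH {t \<in> F. tmul t s \<in> S} = (\<integral>\<^sup>+ t. indicator {t \<in> F. tmul t s \<in> S} t \<partial>HaarH)" by simp
  also have "\<dots> = (\<integral>\<^sup>+ t. indicator (F' \<inter> S) (tmul t s) \<partial>HaarH)"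
    using FH(2) s
    by (intro nn_integral_cong)
       (auto simp: indicator_def F'_def space_HaarH tmul_tmul_tinv tmul_Hpar_iff)
  also have "\<dots> = (\<integral>\<^sup>+ t. indicator (F' \<inter> S) t \<partial>HaarH)"
    by (rule nn_integral_HaarH_tmul[OF s]) measurable
  also have "\<dots> = emeasure HaarH (F' \<inter> S)" by simp
  also have "\<dots> = emeasure HaarH (F \<inter> S)"
  proof (rule antisym)
    show "emeasure HaarH (F' \<inter> S) \<le> emeasure HaarH (F \<inter> S)"
      by (rule packing_le_covering[of "stab g"])
        (use F'H FH pack fund_dom_covering[OF F] countable_stab[OF g] inv in \<open>auto intro: stabH\<close>)
    show "emeasure HaarH (F \<inter> S) \<le> emeasure HaarH (F' \<inter> S)"
      by (rule packing_le_covering[of "stab g"])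
        (use F'H FH cov fund_dom_packing[OF F] countable_stab[OF g] inv in \<open>auto intro: stabH\<close>)
  qed
  finally show ?thesis .
qed
text \<open>Quantitative cocompactness: T bounds the orbit in logarithmic coordinates and is also
  the scale that the smaller box in the cusp is compared with.\<close>

locale cocompact_stab =
  fixes g :: "real^'n^'n" and T :: real
  assumes g: "invertible g" and T: "T > 0"
    and cov: "\<And>t. t \<in> Hpar \<Longrightarrow> \<exists>a\<in>stab g. tmul t a \<in> logbox T"
begin

lemma fund_dom_measure_finite:
  assumes "fund_dom g F"
  shows "emeasure HaarH F < \<infinity>"
proof -
  have F: "F \<in> sets HaarH" "F \<subseteq> Hpar" using assms(1) by (auto simp: fund_dom_def)
  have "emeasure HaarH (F \<inter> space HaarH) \<le> emeasure HaarH ((logbox T :: ('n \<Rightarrow> real) set) \<inter> space HaarH)"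
  proof (rule packing_le_covering[of "stab g"])
    show "\<And>p. p \<in> F \<Longrightarrow> \<exists>c\<in>logbox T. \<exists>a\<in>stab g. c = tmul p a" using cov F by blast
    fix t a :: "'n \<Rightarrow> real" assume "t \<in> F" "a \<in> stab g"
    then show "tmul t a \<in> space HaarH" by (simp add: space_HaarH tmul_def)
  qed (use F fund_dom_packing[OF assms] countable_stab[OF g] stab_Hpar[of g] in auto)
  also have "\<dots> < \<infinity>"
    using emeasure_logbox sets.sets_into_space[OF logbox_sets] by (simp add: Int_absorb2)
  finally show ?thesis
    using sets.sets_into_space[OF F(1)] by (simp add: Int_absorb2)
qed

text \<open>Finiteness of the fundamental domain is essential, because \<open>measure\<close>
  assigns 0 to sets of infinite measure.\<close>

lemma vol_ge: "vol g \<ge> measure HaarH (sepbox :: ('n \<Rightarrow> real) set)"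
proof -
  let ?F = "SOME F. fund_dom g F"
  have F: "fund_dom g ?F" using fund_dom_exists[OF g] by (rule someI_ex)
  show ?thesis
    unfolding vol_def measure_def
    using fund_dom_measure_ge[OF F g] fund_dom_measure_finite[OF F]
    by (intro enn2real_mono) auto
qed

end

subsection \<open>The invariant probability measure on a periodic orbit\<close>

text \<open>Made total with values in the orbit, so that it is a map into X on the whole parameter
  space, including points with a zero coordinate.\<close>

definition orbmap :: "real^'n^'n \<Rightarrow> ('n \<Rightarrow> real) \<Rightarrow> (real^'n^'n) set" where
  "orbmap g t = cls (g ** hat (if t \<in> Hpar then t else tone))"

lemma invertible_mult_hat: "invertible g \<Longrightarrow> t \<in> Hpar \<Longrightarrow> invertible (g ** hat t)"
  by (intro invertible_mult invertible_hat)

lemma orbmap_Xset: "invertible g \<Longrightarrow> orbmap g t \<in> Xset"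
  by (auto simp: orbmap_def intro!: cls_Xset invertible_mult_hat tone_Hpar)

lemma hv_i0 [simp]: "hv t $ i0 = 1"
  by (simp add: hv_def)

lemma measurable_hv: "(hv :: ('n::finite \<Rightarrow> real) \<Rightarrow> real^'n) \<in> borel_measurable HaarH"
proof -
  have "(\<lambda>t :: 'n \<Rightarrow> real. hv t \<bullet> axis i 1) \<in> borel_measurable HaarH" for i
  proof (cases "i = i0")
    case True
    then show ?thesis by (simp add: hv_def inner_axis)
  next
    case False
    have "(\<lambda>t :: 'n \<Rightarrow> real. t i) \<in> measurable (PiM (- {i0}) (\<lambda>_. mlt)) mlt"
      using False by (intro measurable_component_singleton) auto
    then show ?thesis using False by (simp add: hv_def inner_axis HaarH_eq)
  qed
  then show ?thesis
    unfolding borel_measurable_euclidean_space[of hv] by (auto simp: Basis_vec_def)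
qed

lemma continuous_on_diagm: "continuous_on S (\<lambda>v. g ** diagm v)" for g :: "real^'n^'n"
proof -
  have eq: "(\<lambda>v. g ** diagm v) = (\<lambda>v. \<chi> i j. g $ i $ j * v $ j)"
    by (simp add: fun_eq_iff vec_eq_iff matrix_mult_diagm)
  show ?thesis unfolding eq by (intro continuous_intros)
qed

lemma measurable_orbmap:
  fixes g :: "real^'n^'n"
  assumes g: "invertible g"
  shows "orbmap g \<in> measurable HaarH borelX"
proof (rule measurable_borelXI)
  fix U :: "(real^'n^'n) set set" assume U: "openin Xtop U"
  let ?O = "{v. g ** diagm v \<in> {M. invertible M \<and> cls M \<in> U}}"
  have "open ?O"
    using U continuous_on_diagm[of UNIV g] by (auto simp: openin_Xtop vimage_def dest: open_vimage)
  then have O: "hv -` ?O \<inter> space HaarH \<in> sets HaarH"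
    by (intro measurable_sets[OF measurable_hv]) auto
  \<comment> \<open>Off \<open>Hpar\<close> the map has the constant value
    \<open>cls g\<close>.\<close>
  have "orbmap g -` U \<inter> space HaarH =
      (Hpar \<inter> (hv -` ?O \<inter> space HaarH)) \<union> (if cls g \<in> U then space HaarH - Hpar else {})"
    using sets.sets_into_space[OF Hpar_sets] invertible_mult_hat[OF g]
    by (auto simp: orbmap_def hat_tone hat_eq[symmetric] split: if_splits)
  also have "\<dots> \<in> sets HaarH" using O by auto
  finally show "orbmap g -` U \<inter> space HaarH \<in> sets HaarH" .
qed (use orbmap_Xset[OF g] in auto)

lemma orbmap_sets:
  fixes g :: "real^'n^'n"
  assumes "invertible g" "A \<in> sets borelX"
  shows "{t \<in> Hpar. cls (g ** hat t) \<in> A} \<in> sets HaarH"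
proof -
  have "{t \<in> Hpar. cls (g ** hat t) \<in> A} = Hpar \<inter> (orbmap g -` A \<inter> space HaarH)"
    using sets.sets_into_space[OF Hpar_sets] by (auto simp: orbmap_def)
  also have "\<dots> \<in> sets HaarH"
    using measurable_sets[OF measurable_orbmap[OF assms(1)] assms(2)] by auto
  finally show ?thesis .
qed

lemma Ract_Xset:
  assumes "invertible h" "p \<in> Xset" shows "Ract h p \<in> Xset"
  using assms by (auto simp: Xset_def Ract_cls intro!: imageI invertible_mult)

lemma measurable_Ract:
  fixes h :: "real^'n^'n"
  assumes h: "invertible h"
  shows "Ract h \<in> measurable borelX borelX"
proof (rule measurable_borelXI)
  fix U :: "(real^'n^'n) set set" assume U: "openin Xtop U"
  have "openin Xtop (Ract h -` U \<inter> Xset)"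
    unfolding openin_Xtop
  proof
    have "{g. invertible g \<and> cls g \<in> Ract h -` U \<inter> Xset} =
        GL \<inter> (\<lambda>g. g ** h) -` {g. invertible g \<and> cls g \<in> U}"
      using h by (auto simp: Ract_cls cls_Xset intro: invertible_mult)
    also have "open \<dots>"
    proof (intro open_Int open_invertible open_vimage)
      show "continuous_on UNIV (\<lambda>g. g ** h)"
        unfolding matrix_matrix_mult_def by (intro continuous_intros)
    qed (use U in \<open>simp add: openin_Xtop\<close>)
    finally show "open {g. invertible g \<and> cls g \<in> Ract h -` U \<inter> Xset}" .
  qed auto
  then show "Ract h -` U \<inter> space borelX \<in> sets borelX"
    by (simp add: space_borelX openin_sets_borelX)
qed (use Ract_Xset[OF h] in \<open>auto simp: space_borelX\<close>)

section \<open>The orbit is compact and closed\<close>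

lemma closed_GLZ: "closed (GLZ :: (real^'n^'n) set)"
proof -
  have "GLZ = (\<Inter>i. \<Inter>j. (\<lambda>A :: real^'n^'n. A $ i $ j) -` \<int>) \<inter> (\<lambda>A. \<bar>det A\<bar>) -` {1}"
    by (auto simp: GLZ_def)
  also have "closed \<dots>"
    by (intro closed_Int closed_INT ballI closed_vimage continuous_intros continuous_on_det closed_Ints)
  finally show ?thesis .
qed

lemma hv_logbox:
  assumes "t \<in> logbox T" "T \<ge> 0"
  shows "exp (- T) \<le> \<bar>hv t $ i\<bar>" "\<bar>hv t $ i\<bar> \<le> exp T"
  using assms by (auto simp: hv_def logbox_eq PiE_def Pi_def)

lemma compact_annuli: "compact {w :: real^'n. \<forall>i. lo \<le> \<bar>w $ i\<bar> \<and> \<bar>w $ i\<bar> \<le> hi}"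
proof -
  let ?S = "{w :: real^'n. \<forall>i. lo \<le> \<bar>w $ i\<bar> \<and> \<bar>w $ i\<bar> \<le> hi}"
  have "?S \<subseteq> cbox (\<chi> i. - hi) (\<chi> i. hi)"
  proof
    fix w assume w: "w \<in> ?S"
    have "- hi \<le> w $ i \<and> w $ i \<le> hi" for i
      using w by (auto dest: spec[of _ i])
    then show "w \<in> cbox (\<chi> i. - hi) (\<chi> i. hi)" by (simp add: mem_box_cart)
  qed
  then have "?S = ?S \<inter> cbox (\<chi> i. - hi) (\<chi> i. hi)" by blast
  also have "compact \<dots>"
    by (intro closed_Int_compact compact_cbox closed_Collect_all closed_Collect_conj closed_Collect_le continuous_intros)
  finally show ?thesis .
qed

lemma orbit_Xset: "invertible g \<Longrightarrow> orbit g \<subseteq> Xset"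
  by (auto simp: orbit_eq intro!: cls_Xset invertible_mult_hat)

context cocompact_stab
begin

lemma orbit_eq_logbox: "orbit g = (\<lambda>t. cls (g ** hat t)) ` logbox T"
proof -
  have "cls (g ** hat t) \<in> (\<lambda>t. cls (g ** hat t)) ` logbox T" if t: "t \<in> Hpar" for t
  proof -
    obtain a where a: "a \<in> stab g" "tmul t a \<in> logbox T" using cov[OF t] by blast
    then show ?thesis using cls_hat_stab[OF a(1) t] by (metis imageI)
  qed
  moreover have "logbox T \<subseteq> Hpar" by (auto simp: logbox_def)
  ultimately show ?thesis unfolding orbit_eq by blast
qed

text \<open>In the coordinates \<open>hv\<close> the box is compact because its entries are bounded
  and bounded away from 0.\<close>

lemma compactin_orbit: "compactin Xtop (orbit g)"
proof -
  let ?W = "{w :: real^'n. \<forall>i. exp (- T) \<le> \<bar>w $ i\<bar> \<and> \<bar>w $ i\<bar> \<le> exp T} \<inter> {w. w $ i0 = 1}"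
  have img: "hv ` logbox T = ?W"
  proof (intro equalityI subsetI)
    fix w assume "w \<in> ?W"
    then have w: "\<And>i. exp (- T) \<le> \<bar>w $ i\<bar>" "\<And>i. \<bar>w $ i\<bar> \<le> exp T" "w $ i0 = 1" by auto
    define t where "t = restrict (\<lambda>i. w $ i) (- {i0})"
    have "t \<in> logbox T" using w by (auto simp: logbox_eq t_def)
    moreover have "hv t = w" using w by (auto simp: hv_def t_def vec_eq_iff)
    ultimately show "w \<in> hv ` logbox T" by blast
  qed (use hv_logbox[OF _ less_imp_le[OF T]] in auto)
  have "orbit g = cls ` (\<lambda>v. g ** diagm v) ` (hv ` logbox T)"
    using orbit_eq_logbox by (simp add: image_image hat_eq)
  then have "orbit g = cls ` (\<lambda>v. g ** diagm v) ` ?W"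
    unfolding img .
  moreover have "compact ((\<lambda>v. g ** diagm v) ` ?W)"
    by (intro compact_continuous_image continuous_on_diagm compact_Int_closed compact_annuli closed_Collect_eq continuous_intros)
  moreover have "(\<lambda>v. g ** diagm v) ` ?W \<subseteq> GL"
  proof safe
    fix w :: "real^'n" assume w: "\<forall>i. exp (- T) \<le> \<bar>w $ i\<bar> \<and> \<bar>w $ i\<bar> \<le> exp T"
    have "w $ i \<noteq> 0" for i
      using w exp_gt_zero[of "- T"] by (metis abs_zero not_le)
    then have "invertible (diagm w)" by (simp add: invertible_det_nz det_diagm)
    with g show "invertible (g ** diagm w)" by (rule invertible_mult)
  qed
  ultimately show ?thesis by (simp add: compactin_cls_image)
qed

text \<open>A limit of matrices \<open>\<gamma>\<^sub>k g diag(s\<^sub>k)\<close> has the same form, because the \<open>s\<^sub>k\<close> stay in a compact set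
  and \<open>GL\<^sub>n(\<int>)\<close> is closed.\<close>

lemma openin_compl_orbit: "openin Xtop (Xset - orbit g)"
  unfolding openin_Xtop
proof
  let ?n = "CARD('n)"
  obtain g' where g': "g ** g' = mat 1" "g' ** g = mat 1" using g by (auto simp: invertible_def)
  \<comment> \<open>M lies in \<open>Q lo hi\<close> when a diagonal factor with entries in fixed
    annuli carries it to an integer matrix times g. This is a projection along a compact factor,
    hence closed.\<close>
  define Q where "Q lo hi = {M. \<exists>w. w \<in> {w :: real^'n. \<forall>i. lo \<le> \<bar>w $ i\<bar> \<and> \<bar>w $ i\<bar> \<le> hi} \<and> M ** diagm w ** g' \<in> GLZ}" for lo hi
  have closedQ: "closed (Q lo hi)" for lo hi
  proof -
    let ?S = "{w :: real^'n. \<forall>i. lo \<le> \<bar>w $ i\<bar> \<and> \<bar>w $ i\<bar> \<le> hi}"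
    have "continuous_on UNIV (\<lambda>x :: (real^'n) \<times> (real^'n^'n). snd x ** diagm (fst x) ** g')"
    proof -
      have eq: "(\<lambda>x :: (real^'n) \<times> (real^'n^'n). snd x ** diagm (fst x) ** g') =
        (\<lambda>x. \<chi> i j. \<Sum>k\<in>UNIV. snd x $ i $ k * fst x $ k * g' $ k $ j)"
        by (simp add: fun_eq_iff vec_eq_iff matrix_mult_diagm matrix_matrix_mult_def[of _ g'])
      show ?thesis unfolding eq by (intro continuous_intros)
    qed
    then have "closed {x :: (real^'n) \<times> (real^'n^'n). snd x ** diagm (fst x) ** g' \<in> GLZ}"
      using closed_vimage[OF closed_GLZ] by (auto simp: vimage_def)
    then have "closedin (top_of_set (?S \<times> UNIV)) ((?S \<times> UNIV) \<inter> {x. snd x ** diagm (fst x) ** g' \<in> GLZ})"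
      by (intro closedin_closed_Int)
    then have "closedin (top_of_set UNIV) {M. \<exists>w. w \<in> ?S \<and> (w, M) \<in> (?S \<times> UNIV) \<inter> {x. snd x ** diagm (fst x) ** g' \<in> GLZ}}"
      by (rule closedin_compact_projection[OF compact_annuli])
    then show ?thesis by (simp add: Q_def)
  qed
  have QP: "cls M \<in> orbit g" if MQ: "M \<in> Q lo hi" and lo0: "lo > 0" for M lo hi
  proof -
    obtain w where w: "\<And>i. lo \<le> \<bar>w $ i\<bar>" "M ** diagm w ** g' \<in> GLZ"
      using MQ by (auto simp: Q_def)
    have w0: "w $ i \<noteq> 0" for i using w(1)[of i] lo0 by auto
    define h where "h = diagm (\<chi> i. 1 / w $ i)"
    have "diagm w ** h = mat 1"
      using w0 by (simp add: h_def diagm_mult diagm_1)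
    then have "M = (M ** diagm w ** g') ** (g ** h)"
      using g' by (metis matrix_mul_assoc matrix_mul_rid)
    then have "cls M = cls (g ** h)" using cls_GLZ[OF w(2), of "g ** h"] by simp
    moreover have "h \<in> Hmat" using w0 by (auto simp: Hmat_def h_def)
    ultimately show ?thesis by (auto simp: orbit_def)
  qed
  let ?P = "{M. invertible M \<and> cls M \<in> Xset - orbit g}"
  show "open ?P"
  proof (subst open_subopen, intro ballI)
    fix M0 assume M0: "M0 \<in> ?P"
    define d where "d = \<bar>det M0\<bar>"
    define D where "D = {M :: real^'n^'n. d / 2 < \<bar>det M\<bar> \<and> \<bar>det M\<bar> < 2 * d}"
    have d: "d > 0" using M0 by (simp add: d_def invertible_det_nz)
    have oD: "open D" unfolding D_def
      by (intro open_Collect_conj open_Collect_less continuous_intros continuous_on_det)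
    \<comment> \<open>On D the determinant controls the scalar: if M is c times
      \<open>\<gamma> ** (g ** hat t)\<close> with t in the box, then the n-th power of the absolute
      value of c lies between A and B. This confines the diagonal factor w to the annulus from
      \<open>?lo\<close> to \<open>?hi\<close>.\<close>
    define A where "A = d / (2 * \<bar>det g\<bar> * exp T ^ ?n)"
    define B where "B = 2 * d * exp T ^ ?n / \<bar>det g\<bar>"
    have dg: "\<bar>det g\<bar> > 0" using g by (simp add: invertible_det_nz)
    have AB: "A > 0" "B > 0" using d dg by (auto simp: A_def B_def)
    let ?lo = "exp (- T) / root ?n B" and ?hi = "exp T / root ?n A"
    have lo: "?lo > 0" using AB by simp
    have PQ: "M \<in> Q ?lo ?hi" if MD: "M \<in> D" and MO: "cls M \<in> orbit g" for M
    proof -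
      obtain t where t: "t \<in> logbox T" "cls M = cls (g ** hat t)"
        using MO orbit_eq_logbox by auto
      then obtain \<gamma> c where M: "M = c *\<^sub>R (\<gamma> ** (g ** hat t))" "\<gamma> \<in> GLZ" "c \<noteq> 0"
        using cls_self[of M] by (auto simp: cls_def)
      note hvb = hv_logbox[OF t(1) less_imp_le[OF T]]
      have hv0: "hv t $ i \<noteq> 0" for i using hvb(1)[of i] exp_gt_zero[of "- T"] by (auto simp: not_le)
      define w where "w = (\<chi> i. 1 / (c * hv t $ i))"
      define p where "p = \<bar>\<Prod>i\<in>UNIV. hv t $ i\<bar>"
      have detM: "\<bar>det M\<bar> = \<bar>c\<bar> ^ ?n * (\<bar>det g\<bar> * p)"
        using M(2) by (simp add: M(1) det_scaleR det_mul abs_mult power_abs hat_eq det_diagm p_def GLZ_def)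
      have "p \<le> (\<Prod>i\<in>(UNIV :: 'n set). exp T)"
        unfolding p_def abs_prod by (intro prod_mono) (use hvb in auto)
      then have p_le: "p \<le> exp T ^ ?n" by simp
      have "(\<Prod>i\<in>(UNIV :: 'n set). exp (- T)) \<le> p"
        unfolding p_def abs_prod by (intro prod_mono) (use hvb in auto)
      then have p_ge: "1 \<le> p * exp T ^ ?n" by (simp add: exp_minus field_simps)
      have p0: "p > 0" using hv0 by (simp add: p_def)
      have "A \<le> \<bar>c\<bar> ^ ?n"
      proof -
        have "d / 2 \<le> \<bar>c\<bar> ^ ?n * (\<bar>det g\<bar> * exp T ^ ?n)"
          using MD mult_left_mono[OF p_le, of "\<bar>c\<bar> ^ ?n * \<bar>det g\<bar>"]
          by (simp add: D_def detM mult_ac)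
        then show ?thesis using dg by (simp add: A_def divide_le_eq mult_ac)
      qed
      moreover have "\<bar>c\<bar> ^ ?n \<le> B"
      proof -
        have "\<bar>c\<bar> ^ ?n * \<bar>det g\<bar> * 1 \<le> \<bar>c\<bar> ^ ?n * \<bar>det g\<bar> * (p * exp T ^ ?n)"
          by (intro mult_left_mono p_ge) auto
        also have "\<dots> \<le> 2 * d * exp T ^ ?n"
          using MD by (simp add: D_def detM mult_ac)
        finally show ?thesis using dg by (simp add: B_def le_divide_eq)
      qed
      ultimately have c: "root ?n A \<le> \<bar>c\<bar>" "\<bar>c\<bar> \<le> root ?n B"
        using real_root_le_mono[of ?n A "\<bar>c\<bar> ^ ?n"] real_root_le_mono[of ?n "\<bar>c\<bar> ^ ?n" B]
        by (simp_all add: real_root_power_cancel)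
      have "?lo \<le> \<bar>w $ i\<bar> \<and> \<bar>w $ i\<bar> \<le> ?hi" for i
      proof
        have w: "\<bar>w $ i\<bar> = 1 / (\<bar>hv t $ i\<bar> * \<bar>c\<bar>)" by (simp add: w_def abs_mult mult.commute)
        have "?lo = 1 / (exp T * root ?n B)" by (simp add: exp_minus field_simps)
        also have "\<dots> \<le> \<bar>w $ i\<bar>"
          unfolding w using M(3) hv0 hvb c AB by (intro divide_left_mono mult_mono mult_pos_pos) auto
        finally show "?lo \<le> \<bar>w $ i\<bar>" .
        have "\<bar>w $ i\<bar> \<le> 1 / (exp (- T) * root ?n A)"
          unfolding w using M(3) hv0 hvb c AB by (intro divide_left_mono mult_mono mult_pos_pos) auto
        also have "\<dots> = ?hi" by (simp add: exp_minus field_simps)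
        finally show "\<bar>w $ i\<bar> \<le> ?hi" .
      qed
      moreover have "M ** diagm w ** g' = \<gamma>"
      proof -
        have "c *\<^sub>R (hat t ** diagm w) = mat 1"
          using M(3) hv0 by (simp add: hat_eq diagm_mult w_def) (simp add: diagm_def mat_def vec_eq_iff)
        moreover have "M ** diagm w ** g' = \<gamma> ** g ** (c *\<^sub>R (hat t ** diagm w)) ** g'"
          by (simp add: M(1) matrix_mul_assoc)
        ultimately show ?thesis
          using g' by (metis matrix_mul_assoc matrix_mul_rid)
      qed
      ultimately show ?thesis using M(2) by (auto simp: Q_def intro!: exI[of _ w])
    qed
    show "\<exists>V. open V \<and> M0 \<in> V \<and> V \<subseteq> ?P"
    proof (intro exI conjI)
      show "open (D - Q ?lo ?hi)" by (intro open_Diff oD closedQ)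
      show "M0 \<in> D - Q ?lo ?hi" using M0 d QP[OF _ lo] by (auto simp: D_def d_def)
      show "D - Q ?lo ?hi \<subseteq> ?P"
      proof
        fix M assume M: "M \<in> D - Q ?lo ?hi"
        then have "invertible M" using d by (auto simp: D_def invertible_det_nz)
        then show "M \<in> ?P" using PQ M cls_Xset by auto
      qed
    qed
  qed
qed auto

lemma orbit_sets: "orbit g \<in> sets borelX"
proof -
  have "space borelX - (Xset - orbit g) \<in> sets borelX"
    using openin_sets_borelX[OF openin_compl_orbit] by (rule sets.compl_sets)
  then show ?thesis using orbit_Xset[OF g] by (simp add: space_borelX double_diff)
qed
end

section \<open>Existence and uniqueness of the invariant measure\<close>

definition orbprob :: "real^'n^'n \<Rightarrow> ('n \<Rightarrow> real) set \<Rightarrow> (real^'n^'n) set measure" where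
  "orbprob g F = distr (uniform_measure HaarH F) borelX (orbmap g)"

lemma emeasure_orbprob:
  fixes g :: "real^'n^'n"
  assumes g: "invertible g" and F: "fund_dom g F" and A: "A \<in> sets borelX"
  shows "emeasure (orbprob g F) A = emeasure HaarH (F \<inter> {t \<in> Hpar. cls (g ** hat t) \<in> A}) / emeasure HaarH F"
proof -
  have FH: "F \<in> sets HaarH" "F \<subseteq> Hpar" using F by (auto simp: fund_dom_def)
  have m: "orbmap g -` A \<inter> space HaarH \<in> sets HaarH"
    using measurable_orbmap[OF g] A by (rule measurable_sets)
  have "orbmap g \<in> measurable (uniform_measure HaarH F) borelX"
    using measurable_orbmap[OF g] by (simp add: measurable_cong_sets[OF sets_uniform_measure refl])
  then have "emeasure (orbprob g F) A = emeasure (uniform_measure HaarH F) (orbmap g -` A \<inter> space HaarH)"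
    unfolding orbprob_def using A by (simp add: emeasure_distr)
  also have "\<dots> = emeasure HaarH (F \<inter> (orbmap g -` A \<inter> space HaarH)) / emeasure HaarH F"
    by (rule emeasure_uniform_measure[OF FH(1) m])
  also have "F \<inter> (orbmap g -` A \<inter> space HaarH) = F \<inter> {t \<in> Hpar. cls (g ** hat t) \<in> A}"
    using FH(2) sets.sets_into_space[OF FH(1)] by (auto simp: orbmap_def)
  finally show ?thesis .
qed

lemma stab_invariant_preimage:
  fixes g :: "real^'n^'n"
  assumes "a \<in> stab g" "t \<in> {t \<in> Hpar. cls (g ** hat t) \<in> A}"
  shows "tmul t a \<in> {t \<in> Hpar. cls (g ** hat t) \<in> A}"
  using assms cls_hat_stab[of a g t] stab_Hpar[of g] by (auto intro: tmul_Hpar)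

lemma sigma_finite_HaarH: "sigma_finite_measure (HaarH :: ('n::finite \<Rightarrow> real) measure)"
proof -
  interpret product_sigma_finite "\<lambda>_ :: 'n. mlt" by (rule product_sigma_finite_mlt)
  show ?thesis unfolding HaarH_eq by (rule sigma_finite) simp
qed

text \<open>As \<open>H\<close> is second countable, the set is a countable union of open rectangles.\<close>

lemma action_rectangles:
  fixes A :: "(real^'n^'n) set set"
  assumes A: "openin Xtop A"
  shows "{x \<in> Xset \<times> Hpar. Ract (hat (snd x)) (fst x) \<in> A} \<in> sets (borelX \<Otimes>\<^sub>M HaarH)"
proof -
  obtain \<B> :: "(real^'n) set set" where \<B>: "countable \<B>" "topological_basis \<B>"
    using ex_countable_basis by blast
  \<comment> \<open>The union of all open sets that every h with \<open>hv h\<close> in B carries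
    into A. It is open, so its product with the parameter set of B is a measurable
    rectangle.\<close>
  define W where "W B = \<Union>{W. openin Xtop W \<and> (\<forall>p\<in>W. \<forall>h\<in>Hpar. hv h \<in> B \<longrightarrow> Ract (hat h) p \<in> A)}" for B
  have oW: "openin Xtop (W B)" for B unfolding W_def by (rule openin_Union) auto
  have "{x \<in> Xset \<times> Hpar. Ract (hat (snd x)) (fst x) \<in> A} =
      (\<Union>B\<in>\<B>. W B \<times> (Hpar \<inter> (hv -` B \<inter> space HaarH)))" (is "?L = ?R")
  proof (intro equalityI subsetI)
    fix x assume "x \<in> ?L"
    then obtain p h where x: "x = (p, h)" "p \<in> Xset" "h \<in> Hpar" "Ract (hat h) p \<in> A" by auto
    then obtain g where g: "invertible g" "p = cls g" by (auto simp: Xset_def)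
    define Q where "Q = {M. invertible M \<and> cls M \<in> A}"
    have oO: "open Q" using A by (simp add: Q_def openin_Xtop)
    have eq: "(\<lambda>y :: (real^'n^'n) \<times> (real^'n). fst y ** diagm (snd y)) = (\<lambda>y. \<chi> i j. fst y $ i $ j * snd y $ j)"
      by (simp add: fun_eq_iff vec_eq_iff matrix_mult_diagm)
    have "continuous_on UNIV (\<lambda>y :: (real^'n^'n) \<times> (real^'n). fst y ** diagm (snd y))"
      unfolding eq by (intro continuous_intros)
    then have "open ((\<lambda>y :: (real^'n^'n) \<times> (real^'n). fst y ** diagm (snd y)) -` Q)"
      using oO by (rule open_vimage[rotated])
    moreover have "(g, hv h) \<in> (\<lambda>y. fst y ** diagm (snd y)) -` Q"
      using x g invertible_mult_hat[OF g(1) x(3)] by (simp add: Q_def Ract_cls hat_eq)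
    ultimately obtain V B0 where V: "open V" "open B0" "(g, hv h) \<in> V \<times> B0"
      "V \<times> B0 \<subseteq> (\<lambda>y. fst y ** diagm (snd y)) -` Q"
      by (rule open_prod_elim)
    obtain B where B: "B \<in> \<B>" "hv h \<in> B" "B \<subseteq> B0"
      using \<B>(2) V(2,3) by (auto elim: topological_basisE)
    have "cls ` {M \<in> V. invertible M} \<subseteq> W B"
      unfolding W_def
    proof (intro Union_upper CollectI conjI ballI impI)
      show "openin Xtop (cls ` {M \<in> V. invertible M})" by (rule openin_cls_image[OF V(1)])
      fix q k assume "q \<in> cls ` {M \<in> V. invertible M}" "k \<in> Hpar" "hv k \<in> B"
      then obtain M where M: "M \<in> V" "q = cls M" by auto
      have "(M, hv k) \<in> V \<times> B0" using M \<open>hv k \<in> B\<close> B by auto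
      then have "M ** diagm (hv k) \<in> Q" using V(4) by auto
      then show "Ract (hat k) q \<in> A" by (simp add: M Ract_cls hat_eq Q_def)
    qed
    then have "p \<in> W B" using g V(3) by auto
    then show "x \<in> ?R" using B x by (auto simp: space_HaarH Hpar_extensional)
  next
    fix x assume "x \<in> ?R"
    then obtain B p h where x: "x = (p, h)" "p \<in> W B" "h \<in> Hpar" "hv h \<in> B" by auto
    then have "Ract (hat h) p \<in> A" by (auto simp: W_def)
    moreover have "p \<in> Xset" using x(2) oW[of B] by (auto simp: openin_Xtop)
    ultimately show "x \<in> ?L" using x by simp
  qed
  also have "\<dots> \<in> sets (borelX \<Otimes>\<^sub>M HaarH)"
  proof -
    have "W B \<times> (Hpar \<inter> (hv -` B \<inter> space HaarH)) \<in> sets (borelX \<Otimes>\<^sub>M HaarH)" if "B \<in> \<B>" for B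
    proof (rule pair_measureI)
      have "open B" using \<B>(2) that by (rule topological_basis_open)
      then show "Hpar \<inter> (hv -` B \<inter> space HaarH) \<in> sets HaarH"
        by (intro sets.Int Hpar_sets measurable_sets[OF measurable_hv]) auto
      show "W B \<in> sets borelX" by (rule openin_sets_borelX[OF oW])
    qed
    then show ?thesis by (intro sets.countable_UN' \<B>(1)) auto
  qed
  finally show ?thesis .
qed

context cocompact_stab
begin

text \<open>Preimages of Borel sets in the parameter space are stabiliser-invariant, so invariance
  under H is an instance of \<open>fund_dom_translate\<close>.\<close>

lemma inv_prob_orbprob:
  assumes F: "fund_dom g F"
  shows "inv_prob_on_orbit (orbprob g F) g"
proof -
  have FH: "F \<in> sets HaarH" "F \<subseteq> Hpar" using F by (auto simp: fund_dom_def)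
  have pos: "emeasure HaarH F \<noteq> 0"
    using fund_dom_measure_ge[OF F g] emeasure_sepbox[where 'n='n] by auto
  have fin: "emeasure HaarH F \<noteq> \<infinity>"
    using fund_dom_measure_finite[OF F] by simp
  have sets: "sets (orbprob g F) = sets borelX" by (simp add: orbprob_def)
  have sp: "space (orbprob g F) = Xset" by (simp add: orbprob_def space_borelX)
  show ?thesis
    unfolding inv_prob_on_orbit_def
  proof (intro conjI ballI sets)
    have "orbmap g \<in> measurable (uniform_measure HaarH F) borelX"
      using measurable_orbmap[OF g] by (simp add: measurable_cong_sets[OF sets_uniform_measure refl])
    then show "prob_space (orbprob g F)"
      unfolding orbprob_def by (intro prob_space.prob_space_distr prob_space_uniform_measure pos fin)
    have "F \<inter> {t \<in> Hpar. cls (g ** hat t) \<in> orbit g} = F" using FH(2) by (auto simp: orbit_eq)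
    then show "emeasure (orbprob g F) (orbit g) = 1"
      using orbit_sets pos fin by (simp add: emeasure_orbprob[OF g F] less_top)
    fix h :: "real^'n^'n" assume "h \<in> Hmat"
    then obtain c s where h: "c \<noteq> 0" "s \<in> Hpar" "h = c *\<^sub>R hat s" by (rule Hmat_scale_hat)
    have hi: "invertible h" using h by (simp add: invertible_scaleR invertible_hat)
    have mR: "Ract h \<in> measurable (orbprob g F) (orbprob g F)"
      using measurable_Ract[OF hi] by (simp add: measurable_cong_sets[OF sets sets])
    show "distr (orbprob g F) (orbprob g F) (Ract h) = orbprob g F"
    proof (rule measure_eqI)
      fix A assume "A \<in> sets (distr (orbprob g F) (orbprob g F) (Ract h))"
      then have A: "A \<in> sets borelX" by (simp add: sets)
      let ?S = "{t \<in> Hpar. cls (g ** hat t) \<in> A}"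
      have RA: "Ract h -` A \<inter> Xset \<in> sets borelX"
        using measurable_sets[OF measurable_Ract[OF hi] A] by (simp add: space_borelX)
      have "emeasure (distr (orbprob g F) (orbprob g F) (Ract h)) A = emeasure (orbprob g F) (Ract h -` A \<inter> Xset)"
        using mR A by (simp add: emeasure_distr sets sp)
      also have "\<dots> = emeasure HaarH (F \<inter> {t \<in> Hpar. cls (g ** hat t) \<in> Ract h -` A \<inter> Xset}) / emeasure HaarH F"
        by (rule emeasure_orbprob[OF g F RA])
      \<comment> \<open>Acting by h translates the parameter by s; the scalar c disappears in the
        class.\<close>
      also have "F \<inter> {t \<in> Hpar. cls (g ** hat t) \<in> Ract h -` A \<inter> Xset} = {t \<in> F. tmul t s \<in> ?S}"
      proof -
        have "Ract h (cls (g ** hat t)) = cls (g ** hat (tmul t s))" for t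
          using h by (simp add: Ract_cls cls_scaleR hat_tmul matrix_mul_assoc)
        then show ?thesis
          using FH(2) tmul_Hpar[OF _ h(2)] cls_Xset[OF invertible_mult_hat[OF g]] by auto
      qed
      also have "emeasure HaarH {t \<in> F. tmul t s \<in> ?S} = emeasure HaarH (F \<inter> ?S)"
        by (rule fund_dom_translate[OF F g h(2) orbmap_sets[OF g A]]) (rule stab_invariant_preimage)
      also have "\<dots> / emeasure HaarH F = emeasure (orbprob g F) A"
        by (rule emeasure_orbprob[OF g F A, symmetric])
      finally show "emeasure (distr (orbprob g F) (orbprob g F) (Ract h)) A = emeasure (orbprob g F) A" .
    qed simp
  qed
qed

text \<open>Integrate the indicator of p h in A over p and over h in F, in both orders. Invariance
  of \<mu> makes the integral over p equal to the measure of A for every h in F. For p on the orbit,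
  the integral over h is independent of p by \<open>fund_dom_translate\<close>.\<close>

lemma inv_prob_emeasure_open:
  assumes F: "fund_dom g F" and \<mu>: "inv_prob_on_orbit \<mu> g" and A: "openin Xtop A"
  shows "emeasure \<mu> A * emeasure HaarH F = emeasure HaarH (F \<inter> {t \<in> Hpar. cls (g ** hat t) \<in> A})"
proof -
  have FH: "F \<in> sets HaarH" "F \<subseteq> Hpar" using F by (auto simp: fund_dom_def)
  have sets: "sets \<mu> = sets borelX" and orb1: "emeasure \<mu> (orbit g) = 1"
    and inv: "\<And>h. h \<in> Hmat \<Longrightarrow> distr \<mu> \<mu> (Ract h) = \<mu>" and "prob_space \<mu>"
    using \<mu> by (auto simp: inv_prob_on_orbit_def)
  interpret prob_space \<mu> by fact
  interpret H: sigma_finite_measure "HaarH :: ('n \<Rightarrow> real) measure" by (rule sigma_finite_HaarH)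
  interpret P: pair_sigma_finite \<mu> "HaarH :: ('n \<Rightarrow> real) measure"
    by (intro pair_sigma_finite.intro) unfold_locales
  have sp: "space \<mu> = Xset" using sets_eq_imp_space_eq[OF sets] by (simp add: space_borelX)
  let ?S = "{t \<in> Hpar. cls (g ** hat t) \<in> A}"
  define f where "f x = (indicator {x \<in> Xset \<times> Hpar. Ract (hat (snd x)) (fst x) \<in> A} x * indicator F (snd x) :: ennreal)" for x
  have "sets (\<mu> \<Otimes>\<^sub>M (HaarH :: ('n \<Rightarrow> real) measure)) = sets (borelX \<Otimes>\<^sub>M HaarH)"
    by (intro sets_pair_measure_cong sets refl)
  then have [measurable]: "{x \<in> Xset \<times> Hpar. Ract (hat (snd x)) (fst x) \<in> A} \<in> sets (\<mu> \<Otimes>\<^sub>M HaarH)"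
    using action_rectangles[OF A] by simp
  note [measurable] = FH(1)
  have fm: "(\<lambda>(p, h). f (p, h)) \<in> borel_measurable (\<mu> \<Otimes>\<^sub>M HaarH)"
    unfolding f_def by measurable
  have AX: "A \<in> sets \<mu>" using openin_sets_borelX[OF A] by (simp add: sets)
  have 1: "(\<integral>\<^sup>+ p. f (p, h) \<partial>\<mu>) = emeasure \<mu> A * indicator F h" for h
  proof (cases "h \<in> F")
    case True
    then have h: "h \<in> Hpar" using FH by auto
    then have hm: "hat h \<in> Hmat" by (rule hat_Hmat)
    have mR: "Ract (hat h) \<in> measurable \<mu> \<mu>"
      using measurable_Ract[OF invertible_hat[OF h]] by (simp add: measurable_cong_sets[OF sets sets])
    have "(\<integral>\<^sup>+ p. f (p, h) \<partial>\<mu>) = (\<integral>\<^sup>+ p. indicator (Ract (hat h) -` A \<inter> space \<mu>) p \<partial>\<mu>)"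
      using True h by (intro nn_integral_cong) (auto simp: f_def indicator_def sp)
    also have "\<dots> = emeasure \<mu> (Ract (hat h) -` A \<inter> space \<mu>)"
      using measurable_sets[OF mR AX] by simp
    also have "\<dots> = emeasure (distr \<mu> \<mu> (Ract (hat h))) A"
      using mR AX by (simp add: emeasure_distr)
    finally show ?thesis using True by (simp add: inv[OF hm])
  qed (simp add: f_def)
  have 2: "AE p in \<mu>. (\<integral>\<^sup>+ h. f (p, h) \<partial>HaarH) = emeasure HaarH (F \<inter> ?S)"
  proof -
    have "orbit g \<in> sets \<mu>" using orb1 emeasure_notin_sets by fastforce
    then have "AE p in \<mu>. p \<in> orbit g"
      using orb1 by (simp add: AE_in_set_eq_1 emeasure_eq_measure)
    then show ?thesis
    proof eventually_elim
      fix p assume "p \<in> orbit g"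
      then obtain s where s: "s \<in> Hpar" "p = cls (g ** hat s)" by (auto simp: orbit_eq)
      have "{t \<in> F. tmul t s \<in> ?S} = F \<inter> ((\<lambda>t. tmul t s) -` ?S \<inter> space HaarH)"
        using sets.sets_into_space[OF FH(1)] by auto
      then have m: "{t \<in> F. tmul t s \<in> ?S} \<in> sets HaarH"
        using FH(1) measurable_sets[OF measurable_tmul orbmap_sets[OF g openin_sets_borelX[OF A]]] by simp
      have "(\<integral>\<^sup>+ h. f (p, h) \<partial>HaarH) = (\<integral>\<^sup>+ h. indicator {t \<in> F. tmul t s \<in> ?S} h \<partial>HaarH)"
      proof (rule nn_integral_cong)
        fix h :: "'n \<Rightarrow> real"
        have "Ract (hat h) p = cls (g ** hat (tmul h s))"
          by (simp add: s Ract_cls hat_tmul tmul_commute[of h s] matrix_mul_assoc)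
        moreover have "p \<in> Xset" using s cls_Xset[OF invertible_mult_hat[OF g]] by simp
        ultimately show "f (p, h) = indicator {t \<in> F. tmul t s \<in> ?S} h"
          using FH(2) tmul_Hpar[OF _ s(1)] by (auto simp: f_def indicator_def)
      qed
      also have "\<dots> = emeasure HaarH {t \<in> F. tmul t s \<in> ?S}" using m by simp
      also have "\<dots> = emeasure HaarH (F \<inter> ?S)"
        by (rule fund_dom_translate[OF F g s(1) orbmap_sets[OF g openin_sets_borelX[OF A]]])
           (rule stab_invariant_preimage)
      finally show "(\<integral>\<^sup>+ h. f (p, h) \<partial>HaarH) = emeasure HaarH (F \<inter> ?S)" .
    qed
  qed
  have "emeasure \<mu> A * emeasure HaarH F = (\<integral>\<^sup>+ h. emeasure \<mu> A * indicator F h \<partial>HaarH)"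
    using FH(1) by (simp add: nn_integral_cmult_indicator)
  also have "\<dots> = (\<integral>\<^sup>+ h. (\<integral>\<^sup>+ p. f (p, h) \<partial>\<mu>) \<partial>HaarH)" by (simp add: 1)
  also have "\<dots> = (\<integral>\<^sup>+ p. (\<integral>\<^sup>+ h. f (p, h) \<partial>HaarH) \<partial>\<mu>)"
    using fm by (rule P.Fubini')
  also have "\<dots> = (\<integral>\<^sup>+ p. emeasure HaarH (F \<inter> ?S) \<partial>\<mu>)"
    using 2 by (rule nn_integral_cong_AE)
  also have "\<dots> = emeasure HaarH (F \<inter> ?S)"
    by (simp add: emeasure_space_1)
  finally show ?thesis .
qed

text \<open>The open sets are stable under intersection and generate the Borel sets; the finite
  positive measure of a fundamental domain cancels.\<close>

lemma inv_prob_unique: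
  assumes \<mu>: "inv_prob_on_orbit \<mu> g" and \<nu>: "inv_prob_on_orbit \<nu> g"
  shows "\<mu> = \<nu>"
proof (rule measure_eqI_generator_eq)
  obtain F where F: "fund_dom g F" using fund_dom_exists[OF g] by blast
  have fin: "emeasure HaarH F \<noteq> \<infinity>" using fund_dom_measure_finite[OF F] by simp
  have pos: "emeasure HaarH F \<noteq> 0"
    using fund_dom_measure_ge[OF F g] emeasure_sepbox[where 'n='n] by auto
  let ?E = "{U :: (real^'n^'n) set set. openin Xtop U}"
  show "Int_stable ?E" by (auto simp: Int_stable_def)
  show "?E \<subseteq> Pow Xset" by (auto simp: openin_Xtop)
  show "sets \<mu> = sigma_sets Xset ?E" "sets \<nu> = sigma_sets Xset ?E"
    using \<mu> \<nu> by (auto simp: inv_prob_on_orbit_def sets_borelX)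
  fix U assume "U \<in> ?E"
  then have "emeasure \<mu> U * emeasure HaarH F = emeasure \<nu> U * emeasure HaarH F"
    using inv_prob_emeasure_open[OF F \<mu>] inv_prob_emeasure_open[OF F \<nu>] by simp
  then show "emeasure \<mu> U = emeasure \<nu> U"
    using fin pos by (metis ennreal_mult_divide_eq infinity_ennreal_def)
next
  have "openin Xtop (Xset :: (real^'n^'n) set set)"
    using openin_topspace[of Xtop] by (simp add: topspace_Xtop)
  then show "range (\<lambda>_ :: nat. Xset) \<subseteq> {U :: (real^'n^'n) set set. openin Xtop U}" by auto
  show "emeasure \<mu> Xset \<noteq> \<infinity>"
    using \<mu> by (auto simp: inv_prob_on_orbit_def prob_space_def finite_measure.emeasure_finite)
qed auto

lemma inv_prob_orbmeas: "inv_prob_on_orbit (orbmeas g) g"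
proof -
  obtain F where F: "fund_dom g F" using fund_dom_exists[OF g] by blast
  show ?thesis
    unfolding orbmeas_def
  proof (rule theI)
    show "inv_prob_on_orbit (orbprob g F) g" by (rule inv_prob_orbprob[OF F])
    show "\<mu> = orbprob g F" if "inv_prob_on_orbit \<mu> g" for \<mu>
      using inv_prob_unique[OF that inv_prob_orbprob[OF F]] .
  qed
qed

text \<open>The box \<open>logbox T\<close> is covered by at most \<open>(2 * q + 1) ^ n\<close> translates of \<open>logbox (T / q)\<close>.\<close>

lemma inv_prob_box_mass:
  fixes q :: nat
  assumes q: "q > 0" and \<mu>: "inv_prob_on_orbit \<mu> g"
    and A: "A \<in> sets borelX" and sub: "\<And>t. t \<in> logbox (T / real q) \<Longrightarrow> cls (g ** hat t) \<in> A"
  shows "1 / real (2 * q + 1) ^ CARD('n) \<le> measure \<mu> A"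
proof -
  have sets: "sets \<mu> = sets borelX" and orb1: "emeasure \<mu> (orbit g) = 1"
    and inv: "\<And>h. h \<in> Hmat \<Longrightarrow> distr \<mu> \<mu> (Ract h) = \<mu>" and "prob_space \<mu>"
    using \<mu> by (auto simp: inv_prob_on_orbit_def)
  interpret prob_space \<mu> by fact
  have sp: "space \<mu> = Xset" using sets_eq_imp_space_eq[OF sets] by (simp add: space_borelX)
  \<comment> \<open>The grid has step T / q in logarithmic coordinates, and its labels are functions
    on all of \<open>'n\<close>, whence the exponent n. Positive translates suffice because
    \<open>logbox\<close> is closed under sign changes.\<close>
  define I where "I = PiE (UNIV :: 'n set) (\<lambda>_. {- int q..int q})"
  define s where "s m = (\<lambda>i\<in>- {i0 :: 'n}. exp (- real_of_int (m i) * (T / real q)))" for m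
  have sH: "s m \<in> Hpar" for m by (auto simp: s_def Hpar_def)
  define C where "C m = Ract (hat (s m)) -` A \<inter> Xset" for m
  have mR: "Ract (hat (s m)) \<in> measurable borelX borelX" for m
    by (rule measurable_Ract[OF invertible_hat[OF sH]])
  have Cs: "C m \<in> sets \<mu>" for m
    using measurable_sets[OF mR A] by (simp add: C_def sets space_borelX)
  have Cm: "measure \<mu> (C m) = measure \<mu> A" for m
  proof -
    have "Ract (hat (s m)) \<in> measurable \<mu> \<mu>"
      using mR by (simp add: measurable_cong_sets[OF sets sets])
    then have "measure (distr \<mu> \<mu> (Ract (hat (s m)))) A = measure \<mu> (C m)"
      using A by (simp add: measure_distr sets C_def sp)
    then show ?thesis using inv[OF hat_Hmat[OF sH]] by simp
  qed
  have finI: "finite I" unfolding I_def by (intro finite_PiE) auto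
  have cardI: "card I = (2 * q + 1) ^ CARD('n)"
    unfolding I_def by (simp add: card_PiE nat_add_distrib nat_mult_distrib)
  have "orbit g \<subseteq> (\<Union>m\<in>I. C m)"
  proof
    fix p assume "p \<in> orbit g"
    then obtain t where t: "t \<in> logbox T" "p = cls (g ** hat t)"
      using orbit_eq_logbox by auto
    have tH: "t \<in> Hpar" using t by (simp add: logbox_def)
    define m where "m i = (if i = i0 then 0 else \<lfloor>ln \<bar>t i\<bar> / (T / real q)\<rfloor>)" for i
    have k: "T / real q > 0" using T q by simp
    have "m i \<in> {- int q..int q}" for i
    proof (cases "i = i0")
      case False
      then have "\<bar>ln \<bar>t i\<bar>\<bar> \<le> T" using t by (auto simp: logbox_def)
      then have "\<bar>ln \<bar>t i\<bar> / (T / real q)\<bar> \<le> real q"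
        using T q by (simp add: field_simps abs_mult)
      then have "- real q \<le> ln \<bar>t i\<bar> / (T / real q)" "ln \<bar>t i\<bar> / (T / real q) \<le> real q"
        unfolding abs_le_iff by linarith+
      then show ?thesis using False
        by (auto simp: m_def le_floor_iff floor_le_iff)
    qed (simp add: m_def)
    then have mI: "m \<in> I" by (auto simp: I_def)
    have "tmul t (s m) \<in> logbox (T / real q)"
      unfolding logbox_def
    proof (intro CollectI conjI allI impI tmul_Hpar tH sH)
      fix i assume i: "i \<noteq> (i0 :: 'n)"
      have ti: "t i \<noteq> 0" using tH i by (auto simp: Hpar_def)
      let ?x = "ln \<bar>t i\<bar> / (T / real q)"
      have "ln \<bar>tmul t (s m) i\<bar> = ln \<bar>t i\<bar> - real_of_int (m i) * (T / real q)"
        using i ti by (simp add: tmul_def s_def abs_mult ln_mult)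
      also have "\<dots> = (?x - real_of_int \<lfloor>?x\<rfloor>) * (T / real q)"
      proof -
        have "?x * (T / real q) = ln \<bar>t i\<bar>" using T q by simp
        then show ?thesis using i by (simp only: m_def if_False left_diff_distrib)
      qed
      finally have eq: "ln \<bar>tmul t (s m) i\<bar> = (?x - real_of_int \<lfloor>?x\<rfloor>) * (T / real q)" .
      have "0 \<le> ?x - real_of_int \<lfloor>?x\<rfloor>" "?x - real_of_int \<lfloor>?x\<rfloor> \<le> 1" by linarith+
      then show "\<bar>ln \<bar>tmul t (s m) i\<bar>\<bar> \<le> T / real q"
        unfolding eq using k T mult_right_mono[of "?x - real_of_int \<lfloor>?x\<rfloor>" 1 "T / real q"] by (simp add: abs_mult)
    qed
    then have "cls (g ** hat (tmul t (s m))) \<in> A" by (rule sub)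
    then have "p \<in> C m"
      using cls_Xset[OF invertible_mult_hat[OF g tH]] by (simp add: C_def t Ract_cls hat_tmul matrix_mul_assoc)
    then show "p \<in> (\<Union>m\<in>I. C m)" using mI by blast
  qed
  then have "1 \<le> measure \<mu> (\<Union>m\<in>I. C m)"
    using orb1 finite_measure_mono[of "orbit g" "\<Union>m\<in>I. C m"] finI Cs
    by (simp add: emeasure_eq_measure sets.finite_UN)
  also have "\<dots> \<le> (\<Sum>m\<in>I. measure \<mu> (C m))"
    by (rule finite_measure_subadditive_finite[OF finI]) (use Cs in auto)
  also have "\<dots> = real (2 * q + 1) ^ CARD('n) * measure \<mu> A"
    by (simp add: Cm cardI)
  finally show ?thesis
    by (simp add: divide_le_eq mult.commute)
qed
end

subsection \<open>Orders generated by units\<close>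

text \<open>A fixed enumeration of the index type. It supplies both the exponents of the rows and
  the positions of the roots.\<close>

definition ix :: "nat \<Rightarrow> 'n::finite" where
  "ix = (SOME b. bij_betw b {..<CARD('n)} UNIV)"

definition xi :: "'n::finite \<Rightarrow> nat" where
  "xi = inv_into {..<CARD('n)} ix"

lemma bij_ix: "bij_betw (ix :: nat \<Rightarrow> 'n::finite) {..<CARD('n)} UNIV"
proof -
  have "\<exists>b. bij_betw b {..<CARD('n)} (UNIV :: 'n set)"
    using ex_bij_betw_nat_finite[of "UNIV :: 'n set"] by (simp add: atLeast0LessThan)
  then show ?thesis unfolding ix_def by (rule someI_ex)
qed

lemma bij_xi: "bij_betw (xi :: 'n::finite \<Rightarrow> nat) UNIV {..<CARD('n)}"
  unfolding xi_def by (rule bij_betw_inv_into[OF bij_ix])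

lemma xi_less: "xi (i :: 'n::finite) < CARD('n)"
  using bij_xi by (auto simp: bij_betw_def)

lemma inj_xi: "xi i = xi j \<longleftrightarrow> i = j"
  using bij_xi by (auto simp: bij_betw_def inj_on_def)

lemma xi_ix: "k < CARD('n) \<Longrightarrow> xi (ix k :: 'n::finite) = k"
  unfolding xi_def using bij_ix by (intro inv_into_f_f) (auto simp: bij_betw_def)

lemma sum_xi: "(\<Sum>k\<in>(UNIV :: 'n::finite set). f (xi k)) = (\<Sum>i<CARD('n). f i)"
  using sum.reindex_bij_betw[OF bij_xi] .

lemma prod_xi: "(\<Prod>k\<in>(UNIV :: 'n::finite set). f (xi k)) = (\<Prod>i<CARD('n). f i)"
  using prod.reindex_bij_betw[OF bij_xi] .

text \<open>For the roots \<open>x j\<close> of a monic integer polynomial of degree d this is the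
  order generated by a root, seen through evaluation at all the roots, so that multiplication is
  coordinatewise.\<close>

definition Zspan :: "('n \<Rightarrow> real) \<Rightarrow> nat \<Rightarrow> ('n \<Rightarrow> real) set" where
  "Zspan x d = {v. \<exists>e :: nat \<Rightarrow> int. \<forall>j. v j = (\<Sum>i<d. of_int (e i) * x j ^ i)}"

lemma Zspan_add: "u \<in> Zspan x d \<Longrightarrow> v \<in> Zspan x d \<Longrightarrow> (\<lambda>j. u j + v j) \<in> Zspan x d"
proof -
  assume "u \<in> Zspan x d" "v \<in> Zspan x d"
  then obtain e e' where "\<And>j. u j = (\<Sum>i<d. of_int (e i) * x j ^ i)" "\<And>j. v j = (\<Sum>i<d. of_int (e' i) * x j ^ i)"
    by (auto simp: Zspan_def)
  then have "\<forall>j. u j + v j = (\<Sum>i<d. of_int (e i + e' i) * x j ^ i)"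
    by (simp add: sum.distrib distrib_right)
  then show ?thesis unfolding Zspan_def by (intro CollectI exI[of _ "\<lambda>i. e i + e' i"])
qed

lemma Zspan_cmult: "u \<in> Zspan x d \<Longrightarrow> (\<lambda>j. of_int c * u j) \<in> Zspan x d"
proof -
  assume "u \<in> Zspan x d"
  then obtain e where "\<And>j. u j = (\<Sum>i<d. of_int (e i) * x j ^ i)"
    by (auto simp: Zspan_def)
  then have "\<forall>j. of_int c * u j = (\<Sum>i<d. of_int (c * e i) * x j ^ i)"
    by (simp add: sum_distrib_left mult.assoc)
  then show ?thesis unfolding Zspan_def by (intro CollectI exI[of _ "\<lambda>i. c * e i"])
qed

lemma Zspan_zero: "(\<lambda>j. 0) \<in> Zspan x d"
  unfolding Zspan_def by (intro CollectI exI[of _ "\<lambda>_. 0"]) simp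

lemma Zspan_sum: "finite I \<Longrightarrow> (\<And>i. i \<in> I \<Longrightarrow> f i \<in> Zspan x d) \<Longrightarrow> (\<lambda>j. \<Sum>i\<in>I. f i j) \<in> Zspan x d"
  by (induction I rule: finite_induct) (simp_all add: Zspan_zero Zspan_add)

lemma Zspan_power: "k < d \<Longrightarrow> (\<lambda>j. x j ^ k) \<in> Zspan x d"
  unfolding Zspan_def
  by (intro CollectI exI[of _ "\<lambda>i. if i = k then 1 else 0"]) (simp add: if_distrib[of of_int] if_distrib[of "\<lambda>y. y * _"] cong: if_cong)

lemma Zspan_mono: "u \<in> Zspan x d \<Longrightarrow> u \<in> Zspan x (Suc d)"
proof -
  assume "u \<in> Zspan x d"
  then obtain e where "\<And>j. u j = (\<Sum>i<d. of_int (e i) * x j ^ i)"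
    by (auto simp: Zspan_def)
  then have "\<forall>j. u j = (\<Sum>i<Suc d. of_int (if i < d then e i else 0) * x j ^ i)"
    by simp
  then show ?thesis unfolding Zspan_def by (intro CollectI exI[of _ "\<lambda>i. if i < d then e i else 0"])
qed

lemma Zspan_shift: "u \<in> Zspan x d \<Longrightarrow> (\<lambda>j. x j * u j) \<in> Zspan x (Suc d)"
proof -
  assume "u \<in> Zspan x d"
  then obtain e where "\<And>j. u j = (\<Sum>i<d. of_int (e i) * x j ^ i)"
    by (auto simp: Zspan_def)
  then have "\<forall>j. x j * u j = (\<Sum>i<Suc d. of_int (if i = 0 then 0 else e (i - 1)) * x j ^ i)"
    by (subst sum.lessThan_Suc_shift) (simp add: sum_distrib_left mult_ac)
  then show ?thesis unfolding Zspan_def by (intro CollectI exI[of _ "\<lambda>i. if i = 0 then 0 else e (i - 1)"])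
qed

text \<open>Expresses that the product is monic with integer coefficients, in the form that rewrites
  the top power.\<close>

lemma Zspan_monic:
  fixes c :: "nat \<Rightarrow> int"
  shows "(\<lambda>j. (\<Prod>k<d. x j - of_int (c k)) - x j ^ d) \<in> Zspan x d"
proof (induction d)
  case 0
  then show ?case using Zspan_zero by simp
next
  case (Suc d)
  let ?h = "\<lambda>j. (\<Prod>k<d. x j - of_int (c k)) - x j ^ d"
  have "(\<lambda>j. x j * ?h j + (of_int (- c d) * ?h j + of_int (- c d) * x j ^ d)) \<in> Zspan x (Suc d)"
    by (intro Zspan_add Zspan_shift Suc Zspan_cmult Zspan_mono[OF Suc] Zspan_power) simp
  also have "(\<lambda>j. x j * ?h j + (of_int (- c d) * ?h j + of_int (- c d) * x j ^ d)) =
      (\<lambda>j. (\<Prod>k<Suc d. x j - of_int (c k)) - x j ^ Suc d)"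
    by (simp add: algebra_simps)
  finally show ?case .
qed

text \<open>One equation has two uses: it is the monic relation that closes the span under
  multiplication, and it says that the linear factors are units. Distinctness of the roots enters
  through \<open>invertible G\<close>.\<close>

locale unit_order =
  fixes x :: "'n::finite \<Rightarrow> real" and c :: "nat \<Rightarrow> int"
  assumes root: "\<And>j. (\<Prod>k<CARD('n). x j - of_int (c k)) = 1"
begin

abbreviation "\<O> \<equiv> Zspan x CARD('n)"

lemma one_in: "(\<lambda>j. 1) \<in> \<O>"
  using Zspan_power[of 0 "CARD('n)" x] by simp

lemma top_power_in: "(\<lambda>j. x j ^ CARD('n)) \<in> \<O>"
proof -
  have "(\<lambda>j. 1 + of_int (- 1) * ((\<Prod>k<CARD('n). x j - of_int (c k)) - x j ^ CARD('n))) \<in> \<O>"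
    by (intro Zspan_add one_in Zspan_cmult Zspan_monic)
  then show ?thesis by (simp add: root)
qed

lemma x_mult_in: "u \<in> \<O> \<Longrightarrow> (\<lambda>j. x j * u j) \<in> \<O>"
proof -
  assume "u \<in> \<O>"
  then have "(\<lambda>j. x j * u j) \<in> Zspan x (Suc CARD('n))" by (rule Zspan_shift)
  then obtain e where "\<And>j. x j * u j = (\<Sum>i<Suc CARD('n). of_int (e i) * x j ^ i)"
    by (auto simp: Zspan_def)
  then have "(\<lambda>j. x j * u j) = (\<lambda>j. (\<Sum>i<CARD('n). of_int (e i) * x j ^ i) + of_int (e CARD('n)) * x j ^ CARD('n))"
    by simp
  also have "\<dots> \<in> \<O>"
    by (intro Zspan_add Zspan_cmult top_power_in Zspan_sum Zspan_power) auto
  finally show ?thesis .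
qed

lemma mult_in: "u \<in> \<O> \<Longrightarrow> v \<in> \<O> \<Longrightarrow> (\<lambda>j. u j * v j) \<in> \<O>"
proof -
  assume u: "u \<in> \<O>" and v: "v \<in> \<O>"
  have pw: "(\<lambda>j. x j ^ i * v j) \<in> \<O>" for i
    by (induction i) (use v x_mult_in in \<open>auto simp: mult.assoc\<close>)
  obtain e where "\<And>j. u j = (\<Sum>i<CARD('n). of_int (e i) * x j ^ i)"
    using u by (auto simp: Zspan_def)
  then have "(\<lambda>j. u j * v j) = (\<lambda>j. \<Sum>i<CARD('n). of_int (e i) * (x j ^ i * v j))"
    by (simp add: sum_distrib_right mult.assoc)
  also have "\<dots> \<in> \<O>"
    by (intro Zspan_sum Zspan_cmult pw) auto
  finally show ?thesis .
qed

lemma prod_in: "finite I \<Longrightarrow> (\<And>i. i \<in> I \<Longrightarrow> f i \<in> \<O>) \<Longrightarrow> (\<lambda>j. \<Prod>i\<in>I. f i j) \<in> \<O>"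
  by (induction I rule: finite_induct) (simp_all add: one_in mult_in)

lemma linear_in: "(\<lambda>j. x j - of_int b) \<in> \<O>"
proof -
  have "(\<lambda>j. x j * 1 + of_int (- b) * 1) \<in> \<O>"
    by (intro Zspan_add x_mult_in one_in Zspan_cmult)
  then show ?thesis by simp
qed

definition G :: "real^'n^'n" where
  "G = (\<chi> k j. x j ^ xi k)"

lemma in_iff_row: "v \<in> \<O> \<longleftrightarrow> (\<exists>m :: 'n \<Rightarrow> int. \<forall>j. v j = (\<Sum>k\<in>UNIV. of_int (m k) * G $ k $ j))"
proof
  assume "v \<in> \<O>"
  then obtain e where e: "\<And>j. v j = (\<Sum>i<CARD('n). of_int (e i) * x j ^ i)"
    by (auto simp: Zspan_def)
  have "v j = (\<Sum>k\<in>UNIV. of_int (e (xi k)) * G $ k $ j)" for j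
    unfolding e G_def by (simp add: sum_xi[of "\<lambda>i. of_int (e i) * x j ^ i", where 'n='n])
  then show "\<exists>m :: 'n \<Rightarrow> int. \<forall>j. v j = (\<Sum>k\<in>UNIV. of_int (m k) * G $ k $ j)"
    by (intro exI[of _ "\<lambda>k. e (xi k)"]) simp
next
  assume "\<exists>m :: 'n \<Rightarrow> int. \<forall>j. v j = (\<Sum>k\<in>UNIV. of_int (m k) * G $ k $ j)"
  then obtain m :: "'n \<Rightarrow> int" where "\<And>j. v j = (\<Sum>k\<in>UNIV. of_int (m k) * G $ k $ j)" by blast
  then have "v = (\<lambda>j. \<Sum>k\<in>UNIV. of_int (m k) * x j ^ xi k)" by (simp add: G_def fun_eq_iff)
  also have "\<dots> \<in> \<O>" by (intro Zspan_sum Zspan_cmult Zspan_power xi_less) auto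
  finally show "v \<in> \<O>" .
qed

lemma mult_matrix:
  assumes "u \<in> \<O>"
  obtains M :: "real^'n^'n" where "\<And>i j. M $ i $ j \<in> \<int>" "G ** diagm (\<chi> j. u j) = M ** G"
proof -
  have "\<exists>m :: 'n \<Rightarrow> int. \<forall>j. u j * G $ k $ j = (\<Sum>l\<in>UNIV. of_int (m l) * G $ l $ j)" for k
  proof -
    have "(\<lambda>j. u j * G $ k $ j) \<in> \<O>"
      unfolding G_def vec_lambda_beta by (intro mult_in assms Zspan_power xi_less)
    then show ?thesis by (simp add: in_iff_row)
  qed
  then obtain m :: "'n \<Rightarrow> 'n \<Rightarrow> int" where m: "\<And>k j. u j * G $ k $ j = (\<Sum>l\<in>UNIV. of_int (m k l) * G $ l $ j)"
    by metis
  have "G ** diagm (\<chi> j. u j) = (\<chi> k l. of_int (m k l)) ** G"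
    by (simp add: vec_eq_iff matrix_mult_diagm) (simp add: matrix_matrix_mult_def m mult.commute flip: m)
  then show ?thesis by (rule that[rotated]) simp
qed

text \<open>Multiplication by u and by its inverse have integer matrices in the row basis of
  \<open>G\<close>. These matrices are inverse to each other, so the first lies in
  \<open>GLZ\<close>.\<close>

lemma cls_unit:
  assumes "u \<in> \<O>" "u' \<in> \<O>" "\<And>j. u j * u' j = 1" and G: "invertible G"
  shows "cls (G ** diagm (\<chi> j. u j)) = cls G"
proof -
  obtain M :: "real^'n^'n" where M: "\<And>i j. M $ i $ j \<in> \<int>" "G ** diagm (\<chi> j. u j) = M ** G"
    using mult_matrix[OF assms(1)] by metis
  obtain M' :: "real^'n^'n" where M': "\<And>i j. M' $ i $ j \<in> \<int>" "G ** diagm (\<chi> j. u' j) = M' ** G"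
    using mult_matrix[OF assms(2)] by metis
  obtain G' where G': "G ** G' = mat 1" using G by (auto simp: invertible_def)
  have "M ** M' ** G = M ** (G ** diagm (\<chi> j. u' j))" by (simp add: M' matrix_mul_assoc)
  also have "\<dots> = G ** (diagm (\<chi> j. u j) ** diagm (\<chi> j. u' j))" by (simp add: M(2)[symmetric] matrix_mul_assoc)
  also have "\<dots> = G" by (simp add: diagm_mult assms(3) diagm_1)
  finally have "M ** M' ** G ** G' = G ** G'" by simp
  then have "M ** M' = mat 1" by (simp add: G' flip: matrix_mul_assoc)
  then have "M \<in> GLZ" using M(1) M'(1) by (intro GLZ_I[of M M'])
  then show ?thesis by (simp add: M(2) cls_GLZ)
qed

definition unit :: "'n \<Rightarrow> 'n \<Rightarrow> real" where
  "unit k j = x j - of_int (c (xi k))"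

lemma prod_unit: "(\<Prod>k\<in>UNIV. unit k j) = 1"
  unfolding unit_def prod_xi[of "\<lambda>i. x j - of_int (c i)", where 'n='n] by (rule root)

lemma unit_nonzero: "unit k j \<noteq> 0"
  using prod_unit[of j] by (metis finite_UNIV UNIV_I prod_zero_iff zero_neq_one finite_code)

lemma cls_unit_k: "invertible G \<Longrightarrow> cls (G ** diagm (\<chi> j. unit k j)) = cls G"
proof (rule cls_unit)
  show "unit k \<in> \<O>" unfolding unit_def[abs_def] by (rule linear_in)
  \<comment> \<open>The inverse of one factor is the product of the others, because all of them
    multiply to 1.\<close>
  show "(\<lambda>j. \<Prod>l\<in>UNIV - {k}. unit l j) \<in> \<O>"
    by (rule prod_in) (auto simp: unit_def[abs_def] linear_in)
  show "unit k j * (\<Prod>l\<in>UNIV - {k}. unit l j) = 1" for j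
    using prod_unit[of j] by (simp add: prod.remove[of UNIV k])
qed

definition unit_stab :: "'n \<Rightarrow> 'n \<Rightarrow> real" where
  "unit_stab k = (\<lambda>j\<in>- {i0}. unit k j / unit k i0)"

lemma unit_stab_in: "invertible G \<Longrightarrow> unit_stab k \<in> stab G"
proof -
  assume G: "invertible G"
  have "hat (unit_stab k) = (1 / unit k i0) *\<^sub>R diagm (\<chi> j. unit k j)"
    using unit_nonzero by (simp add: vec_eq_iff hat_eq hv_def unit_stab_def diagm_def)
  then have "cls (G ** hat (unit_stab k)) = cls G"
    using unit_nonzero cls_unit_k[OF G, of k] by (simp add: cls_scaleR)
  moreover have "unit_stab k \<in> Hpar"
    using unit_nonzero by (simp add: unit_stab_def Hpar_def)
  ultimately show ?thesis by (simp add: stab_def)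
qed

lemma det_G: "det G = (\<Prod>j<CARD('n). \<Prod>l<j. x (ix j) - x (ix l))"
proof -
  have "det G = detn CARD('n) (\<lambda>i j. G $ ix i $ ix j)"
    by (rule det_eq_detn[OF bij_ix])
  also have "\<dots> = detn CARD('n) (\<lambda>i j. x (ix j) ^ i)"
    by (rule detn_cong) (simp add: G_def xi_ix)
  also have "\<dots> = (\<Prod>j<CARD('n). \<Prod>l<j. x (ix j) - x (ix l))"
    by (rule detn_vandermonde)
  finally show ?thesis .
qed

end

text \<open>Multiplying by the unit \<open>\<tau> j\<close>, which is close to \<open>exp (- T)\<close> in coordinate \<open>j\<close> and to 1 elsewhere,
  or by its inverse, lowers \<open>\<Sum>i. \<bar>ln \<bar>t i\<bar>\<bar>\<close> by at least \<open>T / 2\<close> when \<open>\<bar>ln \<bar>t j\<bar>\<bar> > T\<close>.\<close>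

lemma stab_covering:
  fixes g :: "real^'n^'n"
  assumes \<tau>: "\<And>j. j \<noteq> i0 \<Longrightarrow> \<tau> j \<in> stab g"
    and diag: "\<And>j. j \<noteq> i0 \<Longrightarrow> \<bar>ln \<bar>\<tau> j j\<bar> + T\<bar> \<le> e"
    and off: "\<And>i j. j \<noteq> i0 \<Longrightarrow> i \<noteq> i0 \<Longrightarrow> i \<noteq> j \<Longrightarrow> \<bar>ln \<bar>\<tau> j i\<bar>\<bar> \<le> e"
    and e: "e \<ge> 0" and T: "T > 0" "T \<ge> 2 * real CARD('n) * e"
    and t: "t \<in> Hpar"
  shows "\<exists>a\<in>stab g. tmul t a \<in> logbox T"
proof -
  define S where "S t = (\<Sum>i\<in>- {i0}. \<bar>ln \<bar>t i\<bar>\<bar>)" for t :: "'n \<Rightarrow> real"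
  have stabH: "a \<in> stab g \<Longrightarrow> a \<in> Hpar" for a using stab_Hpar by blast
  have nz: "t i \<noteq> 0" if "t \<in> Hpar" "i \<noteq> i0" for t :: "'n \<Rightarrow> real" and i
    using that by (auto simp: Hpar_def)
  \<comment> \<open>Descent: m counts the remaining steps of size T / 2.\<close>
  have "\<forall>t\<in>Hpar. S t \<le> real m * (T / 2) \<longrightarrow> (\<exists>a\<in>stab g. tmul t a \<in> logbox T)" for m
  proof (induction m)
    case 0
    show ?case
    proof (intro ballI impI bexI[OF _ tone_stab])
      fix t :: "'n \<Rightarrow> real" assume t: "t \<in> Hpar" "S t \<le> real 0 * (T / 2)"
      have "\<bar>ln \<bar>t i\<bar>\<bar> \<le> S t" if "i \<noteq> i0" for i
        unfolding S_def using that by (intro member_le_sum) auto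
      then have "t \<in> logbox T" using t T by (force simp: logbox_def)
      then show "tmul t tone \<in> logbox T" using t by (simp add: tmul_tone Hpar_extensional)
    qed
  next
    case (Suc m)
    show ?case
    proof (intro ballI impI)
      fix t :: "'n \<Rightarrow> real" assume t: "t \<in> Hpar" and St: "S t \<le> real (Suc m) * (T / 2)"
      show "\<exists>a\<in>stab g. tmul t a \<in> logbox T"
      proof (cases "t \<in> logbox T")
        case True
        then show ?thesis using t tone_stab[of g] by (intro bexI[of _ tone]) (auto simp: tmul_tone Hpar_extensional)
      next
        case False
        then obtain j where j: "j \<noteq> i0" "\<bar>ln \<bar>t j\<bar>\<bar> > T" using t by (auto simp: logbox_def not_le)
        define a where "a = (if ln \<bar>t j\<bar> > 0 then \<tau> j else tinv (\<tau> j))"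
        define \<sigma> where "\<sigma> = (if ln \<bar>t j\<bar> > 0 then 1 else - 1 :: real)"
        have a: "a \<in> stab g" using \<tau>[OF j(1)] by (simp add: a_def stab_tinv)
        have aH: "a \<in> Hpar" using a stabH by blast
        have la: "ln \<bar>a i\<bar> = \<sigma> * ln \<bar>\<tau> j i\<bar>" if "i \<noteq> i0" for i
          using that nz[OF stabH[OF \<tau>[OF j(1)]] that] by (simp add: a_def \<sigma>_def tinv_def ln_div)
        have ln_mult_t: "ln \<bar>tmul t a i\<bar> = ln \<bar>t i\<bar> + \<sigma> * ln \<bar>\<tau> j i\<bar>" if "i \<noteq> i0" for i
          using that nz[OF t that] nz[OF aH that] by (simp add: tmul_def abs_mult ln_mult la)
        have Te: "T \<ge> e"
        proof -
          have "1 \<le> 2 * real CARD('n)" using zero_less_card_finite[where 'a='n] by linarith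
          then have "1 * e \<le> 2 * real CARD('n) * e" by (rule mult_right_mono[OF _ e])
          then show ?thesis using T(2) by simp
        qed
        \<comment> \<open>Since the absolute value of l exceeds T, moving it by T up to an error e
          towards 0 overshoots by less than e.\<close>
        have aux1: "\<bar>l + (if l > 0 then 1 else - 1) * u\<bar> \<le> \<bar>l\<bar> - T + e"
          if "\<bar>l\<bar> > T" "\<bar>u + T\<bar> \<le> e" for l u :: real
          using that Te T(1) by (auto simp: abs_if split: if_splits)
        have aux2: "\<bar>l + (if P then 1 else - 1) * u\<bar> \<le> \<bar>l\<bar> + e" if "\<bar>u\<bar> \<le> e" for l u :: real and P
          using that by (auto simp: abs_if split: if_splits)
        have main: "\<bar>ln \<bar>tmul t a j\<bar>\<bar> \<le> \<bar>ln \<bar>t j\<bar>\<bar> - T + e"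
          unfolding ln_mult_t[OF j(1)] \<sigma>_def by (rule aux1[OF j(2) diag[OF j(1)]])
        have rest: "\<bar>ln \<bar>tmul t a i\<bar>\<bar> \<le> \<bar>ln \<bar>t i\<bar>\<bar> + e" if "i \<noteq> i0" "i \<noteq> j" for i
          unfolding ln_mult_t[OF that(1)] \<sigma>_def by (rule aux2[OF off[OF j(1) that]])
        have "S (tmul t a) = \<bar>ln \<bar>tmul t a j\<bar>\<bar> + (\<Sum>i\<in>- {i0} - {j}. \<bar>ln \<bar>tmul t a i\<bar>\<bar>)"
          unfolding S_def using j by (simp add: sum.remove)
        also have "\<dots> \<le> (\<bar>ln \<bar>t j\<bar>\<bar> - T + e) + (\<Sum>i\<in>- {i0} - {j}. \<bar>ln \<bar>t i\<bar>\<bar> + e)"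
          by (intro add_mono main sum_mono rest) auto
        also have "\<dots> = S t - T + e + real (card (- {i0} - {j})) * e"
          unfolding S_def using j by (simp add: sum.remove[of "- {i0}" j] sum.distrib)
        also have "real (card (- {i0} - {j})) \<le> real CARD('n) - 1"
        proof -
          have "card (- {i0} - {j}) \<le> card (UNIV - {j})" by (rule card_mono) auto
          also have "\<dots> = CARD('n) - 1" by (simp add: card_Diff_singleton)
          finally show ?thesis using zero_less_card_finite[where 'a='n] by linarith
        qed
        then have "S t - T + e + real (card (- {i0} - {j})) * e \<le> S t - T + e + (real CARD('n) - 1) * e"
          using e by (intro add_left_mono mult_right_mono) auto
        also have "\<dots> = S t - T + real CARD('n) * e" by (simp add: algebra_simps)
        \<comment> \<open>The hypothesis on T bounds the total error n e by T / 2, so half of the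
          gain T survives.\<close>
        also have "\<dots> \<le> real m * (T / 2)" using St T(2) by (simp add: algebra_simps)
        finally have "S (tmul t a) \<le> real m * (T / 2)" by simp
        then obtain b where "b \<in> stab g" "tmul (tmul t a) b \<in> logbox T"
          using Suc.IH tmul_Hpar[OF t aH] by blast
        then show ?thesis using stab_tmul[OF a] by (auto simp: tmul_assoc)
      qed
    qed
  qed
  moreover obtain m :: nat where "S t / (T / 2) \<le> real m" using real_arch_simple by blast
  then have "S t \<le> real m * (T / 2)" using T by (simp add: divide_le_eq)
  ultimately show ?thesis using t by blast
qed

subsection \<open>The discriminant\<close>

text \<open>Under left multiplication the matrix algebra is a sum of n copies of the standard
  module.\<close>

lemma trLM_eq: "trLM A = real CARD('n) * trace A" for A :: "real^'n^'n"
proof -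
  have "(A ** Emat i j) $ i $ j = A $ i $ i" for i j
    by (simp add: matrix_matrix_mult_def Emat_def if_distrib[of "(*) _"] cong: if_cong)
  then show ?thesis
    by (simp add: trLM_def trace_def sum_distrib_left)
qed

lemma Bform_eq:
  "Bform A C = real CARD('n) ^ 2 * (real CARD('n) * trace (A ** C) - trace A * trace C)"
  for A C :: "real^'n^'n"
  by (simp add: Bform_def trLM_eq trace_def mat_def power2_eq_square algebra_simps)

lemma trace_scaleR: "trace (c *\<^sub>R A) = c * trace A" for A :: "real^'n^'n"
  by (simp add: trace_def sum_distrib_left)

lemma Bform_add_left: "Bform (A + B) C = Bform A C + Bform B C"
  unfolding Bform_eq matrix_add_rdistrib trace_add by (simp only: ring_distribs)

lemma Bform_commute: "Bform A C = Bform C A"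
  unfolding Bform_eq trace_mul_sym[of A C] by (simp only: mult.commute)

lemma Bform_scaleR_left: "Bform (c *\<^sub>R A) C = c * Bform A C"
  by (simp add: Bform_eq trace_scaleR right_diff_distrib mult_ac)

lemma Bform_zero_left: "Bform 0 C = 0"
  using Bform_scaleR_left[of 0 0 C] by simp

lemma Bform_sum_left: "Bform (\<Sum>i\<in>I. f i) C = (\<Sum>i\<in>I. Bform (f i) C)"
  by (induction I rule: infinite_finite_induct) (simp_all add: Bform_zero_left Bform_add_left)

text \<open>Scalars lie in the radical, so the form descends to the quotient by them and any
  representatives may be used.\<close>

lemma Bform_mat_1_left: "Bform (mat 1) C = 0"
  by (simp add: Bform_eq trace_I)

lemma Bform_span_left:
  "Bform (c *\<^sub>R mat 1 + (\<Sum>k\<in>I. a k *\<^sub>R E k)) C = (\<Sum>k\<in>I. a k * Bform (E k) C)"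
  by (simp add: Bform_add_left Bform_scaleR_left Bform_sum_left Bform_mat_1_left)

lemma Bform_span_right:
  "Bform C (c *\<^sub>R mat 1 + (\<Sum>k\<in>I. a k *\<^sub>R E k)) = (\<Sum>k\<in>I. a k * Bform C (E k))"
  unfolding Bform_commute[of C] by (rule Bform_span_left)

lemma trace_conj:
  fixes A P Q :: "real^'n^'n"
  assumes "P ** Q = mat 1"
  shows "trace (Q ** A ** P) = trace A"
  using assms trace_mul_sym[of "Q ** A" P] by (simp add: matrix_mul_assoc)

lemma matrix_conj_mult:
  fixes A C P Q :: "real^'n^'n"
  assumes "P ** Q = mat 1"
  shows "(Q ** A ** P) ** (Q ** C ** P) = Q ** (A ** C) ** P"
proof -
  have "Q ** A ** P ** (Q ** C ** P) = Q ** A ** (P ** Q) ** C ** P"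
    by (simp add: matrix_mul_assoc)
  also have "\<dots> = Q ** (A ** C) ** P" by (simp add: assms matrix_mul_assoc)
  finally show ?thesis .
qed

lemma Bform_conj:
  fixes A C P Q :: "real^'n^'n"
  assumes "P ** Q = mat 1"
  shows "Bform (Q ** A ** P) (Q ** C ** P) = Bform A C"
  by (simp add: Bform_eq matrix_conj_mult[OF assms] trace_conj[OF assms])

lemma matrix_inv_inverse:
  fixes g :: "real^'n^'n"
  assumes "invertible g"
  shows "g ** matrix_inv g = mat 1" "matrix_inv g ** g = mat 1"
  using someI_ex[of "\<lambda>B. g ** B = mat 1 \<and> B ** g = mat 1"] assms
  unfolding invertible_def matrix_inv_def by blast+

lemma Lint_iff:
  fixes g :: "real^'n^'n"
  assumes g: "invertible g"
  shows "M \<in> Lint g \<longleftrightarrow> (\<forall>i j. M $ i $ j \<in> \<int>) \<and> (\<exists>t. M ** g = g ** diagm t)"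
proof -
  have "M = g ** diagm t ** matrix_inv g \<longleftrightarrow> M ** g = g ** diagm t" for t
    using matrix_inv_inverse[OF g] by (metis matrix_mul_assoc matrix_mul_rid)
  then show ?thesis by (simp add: Lint_def)
qed

abbreviation gram :: "(nat \<Rightarrow> real^'n^'n) \<Rightarrow> real" where
  "gram E \<equiv> detn (CARD('n) - 1) (\<lambda>k l. Bform (E k) (E l))"

text \<open>Conjugation by \<gamma> carries the lattice of x into that of y and preserves the form;
  the scalar and the factor h commute with diagonal matrices and drop out. The transition matrix is
  integral, and its determinant enters squared.\<close>

lemma gram_change:
  fixes x y :: "real^'n^'n"
  assumes x: "invertible x" and y: "invertible y" and xy: "x = c *\<^sub>R (\<gamma> ** (y ** h))"
    and \<gamma>: "\<gamma> \<in> GLZ" and c: "c \<noteq> 0" and h: "h \<in> Hmat"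
    and E: "Zbasis x E" and E': "Zbasis y E'"
  shows "\<exists>d\<in>\<int>. gram E = d\<^sup>2 * gram E'"
proof -
  let ?m = "CARD('n) - 1"
  obtain \<delta> where \<delta>: "\<delta> \<in> GLZ" "\<gamma> ** \<delta> = mat 1" "\<delta> ** \<gamma> = mat 1" using GLZ_inverse[OF \<gamma>] by metis
  obtain s where s: "h = diagm s" "\<And>i. s $ i \<noteq> 0" using h by (auto simp: Hmat_def)
  define h' where "h' = diagm (\<chi> i. 1 / s $ i)"
  have hh': "h ** h' = mat 1" using s by (simp add: h'_def diagm_mult diagm_1)
  have tr: "\<delta> ** E k ** \<gamma> \<in> Lint y" if "k < ?m" for k
  proof -
    have "E k \<in> Lint x" using E that by (simp add: Zbasis_def)
    then obtain t where t: "\<And>i j. E k $ i $ j \<in> \<int>" "E k ** x = x ** diagm t"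
      by (auto simp: Lint_iff[OF x])
    have "(\<delta> ** E k ** \<gamma>) ** y ** h = (1 / c) *\<^sub>R (\<delta> ** (E k ** x))"
      using c by (simp add: xy matrix_mul_assoc)
    also have "\<dots> = (\<delta> ** \<gamma>) ** y ** (h ** diagm t)"
      using c unfolding t(2) by (simp add: xy matrix_mul_assoc)
    also have "h ** diagm t = diagm t ** h"
      by (simp add: s(1) diagm_mult mult.commute)
    finally have "(\<delta> ** E k ** \<gamma>) ** y ** h = y ** diagm t ** h"
      by (simp add: \<delta> matrix_mul_assoc)
    then have "(\<delta> ** E k ** \<gamma>) ** y ** (h ** h') = y ** diagm t ** (h ** h')"
      by (simp add: matrix_mul_assoc)
    then have "(\<delta> ** E k ** \<gamma>) ** y = y ** diagm t" by (simp add: hh')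
    moreover have "(\<delta> ** E k ** \<gamma>) $ i $ j \<in> \<int>" for i j
      using t(1) \<delta>(1) \<gamma> by (intro matrix_mult_Ints) (auto simp: GLZ_def)
    ultimately show ?thesis by (auto simp: Lint_iff[OF y])
  qed
  have "\<exists>p. k < ?m \<longrightarrow> (\<forall>i. snd p i \<in> \<int>) \<and>
      \<delta> ** E k ** \<gamma> = fst p *\<^sub>R mat 1 + (\<Sum>i<?m. snd p i *\<^sub>R E' i)" for k
  proof (cases "k < ?m")
    case True
    then obtain c a where "\<forall>i. a i \<in> \<int>" "\<delta> ** E k ** \<gamma> = c *\<^sub>R mat 1 + (\<Sum>i<?m. a i *\<^sub>R E' i)"
      using tr E' unfolding Zbasis_def by blast
    then show ?thesis by (intro exI[of _ "(c, a)"]) simp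
  qed simp
  then obtain p :: "nat \<Rightarrow> real \<times> (nat \<Rightarrow> real)" where p: "\<And>k. k < ?m \<longrightarrow> (\<forall>i. snd (p k) i \<in> \<int>) \<and>
      \<delta> ** E k ** \<gamma> = fst (p k) *\<^sub>R mat 1 + (\<Sum>i<?m. snd (p k) i *\<^sub>R E' i)"
    using choice[of "\<lambda>k p. k < ?m \<longrightarrow> (\<forall>i. snd p i \<in> \<int>) \<and>
      \<delta> ** E k ** \<gamma> = fst p *\<^sub>R mat 1 + (\<Sum>i<?m. snd p i *\<^sub>R E' i)"] by blast
  define a where "a k = snd (p k)" for k
  define b where "b k = fst (p k)" for k
  have a: "\<And>k i. k < ?m \<Longrightarrow> a k i \<in> \<int>"
    "\<And>k. k < ?m \<Longrightarrow> \<delta> ** E k ** \<gamma> = b k *\<^sub>R mat 1 + (\<Sum>i<?m. a k i *\<^sub>R E' i)"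
    using p unfolding a_def b_def by blast+
  have "gram E = detn ?m (\<lambda>k l. \<Sum>i<?m. a k i * (\<Sum>j<?m. Bform (E' i) (E' j) * a l j))"
  proof (rule detn_cong)
    fix k l assume kl: "k < ?m" "l < ?m"
    have "Bform (E k) (E l) = Bform (\<delta> ** E k ** \<gamma>) (\<delta> ** E l ** \<gamma>)"
      by (rule Bform_conj[OF \<delta>(2), symmetric])
    also have "\<dots> = (\<Sum>i<?m. a k i * Bform (E' i) (\<delta> ** E l ** \<gamma>))"
      by (subst a(2)[OF kl(1)]) (rule Bform_span_left)
    also have "\<dots> = (\<Sum>i<?m. a k i * (\<Sum>j<?m. a l j * Bform (E' i) (E' j)))"
      by (subst a(2)[OF kl(2)]) (simp only: Bform_span_right)
    finally show "Bform (E k) (E l) = (\<Sum>i<?m. a k i * (\<Sum>j<?m. Bform (E' i) (E' j) * a l j))"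
      by (simp add: mult.commute)
  qed
  also have "\<dots> = detn ?m a * (gram E' * detn ?m (\<lambda>j l. a l j))"
    by (subst detn_mult, subst detn_mult) simp
  also have "\<dots> = (detn ?m a)\<^sup>2 * gram E'"
    unfolding detn_transpose[of ?m a] by (simp only: power2_eq_square mult_ac)
  finally show ?thesis by (rule bexI[OF _ detn_Ints[OF a(1)]])
qed

text \<open>Apply \<open>gram_change\<close> in both directions: unless the Gram determinant is 0,
  the two integers have product 1 or -1. The case x = y is the independence of the basis.\<close>

lemma gram_orbit:
  fixes x y :: "real^'n^'n"
  assumes x: "invertible x" and y: "invertible y" and xy: "cls x \<in> orbit y"
    and E: "Zbasis x E" and E': "Zbasis y E'"
  shows "gram E = gram E'"
proof -
  obtain h where h: "h \<in> Hmat" "cls x = cls (y ** h)" using xy by (auto simp: orbit_def)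
  obtain s where s: "h = diagm s" "\<And>i. s $ i \<noteq> 0" using h by (auto simp: Hmat_def)
  define h' where "h' = diagm (\<chi> i. 1 / s $ i)"
  have hh': "h ** h' = mat 1" and h': "h' \<in> Hmat"
    using s by (auto simp: h'_def diagm_mult diagm_1 Hmat_def)
  have "x \<in> cls (y ** h)" using cls_self[of x] h(2) by simp
  then obtain \<gamma> c where 1: "x = c *\<^sub>R (\<gamma> ** (y ** h))" "\<gamma> \<in> GLZ" "c \<noteq> 0" by (auto simp: cls_def)
  have "cls (x ** h') = cls (y ** h ** h')" by (rule cls_mult_cong[OF h(2)])
  also have "y ** h ** h' = y" by (simp add: hh' flip: matrix_mul_assoc)
  finally have "y \<in> cls (x ** h')" using cls_self[of y] by simp
  then obtain \<gamma>' c' where 2: "y = c' *\<^sub>R (\<gamma>' ** (x ** h'))" "\<gamma>' \<in> GLZ" "c' \<noteq> 0" by (auto simp: cls_def)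
  obtain d where d: "d \<in> \<int>" "gram E = d\<^sup>2 * gram E'"
    using gram_change[OF x y 1 h(1) E E'] by blast
  obtain d' where d': "d' \<in> \<int>" "gram E' = d'\<^sup>2 * gram E"
    using gram_change[OF y x 2 h' E' E] by blast
  show ?thesis
  proof (cases "gram E' = 0")
    case False
    have "gram E' = (d' * d)\<^sup>2 * gram E'" using d d' by (simp add: power_mult_distrib)
    then have "(d' * d)\<^sup>2 = 1" using False by simp
    then have "d' * d = 1 \<or> d' * d = - 1" by (simp add: power2_eq_1_iff)
    then have "\<bar>d' * d\<bar> = 1" by auto
    moreover obtain i j where "d = of_int i" "d' = of_int j" using d(1) d'(1) by (auto elim!: Ints_cases)
    ultimately have "\<bar>real_of_int (j * i)\<bar> = 1" by simp
    then have "\<bar>j * i\<bar> = 1" by (metis of_int_abs of_int_eq_1_iff)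
    then have "\<bar>i\<bar> = 1" by (metis abs_mult abs_zmult_eq_1 mult.commute)
    then have "d\<^sup>2 = 1" using \<open>d = of_int i\<close> by (auto simp: power2_eq_1_iff abs_if split: if_splits)
    then show ?thesis using d by simp
  qed (use d in simp)
qed

lemma cls_in_orbit: "cls g \<in> orbit g" for g :: "real^'n^'n"
  unfolding orbit_eq using tone_Hpar by (intro image_eqI[of _ _ tone]) (auto simp: hat_tone)

lemma disc_eq_gram:
  fixes g :: "real^'n^'n"
  assumes "invertible g" "Zbasis g E"
  shows "disc g = gram E"
  unfolding disc_def
  by (rule the_equality) (use assms gram_orbit[OF assms(1,1) cls_in_orbit] in blast)+

lemma disc_orbit_eq:
  fixes x y :: "real^'n^'n"
  assumes "invertible x" "invertible y" "orbit x = orbit y" "Zbasis x E" "Zbasis y E'"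
  shows "disc x = disc y"
  using assms gram_orbit[of x y E E'] cls_in_orbit[of x] by (simp add: disc_eq_gram)

section \<open>The lattice and the discriminant of the order\<close>

context unit_order
begin

text \<open>The exponents start at 1, as the power 0 gives the identity, which is divided
  out.\<close>

definition mulm :: "nat \<Rightarrow> real^'n^'n" where
  "mulm k = (SOME M. (\<forall>i j. M $ i $ j \<in> \<int>) \<and> G ** diagm (\<chi> j. x j ^ Suc k) = M ** G)"

lemma mulm:
  assumes "k < CARD('n) - 1"
  shows "mulm k $ i $ j \<in> \<int>" "mulm k ** G = G ** diagm (\<chi> j. x j ^ Suc k)"
proof -
  have "(\<lambda>j. x j ^ Suc k) \<in> \<O>" using assms by (intro Zspan_power) simp
  then obtain M :: "real^'n^'n" where "\<And>i j. M $ i $ j \<in> \<int>" "G ** diagm (\<chi> j. x j ^ Suc k) = M ** G"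
    using mult_matrix by metis
  then have "\<exists>M :: real^'n^'n. (\<forall>i j. M $ i $ j \<in> \<int>) \<and> G ** diagm (\<chi> j. x j ^ Suc k) = M ** G" by blast
  from someI_ex[OF this] show "mulm k $ i $ j \<in> \<int>" "mulm k ** G = G ** diagm (\<chi> j. x j ^ Suc k)"
    unfolding mulm_def by simp_all
qed

lemma span_mult_G:
  "(b *\<^sub>R mat 1 + (\<Sum>k<CARD('n) - 1. a k *\<^sub>R mulm k)) ** G =
   G ** diagm (\<chi> j. b + (\<Sum>k<CARD('n) - 1. a k * x j ^ Suc k))"
proof -
  have sum_l: "(\<Sum>k\<in>I. f k) ** G = (\<Sum>k\<in>I. f k ** G)" for f :: "nat \<Rightarrow> real^'n^'n" and I
    by (induction I rule: infinite_finite_induct) (simp_all add: matrix_add_rdistrib)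
  have "(b *\<^sub>R mat 1 + (\<Sum>k<CARD('n) - 1. a k *\<^sub>R mulm k)) ** G =
      b *\<^sub>R G + (\<Sum>k<CARD('n) - 1. a k *\<^sub>R (G ** diagm (\<chi> j. x j ^ Suc k)))"
    by (simp add: matrix_add_rdistrib sum_l mulm)
  also have "\<dots> = G ** diagm (\<chi> j. b + (\<Sum>k<CARD('n) - 1. a k * x j ^ Suc k))"
    by (simp add: vec_eq_iff matrix_mult_diagm sum_distrib_left distrib_left mult_ac)
  finally show ?thesis .
qed

lemma sum_shift: "f 0 + (\<Sum>k<CARD('n) - 1. f (Suc k)) = (\<Sum>i<CARD('n). f i)" for f :: "nat \<Rightarrow> real"
  using sum.lessThan_Suc_shift[of f "CARD('n) - 1"] zero_less_card_finite[where 'a='n] by simp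

text \<open>The row of \<open>G\<close> with exponent 0 is (1, ..., 1), so the eigenvalue vector t
  of a lattice element is the corresponding row of \<open>M ** G\<close>: an integer combination of
  powers whose coefficients are read off from M. Independence follows from the invertibility of
  \<open>G\<close>.\<close>

lemma Zbasis_mulm:
  assumes G: "invertible G"
  shows "Zbasis G mulm"
  unfolding Zbasis_def
proof (intro conjI allI impI ballI)
  show "mulm k \<in> Lint G" if "k < CARD('n) - 1" for k
    using mulm[OF that] by (auto simp: Lint_iff[OF G])
next
  obtain G' where G': "G ** G' = mat 1" using G by (auto simp: invertible_def)
  fix M assume "M \<in> Lint G"
  then obtain t where M: "\<And>i j. M $ i $ j \<in> \<int>" and t: "M ** G = G ** diagm t"
    by (auto simp: Lint_iff[OF G])
  define m where "m i = M $ ix 0 $ ix i" for i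
  have "t $ j = m 0 + (\<Sum>k<CARD('n) - 1. m (Suc k) * x j ^ Suc k)" for j
  proof -
    have "t $ j = (G ** diagm t) $ ix 0 $ j"
      by (simp add: matrix_mult_diagm G_def xi_ix)
    also have "\<dots> = (\<Sum>k\<in>UNIV. M $ ix 0 $ k * G $ k $ j)"
      unfolding t[symmetric] by (simp add: matrix_matrix_mult_def)
    also have "\<dots> = (\<Sum>i<CARD('n). m i * G $ ix i $ j)"
      unfolding m_def by (rule sum.reindex_bij_betw[OF bij_ix, symmetric])
    also have "\<dots> = (\<Sum>i<CARD('n). m i * x j ^ i)"
      by (rule sum.cong) (auto simp: G_def xi_ix)
    also have "\<dots> = m 0 + (\<Sum>k<CARD('n) - 1. m (Suc k) * x j ^ Suc k)"
      using sum_shift[of "\<lambda>i. m i * x j ^ i"] by simp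
    finally show ?thesis .
  qed
  then have "t = (\<chi> j. m 0 + (\<Sum>k<CARD('n) - 1. m (Suc k) * x j ^ Suc k))"
    by (simp add: vec_eq_iff)
  then have "M ** G = (m 0 *\<^sub>R mat 1 + (\<Sum>k<CARD('n) - 1. m (Suc k) *\<^sub>R mulm k)) ** G"
    unfolding span_mult_G t by simp
  then have "M ** (G ** G') = (m 0 *\<^sub>R mat 1 + (\<Sum>k<CARD('n) - 1. m (Suc k) *\<^sub>R mulm k)) ** (G ** G')"
    by (simp only: matrix_mul_assoc)
  then have "M = m 0 *\<^sub>R mat 1 + (\<Sum>k<CARD('n) - 1. m (Suc k) *\<^sub>R mulm k)"
    by (simp only: G' matrix_mul_rid)
  then show "\<exists>c a. c \<in> \<int> \<and> (\<forall>k. a k \<in> \<int>) \<and> M = c *\<^sub>R mat 1 + (\<Sum>k<CARD('n) - 1. a k *\<^sub>R mulm k)"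
    using M by (intro exI[of _ "m 0"] exI[of _ "\<lambda>k. m (Suc k)"]) (simp add: m_def)
next
  obtain G' where G': "G ** G' = mat 1" "G' ** G = mat 1" using G by (auto simp: invertible_def)
  fix b :: real and a :: "nat \<Rightarrow> real"
  assume *: "b \<in> \<int> \<and> (\<forall>k. a k \<in> \<int>) \<and> b *\<^sub>R mat 1 + (\<Sum>k<CARD('n) - 1. a k *\<^sub>R mulm k) = 0"
  have "G ** diagm (\<chi> j. b + (\<Sum>k<CARD('n) - 1. a k * x j ^ Suc k)) = 0"
    using * unfolding span_mult_G[symmetric] by simp
  then have "G' ** G ** diagm (\<chi> j. b + (\<Sum>k<CARD('n) - 1. a k * x j ^ Suc k)) = 0"
    by (simp flip: matrix_mul_assoc)
  then have "diagm (\<chi> j. b + (\<Sum>k<CARD('n) - 1. a k * x j ^ Suc k)) $ j $ j = 0" for j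
    by (simp only: G' matrix_mul_lid zero_index)
  then have z: "b + (\<Sum>k<CARD('n) - 1. a k * x j ^ Suc k) = 0" for j
    by (simp add: diagm_def)
  define e where "e i = (if i = 0 then b else a (i - 1))" for i
  have "(\<Sum>i<CARD('n). e i * x j ^ i) = 0" for j
    using z[of j] sum_shift[of "\<lambda>i. e i * x j ^ i"] by (simp add: e_def)
  then have "(\<chi> k. e (xi k)) v* G = 0"
    using sum_xi[of "\<lambda>i. e i * x _ ^ i", where 'n='n]
    by (simp add: vec_eq_iff vector_matrix_mult_def G_def mult.commute)
  then have "(\<chi> k. e (xi k)) v* (G ** G') = 0"
    by (simp flip: vector_matrix_mul_assoc)
  then have "e (xi k) = 0" for k :: 'n
    by (simp add: G' vec_eq_iff)
  then have e0: "e i = 0" if "i < CARD('n)" for i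
    using xi_ix[OF that] by metis
  show "b = 0" using e0[of 0] by (simp add: e_def)
  show "a k = 0" if "k < CARD('n) - 1" for k
    using e0[of "Suc k"] that by (simp add: e_def)
qed

text \<open>With power sums p_i the Gram entries are n^3 (p_(k+l) - p_k p_l / n) for k, l from 1 to
  n - 1. This is n^3 times the Schur complement of the matrix of power sums at its entry p_0 = n,
  and that matrix is the Vandermonde matrix times its transpose.\<close>

lemma disc_G:
  assumes G: "invertible G"
  shows "disc G = real CARD('n) ^ (3 * (CARD('n) - 1)) / real CARD('n) * (det G)\<^sup>2"
proof -
  let ?n = "CARD('n)"
  obtain G' where G': "G ** G' = mat 1" "G' ** G = mat 1" using G by (auto simp: invertible_def)
  define p where "p i = (\<Sum>j\<in>UNIV. x j ^ i)" for i
  define K where "K k l = p (k + l)" for k l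
  have K00: "K 0 0 = real ?n" by (simp add: K_def p_def)
  have conj: "mulm k = G ** diagm (\<chi> j. x j ^ Suc k) ** G'" if "k < ?n - 1" for k
    unfolding mulm(2)[OF that, symmetric] by (simp add: G' flip: matrix_mul_assoc)
  have tr: "trace (G ** A ** G') = trace A" for A by (rule trace_conj[OF G'(2)])
  have trd: "trace (diagm v) = (\<Sum>j\<in>UNIV. v $ j)" for v :: "real^'n"
    by (simp add: trace_def diagm_def)
  have "gram mulm = detn (?n - 1) (\<lambda>k l. real ?n ^ 3 * (K (Suc k) (Suc l) - K (Suc k) 0 * K 0 (Suc l) / K 0 0))"
  proof (rule detn_cong)
    fix k l assume kl: "k < ?n - 1" "l < ?n - 1"
    have "mulm k ** mulm l = G ** (diagm (\<chi> j. x j ^ Suc k) ** diagm (\<chi> j. x j ^ Suc l)) ** G'"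
      unfolding conj[OF kl(1)] conj[OF kl(2)] by (rule matrix_conj_mult[OF G'(2)])
    then have "trace (mulm k ** mulm l) = K (Suc k) (Suc l)"
      by (simp add: tr diagm_mult trd K_def p_def power_add mult_ac)
    moreover have "trace (mulm k) = K (Suc k) 0"
      by (simp only: conj[OF kl(1)] tr trd) (simp add: K_def p_def)
    moreover have "trace (mulm l) = K 0 (Suc l)"
      by (simp only: conj[OF kl(2)] tr trd) (simp add: K_def p_def)
    ultimately show "Bform (mulm k) (mulm l) = real ?n ^ 3 * (K (Suc k) (Suc l) - K (Suc k) 0 * K 0 (Suc l) / K 0 0)"
      by (simp add: Bform_eq K00 field_simps power3_eq_cube power2_eq_square)
  qed
  also have "\<dots> = (real ?n ^ 3) ^ (?n - 1) * (detn (Suc (?n - 1)) K / K 0 0)"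
  proof -
    have "K 0 0 \<noteq> 0" by (simp add: K00)
    then have "detn (Suc (?n - 1)) K / K 0 0 = detn (?n - 1) (\<lambda>k l. K (Suc k) (Suc l) - K (Suc k) 0 * K 0 (Suc l) / K 0 0)"
      by (subst detn_Schur) simp_all
    then show ?thesis by (simp only: detn_cmult)
  qed
  also have "detn (Suc (?n - 1)) K = (det G)\<^sup>2"
  proof -
    let ?V = "\<lambda>i j. x (ix j) ^ i"
    have "detn ?n K = detn ?n (\<lambda>k l. \<Sum>j<?n. ?V k j * ?V l j)"
    proof (rule detn_cong)
      fix k l
      have "K k l = (\<Sum>j<?n. x (ix j) ^ (k + l))"
        unfolding K_def p_def by (rule sum.reindex_bij_betw[OF bij_ix, symmetric])
      then show "K k l = (\<Sum>j<?n. ?V k j * ?V l j)" by (simp add: power_add)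
    qed
    also have "\<dots> = detn ?n ?V * detn ?n (\<lambda>j l. ?V l j)" by (rule detn_mult)
    also have "\<dots> = (det G)\<^sup>2"
      by (simp only: detn_transpose[of ?n ?V] detn_vandermonde det_G power2_eq_square)
    finally show ?thesis using zero_less_card_finite[where 'a='n] by simp
  qed
  finally show ?thesis
    by (simp add: disc_eq_gram[OF G Zbasis_mulm[OF G]] K00 power_mult)
qed

end

subsection \<open>A family of escaping orbits\<close>

lemma xi_dist:
  fixes i j :: "'n::finite"
  assumes "i \<noteq> j"
  shows "1 \<le> \<bar>real (xi i) - real (xi j)\<bar>" "\<bar>real (xi i) - real (xi j)\<bar> \<le> real CARD('n) - 1"
proof -
  have "xi i \<noteq> xi j" using assms by (simp add: inj_xi)
  then show "1 \<le> \<bar>real (xi i) - real (xi j)\<bar>" by linarith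
  have "xi i < CARD('n)" "xi j < CARD('n)" by (rule xi_less)+
  then show "\<bar>real (xi i) - real (xi j)\<bar> \<le> real CARD('n) - 1" by linarith
qed

text \<open>Near \<open>a * xi j\<close> the factors with \<open>k \<noteq> j\<close> have constant sign and are large, while the remaining
  factor ranges over \<open>[-1/8, 1/8]\<close>; hence the product takes the value 1.\<close>

lemma root_exists:
  assumes n: "CARD('n::finite) \<ge> 2" and a: "a \<ge> 16"
  shows "\<exists>y. \<bar>y - real a * real (xi (j :: 'n))\<bar> \<le> 1 / 8 \<and> (\<Prod>k<CARD('n). y - of_int (int (a * k))) = 1"
proof -
  let ?c = "real a * real (xi j)"
  define P where "P y = (\<Prod>k<CARD('n). y - of_int (int (a * k)))" for y :: real
  define Q where "Q y = (\<Prod>k\<in>UNIV - {j}. y - real a * real (xi k))" for y :: real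
  have P: "P y = (y - ?c) * Q y" for y
  proof -
    have "P y = (\<Prod>k\<in>(UNIV :: 'n set). y - real a * real (xi k))"
      unfolding P_def using prod_xi[of "\<lambda>k. y - real a * real k", where 'n='n] by simp
    then show ?thesis unfolding Q_def by (simp add: prod.remove[of UNIV j])
  qed
  \<comment> \<open>Each other factor has absolute value at least 16 - 1 / 8, and one exists as n is
    at least 2. At distance 1 / 8 from the centre this makes the product at least 15 / 8 > 1 in
    absolute value.\<close>
  have Q15: "15 \<le> \<bar>Q y\<bar>" if y: "\<bar>y - ?c\<bar> \<le> 1 / 8" for y
  proof -
    have f: "15 \<le> \<bar>y - real a * real (xi k)\<bar>" if "k \<noteq> j" for k
    proof -
      have "real a * 1 \<le> real a * \<bar>real (xi j) - real (xi k)\<bar>"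
        using xi_dist(1)[of j k] that by (intro mult_left_mono) auto
      also have "\<dots> = \<bar>?c - real a * real (xi k)\<bar>"
        by (simp add: abs_mult flip: right_diff_distrib)
      finally show ?thesis using y a by linarith
    qed
    have "15 ^ 1 \<le> (15 :: real) ^ (CARD('n) - 1)" using n by (intro power_increasing) auto
    also have "\<dots> = (\<Prod>k\<in>UNIV - {j}. 15)" by (simp add: card_Diff_singleton)
    also have "\<dots> \<le> (\<Prod>k\<in>UNIV - {j}. \<bar>y - real a * real (xi k)\<bar>)"
      using f by (intro prod_mono) auto
    finally show ?thesis by (simp add: Q_def abs_prod)
  qed
  \<comment> \<open>With equal signs of Q at both ends, P reaches 1 between the centre, where it
    vanishes, and the right end if Q is positive there, the left end if Q is negative.\<close>
  have same: "0 < Q (?c - 1 / 8) * Q (?c + 1 / 8)"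
  proof -
    have "0 < (?c - 1 / 8 - real a * real (xi k)) * (?c + 1 / 8 - real a * real (xi k))" if "k \<noteq> j" for k
    proof -
      have "real a * 1 \<le> real a * \<bar>real (xi j) - real (xi k)\<bar>"
        using xi_dist(1)[of j k] that by (intro mult_left_mono) auto
      also have "\<dots> = \<bar>?c - real a * real (xi k)\<bar>"
        by (simp add: abs_mult flip: right_diff_distrib)
      finally have "1 \<le> \<bar>?c - real a * real (xi k)\<bar>" using a by linarith
      moreover have "0 < (u - 1 / 8) * (u + 1 / 8)" if "1 \<le> \<bar>u\<bar>" for u :: real
        using that by (cases "u > 0") (auto intro: mult_pos_pos mult_neg_neg)
      ultimately have "0 < (?c - real a * real (xi k) - 1 / 8) * (?c - real a * real (xi k) + 1 / 8)" by blast
      then show ?thesis by (simp add: algebra_simps)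
    qed
    then show ?thesis unfolding Q_def prod.distrib[symmetric] by (intro prod_pos) auto
  qed
  have cont: "continuous_on S P" for S unfolding P_def by (intro continuous_intros)
  have "\<exists>y. \<bar>y - ?c\<bar> \<le> 1 / 8 \<and> P y = 1"
  proof (cases "Q (?c + 1 / 8) > 0")
    case True
    then have "15 \<le> Q (?c + 1 / 8)" using Q15[of "?c + 1 / 8"] by simp
    then have "1 \<le> P (?c + 1 / 8)" by (simp add: P)
    moreover have "P ?c \<le> 1" by (simp add: P)
    ultimately obtain y where "?c \<le> y" "y \<le> ?c + 1 / 8" "P y = 1"
      using IVT'[of P ?c 1 "?c + 1 / 8"] cont by auto
    then show ?thesis by (intro exI[of _ y]) auto
  next
    case False
    then have "Q (?c - 1 / 8) < 0" using same by (auto simp: zero_less_mult_iff)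
    then have "Q (?c - 1 / 8) \<le> - 15" using Q15[of "?c - 1 / 8"] by simp
    then have "1 \<le> P (?c - 1 / 8)" by (simp add: P)
    moreover have "P ?c \<le> 1" by (simp add: P)
    ultimately obtain y where "?c - 1 / 8 \<le> y" "y \<le> ?c" "P y = 1"
      using IVT2'[of P ?c 1 "?c - 1 / 8"] cont by auto
    then show ?thesis by (intro exI[of _ y]) auto
  qed
  then show ?thesis by (simp add: P_def)
qed

definition rt :: "nat \<Rightarrow> 'n::finite \<Rightarrow> real" where
  "rt a j = (SOME y. \<bar>y - real a * real (xi j)\<bar> \<le> 1 / 8 \<and> (\<Prod>k<CARD('n). y - of_int (int (a * k))) = 1)"

definition pt :: "nat \<Rightarrow> real^'n^'n" where
  "pt a = unit_order.G (rt a)"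

text \<open>The type argument fixes the index type, which the numbers j and l leave open.\<close>

abbreviation gap :: "'n::finite itself \<Rightarrow> nat \<Rightarrow> nat \<Rightarrow> nat \<Rightarrow> real" where
  "gap _ a j l \<equiv> rt a (ix j :: 'n) - rt a (ix l :: 'n)"

definition pairs :: "nat \<Rightarrow> (nat \<times> nat) set" where
  "pairs n = Sigma {..<n} lessThan"

lemma finite_pairs: "finite (pairs n)"
  by (simp add: pairs_def)

lemma card_pairs: "2 * card (pairs n) = n * (n - 1)"
proof -
  have "card (pairs n) = (\<Sum>j<n. j)" by (simp add: pairs_def)
  then show ?thesis
    by (induction n arbitrary: rule: nat.induct) (simp_all add: pairs_def algebra_simps)
qed

text \<open>ln 2 pays for the lower bound on y and ln N for the upper one.\<close>

lemma ln_near: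
  fixes A N y :: real
  assumes "A > 0" "N \<ge> 1" "A / 2 \<le> y" "y \<le> N * A"
  shows "\<bar>ln y - ln A\<bar> \<le> ln (2 * N)"
proof -
  have y: "y > 0" using assms by linarith
  have "ln y \<le> ln (N * A)" using assms y by simp
  also have "\<dots> = ln N + ln A" using assms by (simp add: ln_mult)
  finally have 1: "ln y - ln A \<le> ln N" by simp
  have "ln A - ln 2 = ln (A / 2)" using assms by (simp add: ln_div)
  also have "\<dots> \<le> ln y" using assms y by simp
  finally have 2: "ln A - ln y \<le> ln 2" by simp
  have 3: "ln (2 * N) = ln 2 + ln N" "ln N \<ge> 0" "ln 2 \<ge> (0 :: real)" using assms by (auto simp: ln_mult)
  show ?thesis using 1 2 3 by linarith
qed

context
  fixes a :: nat
  assumes n: "CARD('n::finite) \<ge> 2" and a: "a \<ge> 16"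
begin

lemma rt: "\<bar>rt a (j :: 'n) - real a * real (xi j)\<bar> \<le> 1 / 8" "(\<Prod>k<CARD('n). rt a (j :: 'n) - of_int (int (a * k))) = 1"
  using someI_ex[OF root_exists[OF n a, of j]] by (simp_all add: rt_def)

lemma unit_order_rt: "unit_order (rt a :: 'n \<Rightarrow> real) (\<lambda>k. int (a * k))"
  by unfold_locales (rule rt(2))

lemma det_pt: "det (pt a :: real^'n^'n) = (\<Prod>(j, l)\<in>pairs CARD('n). gap TYPE('n) a j l)"
  unfolding pt_def unit_order.det_G[OF unit_order_rt] pairs_def by (rule prod.Sigma) auto

lemma rt_diff:
  assumes "(j, l) \<in> pairs CARD('n)"
  shows "\<bar>(gap TYPE('n) a j l) - real a * (real j - real l)\<bar> \<le> 1 / 4"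
proof -
  have jl: "j < CARD('n)" "l < CARD('n)" using assms by (auto simp: pairs_def)
  have "\<bar>rt a (ix j :: 'n) - real a * real j\<bar> \<le> 1 / 8" "\<bar>rt a (ix l :: 'n) - real a * real l\<bar> \<le> 1 / 8"
    using rt(1)[of "ix j"] rt(1)[of "ix l"] unfolding xi_ix[OF jl(1)] xi_ix[OF jl(2)] by simp_all
  moreover have "real a * (real j - real l) = real a * real j - real a * real l"
    by (rule right_diff_distrib)
  ultimately show ?thesis by linarith
qed

lemma rt_diff_bounds:
  assumes "(j, l) \<in> pairs CARD('n)"
  shows "real a / 2 \<le> gap TYPE('n) a j l" "gap TYPE('n) a j l \<le> real CARD('n) * real a"
proof -
  have jl: "l < j" "j < CARD('n)" using assms by (auto simp: pairs_def)
  have "real a * 1 \<le> real a * (real j - real l)" using jl by (intro mult_left_mono) auto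
  then show "real a / 2 \<le> gap TYPE('n) a j l" using rt_diff[OF assms] a by linarith
  have "real a * (real j - real l) \<le> real a * (real CARD('n) - 1)" using jl by (intro mult_left_mono) auto
  also have "\<dots> = real CARD('n) * real a - real a" by (simp add: algebra_simps)
  finally show "gap TYPE('n) a j l \<le> real CARD('n) * real a"
    using rt_diff[OF assms] a by linarith
qed

lemma det_pt_bounds:
  "(real a / 2) ^ card (pairs CARD('n)) \<le> det (pt a :: real^'n^'n)"
  "det (pt a :: real^'n^'n) \<le> (real CARD('n) * real a) ^ card (pairs CARD('n))"
proof -
  have "(\<Prod>p\<in>pairs CARD('n). real a / 2) \<le> det (pt a :: real^'n^'n)"
    unfolding det_pt using rt_diff_bounds(1) by (intro prod_mono) auto
  then show "(real a / 2) ^ card (pairs CARD('n)) \<le> det (pt a :: real^'n^'n)" by simp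
  have "0 \<le> gap TYPE('n) a j l" if "(j, l) \<in> pairs CARD('n)" for j l
    using rt_diff_bounds(1)[OF that] by linarith
  then have "det (pt a :: real^'n^'n) \<le> (\<Prod>p\<in>pairs CARD('n). real CARD('n) * real a)"
    unfolding det_pt using rt_diff_bounds(2) by (intro prod_mono) auto
  then show "det (pt a :: real^'n^'n) \<le> (real CARD('n) * real a) ^ card (pairs CARD('n))" by simp
qed

lemma det_pt_pos: "0 < det (pt a :: real^'n^'n)"
  using det_pt_bounds(1) a by (meson less_le_trans zero_less_power half_gt_zero of_nat_0_less_iff zero_less_numeral)

lemma invertible_pt: "invertible (pt a :: real^'n^'n)"
  using det_pt_pos by (simp add: invertible_det_nz)

lemma unit_bounds:
  assumes "k \<noteq> (j :: 'n)"
  shows "\<bar>ln \<bar>unit_order.unit (rt a) (\<lambda>k. int (a * k)) k j\<bar> - ln (real a)\<bar> \<le> ln (2 * real CARD('n))"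
proof -
  let ?u = "unit_order.unit (rt a) (\<lambda>k. int (a * k)) k j"
  have u: "?u = rt a j - real a * real (xi k)"
    unfolding unit_order.unit_def[OF unit_order_rt] by simp
  define d where "d = \<bar>real (xi j) - real (xi k)\<bar>"
  have dd: "1 \<le> d" "d \<le> real CARD('n) - 1"
    unfolding d_def using xi_dist[of j k] assms by auto
  have d: "real a * 1 \<le> real a * d" "real a * d \<le> real a * (real CARD('n) - 1)"
    by (intro mult_left_mono dd of_nat_0_le_iff)+
  have "real a * d = \<bar>real a * real (xi j) - real a * real (xi k)\<bar>"
    by (simp add: d_def abs_mult flip: right_diff_distrib)
  then have "real a * d - 1 / 8 \<le> \<bar>?u\<bar>" "\<bar>?u\<bar> \<le> real a * d + 1 / 8"
    using rt(1)[of j] unfolding u by linarith+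
  moreover have "real a * (real CARD('n) - 1) = real CARD('n) * real a - real a"
    by (simp add: algebra_simps)
  moreover have "real a \<ge> 16" using a by simp
  ultimately have "real a / 2 \<le> \<bar>?u\<bar>" "\<bar>?u\<bar> \<le> real CARD('n) * real a"
    using d by linarith+
  then show ?thesis using a n by (intro ln_near) auto
qed

lemma pt_covering:
  assumes big: "ln (real a) \<ge> 2 * real CARD('n) * ln (2 * real CARD('n))" and t: "t \<in> Hpar"
  shows "\<exists>s\<in>stab (pt a :: real^'n^'n). tmul t s \<in> logbox (real CARD('n) * ln (real a))"
proof -
  interpret unit_order "rt a :: 'n \<Rightarrow> real" "\<lambda>k. int (a * k)" by (rule unit_order_rt)
  let ?n = "real CARD('n)"
  let ?c = "ln (2 * ?n)"
  let ?l = "\<lambda>k j. ln \<bar>unit k j\<bar>"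
  have n2: "?n \<ge> 2" using n by simp
  have c0: "?c \<ge> 0" using n2 by simp
  have off: "\<bar>?l k j - ln (real a)\<bar> \<le> ?c" if "k \<noteq> j" for k j
    using unit_bounds[OF that] .
  have us: "ln \<bar>unit_stab k j\<bar> = ?l k j - ?l k i0" if "j \<noteq> i0" for k j
    unfolding unit_stab_def using that unit_nonzero by (simp add: ln_div del: of_nat_mult)
  have diag: "\<bar>?l k k + (?n - 1) * ln (real a)\<bar> \<le> (?n - 1) * ?c" for k
  proof -
    have "(\<Prod>l\<in>UNIV. \<bar>unit l k\<bar>) = 1"
      using prod_unit[of k] by (simp flip: abs_prod)
    then have "0 = ln (\<Prod>l\<in>UNIV. \<bar>unit l k\<bar>)" by simp
    also have "\<dots> = (\<Sum>l\<in>UNIV. ?l l k)"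
      using unit_nonzero by (intro ln_prod) auto
    also have "\<dots> = ?l k k + (\<Sum>l\<in>UNIV - {k}. ?l l k)" by (simp add: sum.remove)
    also have "(\<Sum>l\<in>UNIV - {k}. ?l l k) = (\<Sum>l\<in>UNIV - {k}. ?l l k - ln (real a)) + (?n - 1) * ln (real a)"
      using n by (simp add: sum_subtractf card_Diff_singleton of_nat_diff)
    finally have "?l k k + (?n - 1) * ln (real a) = - (\<Sum>l\<in>UNIV - {k}. ?l l k - ln (real a))" by simp
    also have "\<bar>\<dots>\<bar> \<le> (\<Sum>l\<in>UNIV - {k}. \<bar>?l l k - ln (real a)\<bar>)"
      unfolding abs_minus_cancel by (rule sum_abs)
    also have "\<dots> \<le> (\<Sum>l\<in>UNIV - {k}. ?c)" by (intro sum_mono off) auto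
    also have "\<dots> = (?n - 1) * ?c" using n by (simp add: card_Diff_singleton of_nat_diff)
    finally show ?thesis .
  qed
  have lna: "ln (real a) > 0" using a by simp
  \<comment> \<open>The error e collects (n - 1) ln (2 n) from the diagonal entry, which is minus
    the sum of n - 1 other logarithms, and one more ln (2 n) from the division by coordinate
    \<open>i0\<close>. Off the diagonal only two such errors occur, and n is at least 2.\<close>
  show ?thesis
  proof (rule stab_covering[where \<tau> = unit_stab and e = "?n * ?c"])
    fix k assume k: "k \<noteq> (i0 :: 'n)"
    show "unit_stab k \<in> stab (pt a)"
      unfolding pt_def by (rule unit_stab_in[OF invertible_pt[unfolded pt_def]])
    show "\<bar>ln \<bar>unit_stab k k\<bar> + ?n * ln (real a)\<bar> \<le> ?n * ?c"
    proof -
      have "(?n - 1) * ln (real a) = ?n * ln (real a) - ln (real a)" "(?n - 1) * ?c = ?n * ?c - ?c"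
        by (simp_all add: left_diff_distrib)
      then show ?thesis
        using diag[of k] off[OF k] unfolding us[OF k] by linarith
    qed
    fix i assume i: "i \<noteq> (i0 :: 'n)" "i \<noteq> k"
    have "\<bar>ln \<bar>unit_stab k i\<bar>\<bar> \<le> 2 * ?c"
      using off[of k i] off[of k i0] i k unfolding us[OF i(1)] by (auto simp: abs_le_iff)
    also have "\<dots> \<le> ?n * ?c" using n2 c0 by (rule mult_right_mono)
    finally show "\<bar>ln \<bar>unit_stab k i\<bar>\<bar> \<le> ?n * ?c" .
  next
    show "0 < ?n * ln (real a)" using lna n2 by simp
    show "2 * ?n * (?n * ?c) \<le> ?n * ln (real a)"
      using mult_left_mono[OF big, of ?n] by (simp add: mult_ac)
  qed (use c0 n2 t in auto)
qed

lemma disc_pt: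
  "disc (pt a :: real^'n^'n) = real CARD('n) ^ (3 * (CARD('n) - 1)) / real CARD('n) * (det (pt a :: real^'n^'n))\<^sup>2"
  unfolding pt_def by (rule unit_order.disc_G[OF unit_order_rt invertible_pt[unfolded pt_def]])

lemma Zbasis_pt: "\<exists>E. Zbasis (pt a :: real^'n^'n) E"
  unfolding pt_def using unit_order.Zbasis_mulm[OF unit_order_rt invertible_pt[unfolded pt_def]] by blast

lemma pt_row: "(pt a :: real^'n^'n) $ ix 0 $ j = 1"
  using n by (simp add: pt_def unit_order.G_def[OF unit_order_rt] xi_ix)

text \<open>The determinant is at least (a / 2)^(n (n - 1) / 2). Its n-th root has exponent (n - 1)
  / 2, which is at least 1 / 2.\<close>

lemma root_det_pt: "sqrt (real a / 2) \<le> root CARD('n) (det (pt a :: real^'n^'n))"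
proof -
  have "CARD('n) * 1 \<le> CARD('n) * (CARD('n) - 1)" using n by (intro mult_left_mono) auto
  then have le: "CARD('n) \<le> 2 * card (pairs CARD('n))" by (simp add: card_pairs)
  have "sqrt (real a / 2) ^ CARD('n) \<le> sqrt (real a / 2) ^ (2 * card (pairs CARD('n)))"
    using a le by (intro power_increasing) auto
  also have "\<dots> = (real a / 2) ^ card (pairs CARD('n))"
    by (simp add: power_mult)
  also have "\<dots> \<le> det (pt a :: real^'n^'n)" by (rule det_pt_bounds)
  finally have "root CARD('n) (sqrt (real a / 2) ^ CARD('n)) \<le> root CARD('n) (det (pt a :: real^'n^'n))"
    by simp
  then show ?thesis by (simp add: real_root_power_cancel)
qed

text \<open>The constant row of \<open>pt a\<close> is the short vector. The box stretches each of
  its entries by at most exp \<tau> and shrinks the normalising root of the determinant by at most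
  the same factor, whence the exponent 2 \<tau>.\<close>

lemma pt_escape:
  fixes t :: "'n \<Rightarrow> real"
  assumes t: "t \<in> logbox \<tau>" and \<tau>: "\<tau> \<ge> 0" and R: "R \<ge> 0"
    and big: "fact CARD('n) * (real CARD('n) * (R + 1) ^ (CARD('n) - 1)) * exp (2 * \<tau>) < sqrt (real a / 2)"
  shows "Psi (cls (pt a ** hat t)) > R"
proof (rule Psi_gt_short_row)
  let ?n = "CARD('n)" and ?g = "pt a :: real^'n^'n"
  have tH: "t \<in> Hpar" using t by (simp add: logbox_def)
  show "invertible (?g ** hat t)" by (rule invertible_mult_hat[OF invertible_pt tH])
  note hvb = hv_logbox[OF t \<tau>]
  have "norm ((?g ** hat t) $ ix 0) \<le> (\<Sum>j\<in>UNIV. \<bar>(?g ** hat t) $ ix 0 $ j\<bar>)"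
    by (rule norm_le_l1_cart)
  also have "\<dots> \<le> (\<Sum>j\<in>(UNIV :: 'n set). exp \<tau>)"
    using hvb by (intro sum_mono) (simp add: hat_eq matrix_mult_diagm pt_row)
  finally have row: "norm ((?g ** hat t) $ ix 0) \<le> real ?n * exp \<tau>" by simp
  have "exp (- \<tau>) ^ ?n = (\<Prod>i\<in>(UNIV :: 'n set). exp (- \<tau>))" by simp
  also have "\<dots> \<le> (\<Prod>i\<in>UNIV. \<bar>hv t $ i\<bar>)" using hvb by (intro prod_mono) auto
  finally have "det ?g * exp (- \<tau>) ^ ?n \<le> det ?g * (\<Prod>i\<in>UNIV. \<bar>hv t $ i\<bar>)"
    using det_pt_pos by (intro mult_left_mono) auto
  also have "\<dots> = \<bar>det (?g ** hat t)\<bar>"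
    using det_pt_pos by (simp add: det_mul hat_eq det_diagm abs_mult abs_prod)
  finally have "root ?n (det ?g * exp (- \<tau>) ^ ?n) \<le> root ?n \<bar>det (?g ** hat t)\<bar>" by simp
  then have det: "root ?n (det ?g) * exp (- \<tau>) \<le> root ?n \<bar>det (?g ** hat t)\<bar>"
    by (simp add: real_root_mult real_root_power_cancel)
  have "fact ?n * (norm ((?g ** hat t) $ ix 0) * (R + 1) ^ (?n - 1)) \<le> fact ?n * ((real ?n * exp \<tau>) * (R + 1) ^ (?n - 1))"
    using row R by (intro mult_left_mono mult_right_mono) auto
  also have "\<dots> = (fact ?n * (real ?n * (R + 1) ^ (?n - 1)) * exp (2 * \<tau>)) * exp (- \<tau>)"
    by (simp add: mult_ac flip: exp_add)
  also have "\<dots> < sqrt (real a / 2) * exp (- \<tau>)" using big by simp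
  also have "\<dots> \<le> root ?n (det ?g) * exp (- \<tau>)" using root_det_pt by simp
  also note det
  finally show "fact ?n * (norm ((?g ** hat t) $ ix 0) * (R + 1) ^ (?n - 1)) < root ?n \<bar>det (?g ** hat t)\<bar>" .
qed (rule R)

end

text \<open>Raising a widens the main term of every gap by at least 1, while the two errors add up
  to at most 1 / 2.\<close>

lemma det_pt_less:
  assumes n: "CARD('n::finite) \<ge> 2" and a: "a \<ge> 16" "a < b"
  shows "det (pt a :: real^'n^'n) < det (pt b :: real^'n^'n)"
proof -
  have b: "b \<ge> 16" using a by simp
  have ne: "(1, 0) \<in> pairs CARD('n)" using n by (auto simp: pairs_def)
  have key: "0 \<le> gap TYPE('n) a j l \<and> gap TYPE('n) a j l < gap TYPE('n) b j l"
    if "(j, l) \<in> pairs CARD('n)" for j l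
  proof -
    have jl: "l < j" using that by (auto simp: pairs_def)
    have "1 * 1 \<le> (real b - real a) * (real j - real l)"
      using jl a by (intro mult_mono) auto
    then have "real a * (real j - real l) + 1 \<le> real b * (real j - real l)"
      by (simp add: left_diff_distrib)
    then show ?thesis
      using rt_diff[OF n a(1) that] rt_diff[OF n b that] rt_diff_bounds(1)[OF n a(1) that] by linarith
  qed
  show ?thesis
    unfolding det_pt[OF n a(1)] det_pt[OF n b]
  proof (rule prod_mono_strict[OF ne])
    fix p assume "p \<in> pairs CARD('n)"
    then obtain j l where p: "p = (j, l)" "(j, l) \<in> pairs CARD('n)" by (cases p) auto
    show "0 \<le> (case p of (j, l) \<Rightarrow> gap TYPE('n) a j l) \<and>
        (case p of (j, l) \<Rightarrow> gap TYPE('n) a j l) \<le> (case p of (j, l) \<Rightarrow> gap TYPE('n) b j l)"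
      using key[OF p(2)] by (simp add: p(1))
    show "0 < (case p of (j, l) \<Rightarrow> gap TYPE('n) b j l)"
      using key[OF p(2)] unfolding p(1) prod.case by linarith
  qed (use key[OF ne] finite_pairs in auto)
qed

text \<open>The exponential is a^(1/4): it is the factor exp (2 \<tau>) of \<open>pt_escape\<close>
  for \<tau> = ln a / 8.\<close>

lemma short_vectors_eventually:
  fixes C :: real
  shows "\<forall>\<^sub>F a :: nat in sequentially. C * exp (ln (real a) / 4) < sqrt (real a / 2)"
proof -
  have "filterlim (\<lambda>a :: nat. sqrt (real a / 2) / exp (ln (real a) / 4)) at_top sequentially"
    by real_asymp
  then have "\<forall>\<^sub>F a :: nat in sequentially. C < sqrt (real a / 2) / exp (ln (real a) / 4)"
    by (simp add: filterlim_at_top_dense)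
  then show ?thesis
    by eventually_elim (simp add: less_divide_eq)
qed

text \<open>The covering box has side n ln a, and q = 8 n cuts it down to side ln a / 8, where
  \<open>pt_escape\<close> applies. The lower bound is uniform because q depends neither on a nor on
  R.\<close>

lemma orbmeas_escape:
  assumes n: "CARD('n::finite) \<ge> 2"
  shows "\<forall>\<^sub>F a in sequentially. 1 / real (2 * (8 * CARD('n)) + 1) ^ CARD('n) \<le>
    measure (orbmeas (pt a :: real^'n^'n)) {p \<in> Xset. Psi p > R}"
proof -
  let ?n = "real CARD('n)"
  \<comment> \<open>\<open>pt_escape\<close> asks for a nonnegative threshold, and raising R only
    shrinks the set.\<close>
  define R' where "R' = max R 0"
  have "filterlim (\<lambda>a :: nat. ln (real a)) at_top sequentially" by real_asymp
  then have "\<forall>\<^sub>F a :: nat in sequentially. 2 * ?n * ln (2 * ?n) \<le> ln (real a)"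
    by (simp add: filterlim_at_top)
  moreover have "\<forall>\<^sub>F a in sequentially. a \<ge> (16 :: nat)" by (rule eventually_ge_at_top)
  moreover note short_vectors_eventually[of "fact CARD('n) * (?n * (R' + 1) ^ (CARD('n) - 1))"]
  ultimately show ?thesis
  proof eventually_elim
    case (elim a)
    let ?g = "pt a :: real^'n^'n"
    let ?T = "?n * ln (real a)"
    interpret cocompact_stab ?g ?T
      by unfold_locales (use elim(2) n invertible_pt[OF n] pt_covering[OF n elim(2,1)] in auto)
    have [measurable]: "Psi \<in> borel_measurable (borelX :: (real^'n^'n) set measure)"
      by (rule borel_measurable_Xtop[OF continuous_map_Psi])
    have "{p \<in> space borelX. Psi p > R} \<in> sets (borelX :: (real^'n^'n) set measure)" by measurable
    then have A: "{p \<in> Xset. Psi p > R} \<in> sets (borelX :: (real^'n^'n) set measure)"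
      by (simp add: space_borelX)
    show ?case
    proof (rule inv_prob_box_mass[OF _ inv_prob_orbmeas A])
      show "0 < 8 * CARD('n)" using n by simp
      fix t :: "'n \<Rightarrow> real" assume t: "t \<in> logbox (?T / real (8 * CARD('n)))"
      have \<tau>: "?T / real (8 * CARD('n)) = ln (real a) / 8" using n by simp
      have "Psi (cls (?g ** hat t)) > R'"
      proof (rule pt_escape[OF n elim(2)])
        show "t \<in> logbox (ln (real a) / 8)" using t unfolding \<tau> .
        show "fact CARD('n) * (?n * (R' + 1) ^ (CARD('n) - 1)) * exp (2 * (ln (real a) / 8)) < sqrt (real a / 2)"
          using elim(3) by simp
      qed (use elim(2) in \<open>auto simp: R'_def\<close>)
      moreover have "t \<in> Hpar" using t by (simp add: logbox_def)
      ultimately show "cls (?g ** hat t) \<in> {p \<in> Xset. Psi p > R}"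
        using cls_Xset[OF invertible_mult_hat[OF g]] by (simp add: R'_def)
    qed
  qed
qed

text \<open>All i with i + a0 < (D / K)^(1 / N) are counted, and the shift a0 costs at most half of
  this bound once D is large. Finiteness matters because an infinite set has cardinality 0.\<close>

lemma card_growth:
  fixes f :: "nat \<Rightarrow> real" and K :: real and N a0 :: nat
  assumes N: "N > 0" and K: "K > 0" and f: "\<And>i. f i \<le> K * real (i + a0) ^ N"
    and fin: "\<And>D. finite {i. f i < D}"
  shows "\<exists>D0. \<forall>D\<ge>D0. 1 / 2 * (1 / K) powr (1 / real N) * D powr (1 / real N) \<le> real (card {i. f i < D})"
proof (intro exI[of _ "max 1 (K * (2 * real a0) ^ N)"] allI impI)
  fix D assume "max 1 (K * (2 * real a0) ^ N) \<le> D"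
  then have D: "1 \<le> D" "K * (2 * real a0) ^ N \<le> D" by auto
  define y where "y = (D / K) powr (1 / real N)"
  have yN: "y ^ N = D / K"
    using D K N by (simp add: y_def powr_power)
  have y0: "y \<ge> 0" by (simp add: y_def)
  have ya: "2 * real a0 \<le> y"
  proof -
    have "(2 * real a0) ^ N \<le> y ^ N" using D K unfolding yN by (simp add: field_simps)
    then show ?thesis by (subst (asm) power_mono_iff) (use y0 N in auto)
  qed
  have "{..<nat \<lceil>y - real a0\<rceil>} \<subseteq> {i. f i < D}"
  proof
    fix i assume "i \<in> {..<nat \<lceil>y - real a0\<rceil>}"
    then have "real (i + a0) < y" by (simp add: zless_nat_eq_int_zless less_ceiling_iff)
    then have "real (i + a0) ^ N < y ^ N" using N by (intro power_strict_mono) auto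
    then have "K * real (i + a0) ^ N < D" using K by (simp add: yN field_simps)
    then show "i \<in> {i. f i < D}" using f[of i] by simp
  qed
  then have "nat \<lceil>y - real a0\<rceil> \<le> card {i. f i < D}"
    using card_mono[OF fin] by (metis card_lessThan)
  then have "y - real a0 \<le> real (card {i. f i < D})" by linarith
  then have "1 / 2 * y \<le> real (card {i. f i < D})" using ya by linarith
  moreover have "y = (1 / K) powr (1 / real N) * D powr (1 / real N)"
    using D K by (simp add: y_def powr_mult[symmetric])
  ultimately show "1 / 2 * (1 / K) powr (1 / real N) * D powr (1 / real N) \<le> real (card {i. f i < D})"
    by simp
qed

theorem theorem1p6:
  assumes "CARD('n::finite) \<ge> 2"
  shows "\<exists>(x :: nat \<Rightarrow> real^'n^'n) (\<alpha>::real) (\<delta>::real). \<alpha> > 0 \<and> \<delta> > 0 \<and>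
    (\<forall>i. periodic (x i)) \<and>
    (\<forall>r \<nu>. strict_mono r \<and> weak_star_limit (\<lambda>k. orbmeas (x (r k))) \<nu> \<longrightarrow>
        emeasure \<nu> (Xset :: (real^'n^'n) set set) < ennreal (1 - \<delta>)) \<and>
    (\<exists>C > 0. \<exists>D0. \<forall>D \<ge> D0.
        C * D powr \<alpha> \<le>
          (\<Sum>i \<in> {i. disc (x i) < D \<and> (\<forall>j<i. orbit (x j) \<noteq> orbit (x i))}. vol (x i)))"
proof -
  note n = assms
  let ?n = "real CARD('n)"
  have "filterlim (\<lambda>a :: nat. ln (real a)) at_top sequentially" by real_asymp
  then have "\<forall>\<^sub>F a :: nat in sequentially. 2 * ?n * ln (2 * ?n) \<le> ln (real a) \<and> 16 \<le> a"
    by (intro eventually_conj eventually_ge_at_top) (simp add: filterlim_at_top)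
  then obtain a0 where a0: "\<And>a. a \<ge> a0 \<Longrightarrow> 2 * ?n * ln (2 * ?n) \<le> ln (real a)" "\<And>a. a \<ge> a0 \<Longrightarrow> 16 \<le> a"
    by (auto simp: eventually_sequentially)
  \<comment> \<open>The shift by a0 makes all thresholds hold from the first index on, since every
    orbit of the sequence has to be periodic.\<close>
  define x where "x i = (pt (i + a0) :: real^'n^'n)" for i
  define T where "T i = ?n * ln (real (i + a0))" for i
  have big: "16 \<le> i + a0" for i using a0(2)[of "i + a0"] by simp
  have inv: "invertible (x i)" for i unfolding x_def by (rule invertible_pt[OF n big])
  have coc: "cocompact_stab (x i) (T i)" for i
  proof
    show "T i > 0" unfolding T_def using big[of i] n by (intro mult_pos_pos) auto
    show "\<exists>s\<in>stab (x i). tmul t s \<in> logbox (T i)" if "t \<in> Hpar" for t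
      unfolding x_def T_def using pt_covering[OF n big a0(1) that] by simp
  qed (rule inv)
  have periodic: "periodic (x i)" for i
    unfolding periodic_def using cocompact_stab.compactin_orbit[OF coc] inv by blast
  note prob = cocompact_stab.inv_prob_orbmeas[OF coc]

  define \<eta> where "\<eta> = 1 / real (2 * (8 * CARD('n)) + 1) ^ CARD('n)"
  have \<eta>: "\<eta> > 0" "\<eta> \<le> 1" by (auto simp: \<eta>_def divide_le_eq)
  \<comment> \<open>Halving \<eta> turns the bound 1 - \<eta> into a strict inequality.\<close>
  have limit: "emeasure \<nu> (Xset :: (real^'n^'n) set set) < ennreal (1 - \<eta> / 2)"
    if r: "strict_mono r" and lim: "weak_star_limit (\<lambda>k. orbmeas (x (r k))) \<nu>" for r \<nu>
  proof -
    have "emeasure \<nu> Xset \<le> ennreal (1 - \<eta>)"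
    proof (rule weak_star_limit_mass_le[OF lim])
      show "prob_space (orbmeas (x (r k)))" "sets (orbmeas (x (r k))) = sets borelX" for k
        using prob[of "r k"] by (auto simp: inv_prob_on_orbit_def)
      fix R
      have "\<forall>\<^sub>F i in sequentially. \<eta> \<le> measure (orbmeas (x i)) {p \<in> Xset. Psi p > R}"
        unfolding x_def \<eta>_def using orbmeas_escape[OF n] by (rule eventually_sequentially_seg[THEN iffD2])
      then show "\<forall>\<^sub>F k in sequentially. \<eta> \<le> measure (orbmeas (x (r k))) {p \<in> Xset. Psi p > R}"
        by (rule eventually_subseq[OF r])
    qed
    also have "\<dots> < ennreal (1 - \<eta> / 2)"
      using \<eta> by (intro ennreal_lessI) auto
    finally show ?thesis .
  qed

  define m where "m = card (pairs CARD('n))"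
  define \<kappa> where "\<kappa> = ?n ^ (3 * (CARD('n) - 1)) / ?n"
  have m: "m > 0" using card_pairs[of "CARD('n)"] n by (cases "m = 0") (auto simp: m_def)
  have \<kappa>: "\<kappa> > 0" by (simp add: \<kappa>_def)
  have disc: "disc (x i) = \<kappa> * (det (x i))\<^sup>2" for i
    unfolding x_def \<kappa>_def by (rule disc_pt[OF n big])
  have det_pos: "det (x i) > 0" for i unfolding x_def by (rule det_pt_pos[OF n big])
  have disc_less: "disc (x i) < disc (x j)" if "i < j" for i j
  proof -
    have "det (x i) < det (x j)" unfolding x_def using that by (intro det_pt_less[OF n big]) simp
    then show ?thesis
      unfolding disc using \<kappa> det_pos[of i] by (intro mult_strict_left_mono power_strict_mono) auto
  qed
  have orbits: "orbit (x j) \<noteq> orbit (x i)" if "j < i" for i j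
  proof
    assume "orbit (x j) = orbit (x i)"
    moreover obtain E E' where "Zbasis (x i) E" "Zbasis (x j) E'"
      unfolding x_def using Zbasis_pt[OF n big] by metis
    ultimately have "disc (x j) = disc (x i)" using disc_orbit_eq[OF inv inv] by blast
    then show False using disc_less[OF that] by simp
  qed
  \<comment> \<open>Linear growth of the discriminant is enough here; over an infinite index set the
    sum of volumes would be 0 by convention.\<close>
  have fin: "finite {i. disc (x i) < D}" for D
  proof (rule finite_subset)
    show "{i. disc (x i) < D} \<subseteq> {i. i < nat \<lceil>2 * D / \<kappa>\<rceil>}"
    proof safe
      fix i assume "disc (x i) < D"
      let ?b = "real (i + a0) / 2"
      have b: "1 \<le> ?b" using big[of i] by simp
      have "?b ^ 1 \<le> ?b ^ m" using b m by (intro power_increasing) auto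
      also have "\<dots> \<le> det (x i)" unfolding x_def m_def by (rule det_pt_bounds(1)[OF n big])
      finally have d: "?b \<le> det (x i)" by simp
      have "?b * 1 \<le> det (x i) * det (x i)" using d b by (intro mult_mono) auto
      then have "\<kappa> * ?b \<le> disc (x i)" unfolding disc using \<kappa> by (simp add: power2_eq_square)
      then have "\<kappa> * ?b < D" using \<open>disc (x i) < D\<close> by simp
      then have "real (i + a0) < 2 * D / \<kappa>" using \<kappa> by (simp add: field_simps)
      then have "real i < 2 * D / \<kappa>" by simp
      then show "i < nat \<lceil>2 * D / \<kappa>\<rceil>" by (simp add: zless_nat_eq_int_zless less_ceiling_iff)
    qed
  qed simp
  have upper: "disc (x i) \<le> (\<kappa> * ?n ^ (2 * m)) * real (i + a0) ^ (2 * m)" for i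
  proof -
    have "(det (x i))\<^sup>2 \<le> ((?n * real (i + a0)) ^ m)\<^sup>2"
      unfolding x_def m_def using det_pt_bounds(2)[OF n big, of i] det_pos[of i]
      by (intro power_mono) (auto simp: x_def)
    also have "\<dots> = ?n ^ (2 * m) * real (i + a0) ^ (2 * m)"
      by (simp add: power_mult_distrib power_mult[symmetric] mult.commute)
    finally show ?thesis unfolding disc using \<kappa> by (simp add: mult.assoc)
  qed

  define v where "v = measure HaarH (sepbox :: ('n \<Rightarrow> real) set)"
  define c where "c = 1 / 2 * (1 / (\<kappa> * ?n ^ (2 * m))) powr (1 / real (2 * m))"
  have v: "v > 0" unfolding v_def by (rule measure_sepbox_pos)
  have vol: "v \<le> vol (x i)" for i unfolding v_def by (rule cocompact_stab.vol_ge[OF coc])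
  have c: "c > 0" using \<kappa> by (simp add: c_def)
  have "2 * m > 0" "\<kappa> * ?n ^ (2 * m) > 0" using m \<kappa> by simp_all
  from card_growth[OF this upper fin]
  obtain D0 where D0: "\<And>D. D \<ge> D0 \<Longrightarrow> c * D powr (1 / real (2 * m)) \<le> real (card {i. disc (x i) < D})"
    unfolding c_def by blast
  have growth: "v * c * D powr (1 / real (2 * m)) \<le>
      (\<Sum>i \<in> {i. disc (x i) < D \<and> (\<forall>j<i. orbit (x j) \<noteq> orbit (x i))}. vol (x i))" if "D \<ge> D0" for D
  proof -
    \<comment> \<open>The discriminants differ, so the orbits are pairwise distinct and the
      condition on earlier indices discards nothing.\<close>
    have eq: "{i. disc (x i) < D \<and> (\<forall>j<i. orbit (x j) \<noteq> orbit (x i))} = {i. disc (x i) < D}"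
      using orbits by blast
    have "v * (c * D powr (1 / real (2 * m))) \<le> v * real (card {i. disc (x i) < D})"
      using D0[OF that] v by (intro mult_left_mono) auto
    also have "\<dots> = (\<Sum>i \<in> {i. disc (x i) < D}. v)" by simp
    also have "\<dots> \<le> (\<Sum>i \<in> {i. disc (x i) < D}. vol (x i))" by (intro sum_mono vol)
    finally show ?thesis unfolding eq by (simp add: mult.assoc)
  qed
  show ?thesis
  proof (intro exI conjI allI impI)
    \<comment> \<open>Here 2 m = n (n - 1), so the exponent is \<alpha> = 1 / (n (n - 1)).\<close>
    show "0 < 1 / real (2 * m)" using m by simp
    show "0 < \<eta> / 2" using \<eta> by simp
    show "periodic (x i)" for i by (rule periodic)
    show "emeasure \<nu> (Xset :: (real^'n^'n) set set) < ennreal (1 - \<eta> / 2)"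
      if "strict_mono r \<and> weak_star_limit (\<lambda>k. orbmeas (x (r k))) \<nu>" for r \<nu>
      using that limit by blast
    show "v * c > 0" using v c by simp
    show "v * c * D powr (1 / real (2 * m)) \<le>
        (\<Sum>i \<in> {i. disc (x i) < D \<and> (\<forall>j<i. orbit (x j) \<noteq> orbit (x i))}. vol (x i))" if "D0 \<le> D" for D
      using that by (rule growth)
  qed
qed

end
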